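(* Let $\mathcal X$ be an RD-space and let $\rho$ be an admissible function on $\mathcal X$. Let $\{Q_t\}_{t>0}$ be a family of operators bounded on $L^2(\mathcal X)$ with integral kernels $\{Q_t(x,y)\}_{t>0}$ such that there exist constants $C_1\in(0,\infty)$, $\delta_1\in(0,\infty)$, $\beta\in(0,1]$, $\delta_2\in(0,1)$ and $\gamma\in(0,\infty)$ such that for all $t\in(0,\infty)$ and $x,x',y\in\mathcal X$ with $d(x,x')\le\frac t2$: (Q)$_{\rm i}$ $|Q_t(x,y)|\le C_1\frac1{V_t(x)+V(x,y)}\left(\frac t{t+d(x,y)}\right)^\gamma\left(\frac{\rho(x)}{t+\rho(x)}\right)^{\delta_1}$; (Q)$_{\rm ii}$ $|Q_t(x,y)-Q_t(x',y)|\le C_1\left(\frac{d(x,x')}{t+d(x,y)}\right)^\beta\frac1{V_t(x)+V(x,y)}\left(\frac t{t+d(x,y)}\right)^\gamma$; (Q)$_{\rm iii}$ $\left|\int_{\mathcal X}Q_t(x,y)\,d\mu(y)\right|\le C_1\left(\frac t{t+\rho(x)}\right)^{\delta_2}$. Let $g(f)(x)=\left(\int_0^\infty|Q_t(f)(x)|^2\frac{dt}t\right)^{1/2}$, and suppose that the operator $g$ is bounded on $L^2(\mathcal X)$. Then there exists a positive constant $C$ such that for all $f\in\mathrm{BMO}_\rho(\mathcal X)$, $g(f)\in\mathrm{BLO}_\rho(\mathcal X)$ and $$\|g(f)\|_{\mathrm{BLO}_\rho(\mathcal X)}\le C\|f\|_{\mathrm{BMO}_\rho(\mathcal X)}.$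$
   Context: RD-space: $(\mathcal X,d)$ is a metric space with a regular Borel measure $\mu$ such that all balls $B(x,r)=\{y: d(x,y)<r\}$ have finite and positive measure; $\mu$ is doubling, i.e. there is $A_1\ge1$ with $\mu(B(x,2r))\le A_1\mu(B(x,r))$ for all $x\in\mathcal X$, $r>0$; and there are $0<\kappa\le n$, $A_2\in(0,1]$, $A_3\in[1,\infty)$ such that $A_2\lambda^\kappa\mu(B(x,r))\le\mu(B(x,\lambda r))\le A_3\lambda^n\mu(B(x,r))$ for all $x\in\mathcal X$, $0<r\le \mathrm{diam}(\mathcal X)/2$ and $1\le\lambda\le \mathrm{diam}(\mathcal X)/(2r)$. Balls are understood together with their center and radius. Write $V_r(x)=\mu(B(x,r))$ and $V(x,y)=\mu(B(x,d(x,y)))$. Admissible function: $\rho:\mathcal X\to(0,\infty)$ is admissible if there are positive constants $C_0,k_0$ such that $\frac1{\rho(x)}\le C_0\frac1{\rho(y)}\left(1+\frac{d(x,y)}{\rho(y)}\right)^{k_0}$ for all $x,y\in\mathcal X$. The operators act through their kernels, $Q_t(f)(x)=\int_{\mathcal X}Q_t(x,y)f(y)\,d\mu(y)$, and $Q_t(x,y)$ is understood to be jointly measurable in $(t,x,y)$ so that $g(f)$ makes sense. $L^1_{\rm loc}(\mathcal X)$ means integrable on every ball; $f_B=\frac1{\mu(B)}\int_B f\,d\mu$. With $\mathcal D$ the collection of balls $B(x,r)$ with $r\ge\rho(x)$, $\mathrm{BMO}_\rho(\mathcal X)$ and $\mathrm{BLO}_\rho(\mathcal X)$ (the latter consisting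 of real-valued functions) are the sets of $f\in L^1_{\rm loc}(\mathcal X)$ for which, respectively, the following are finite: $$\|f\|_{\mathrm{BMO}_\rho(\mathcal X)}=\sup_{B\notin\mathcal D}\frac1{\mu(B)}\int_B|f-f_B|\,d\mu+\sup_{B\in\mathcal D}\frac1{\mu(B)}\int_B|f|\,d\mu,$$ $$\|f\|_{\mathrm{BLO}_\rho(\mathcal X)}=\sup_{B\notin\mathcal D}\frac1{\mu(B)}\int_B\left[f-\operatorname*{ess\,inf}_B f\right]d\mu+\sup_{B\in\mathcal D}\frac1{\mu(B)}\int_B|f|\,d\mu.$$ *)

theory Defs
  imports "HOL-Analysis.Analysis"
begin

(* The space is the whole type; the library's real-valued "diameter" is unspecified on unbounded
   sets, so diam(X) is taken in the extended reals. *)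
definition ediameter :: "'a::metric_space set \<Rightarrow> ereal" where
  "ediameter S = (SUP x\<in>S. SUP y\<in>S. ereal (dist x y))"

(* Regularity is approximation of Borel sets from outside by open sets (Borel regularity of the
   induced outer measure); inner regularity by compact sets is not required. *)
definition regular_borel_measure :: "'a::metric_space measure \<Rightarrow> bool" where
  "regular_borel_measure M \<longleftrightarrow> sets M = sets borel \<and>
     (\<forall>A\<in>sets borel. emeasure M A = (INF U\<in>{U. A \<subseteq> U \<and> open U}. emeasure M U))"

definition RD_space :: "'a::metric_space measure \<Rightarrow> bool" where
  "RD_space M \<longleftrightarrow>
     regular_borel_measure M \<and>
     (\<forall>x r. 0 < r \<longrightarrow> 0 < emeasure M (ball x r) \<and> emeasure M (ball x r) < \<infinity>) \<and>
     (\<exists>A1\<ge>1. \<forall>x r. 0 < r \<longrightarrow> measure M (ball x (2 * r)) \<le> A1 * measure M (ball x r)) \<and>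
     (\<exists>\<kappa> n A2 A3. 0 < \<kappa> \<and> \<kappa> \<le> n \<and> 0 < A2 \<and> A2 \<le> 1 \<and> 1 \<le> A3 \<and>
       (\<forall>x r s. 0 < r \<longrightarrow> ereal r \<le> ediameter (UNIV :: 'a set) / 2 \<longrightarrow>
          1 \<le> s \<longrightarrow> ereal s \<le> ediameter (UNIV :: 'a set) / ereal (2 * r) \<longrightarrow>
          A2 * s powr \<kappa> * measure M (ball x r) \<le> measure M (ball x (s * r)) \<and>
          measure M (ball x (s * r)) \<le> A3 * s powr n * measure M (ball x r)))"

definition vol :: "'a::metric_space measure \<Rightarrow> real \<Rightarrow> 'a \<Rightarrow> real" where
  "vol M r x = measure M (ball x r)"

definition vol2 :: "'a::metric_space measure \<Rightarrow> 'a \<Rightarrow> 'a \<Rightarrow> real" where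
  "vol2 M x y = measure M (ball x (dist x y))"

definition admissible :: "('a::metric_space \<Rightarrow> real) \<Rightarrow> bool" where
  "admissible \<rho> \<longleftrightarrow> (\<forall>x. 0 < \<rho> x) \<and>
     (\<exists>C0>0. \<exists>k0>0. \<forall>x y. 1 / \<rho> x \<le> C0 * (1 / \<rho> y) * (1 + dist x y / \<rho> y) powr k0)"

definition L1_loc :: "'a::metric_space measure \<Rightarrow> ('a \<Rightarrow> 'b::{banach,second_countable_topology}) set" where
  "L1_loc M = {f. \<forall>x r. 0 < r \<longrightarrow> set_integrable M (ball x r) f}"

definition avg :: "'a measure \<Rightarrow> 'a set \<Rightarrow> ('a \<Rightarrow> complex) \<Rightarrow> complex" where
  "avg M B f = (LINT x:B|M. f x) /\<^sub>R measure M B"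

definition ess_inf :: "'a measure \<Rightarrow> 'a set \<Rightarrow> ('a \<Rightarrow> real) \<Rightarrow> ereal" where
  "ess_inf M B f = Sup {c. AE x in M. x \<in> B \<longrightarrow> c \<le> ereal (f x)}"

(* Since a ball carries its centre and radius, the suprema below run over pairs (x, r); the norms
   take values in [0, \<infinity>] and are defined for every locally integrable function. *)
definition small_balls :: "('a \<Rightarrow> real) \<Rightarrow> ('a \<times> real) set" where
  "small_balls \<rho> = {(x, r). 0 < r \<and> r < \<rho> x}"

definition large_balls :: "('a \<Rightarrow> real) \<Rightarrow> ('a \<times> real) set" where
  "large_balls \<rho> = {(x, r). 0 < r \<and> \<rho> x \<le> r}"

definition BMO_norm :: "'a::metric_space measure \<Rightarrow> ('a \<Rightarrow> real) \<Rightarrow> ('a \<Rightarrow> complex) \<Rightarrow> ennreal" where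
  "BMO_norm M \<rho> f =
     (SUP (x, r)\<in>small_balls \<rho>.
        (\<integral>\<^sup>+z\<in>ball x r. ennreal (cmod (f z - avg M (ball x r) f)) \<partial>M) / emeasure M (ball x r)) +
     (SUP (x, r)\<in>large_balls \<rho>.
        (\<integral>\<^sup>+z\<in>ball x r. ennreal (cmod (f z)) \<partial>M) / emeasure M (ball x r))"

definition BMO :: "'a::metric_space measure \<Rightarrow> ('a \<Rightarrow> real) \<Rightarrow> ('a \<Rightarrow> complex) set" where
  "BMO M \<rho> = {f \<in> L1_loc M. BMO_norm M \<rho> f < \<infinity>}"

(* f - ess_inf is nonnegative almost everywhere on the ball, so e2ennreal truncates only on a null
   set; if the essential infimum is -\<infinity> the integral is \<infinity>. *)
definition BLO_norm :: "'a::metric_space measure \<Rightarrow> ('a \<Rightarrow> real) \<Rightarrow> ('a \<Rightarrow> real) \<Rightarrow> ennreal" where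
  "BLO_norm M \<rho> f =
     (SUP (x, r)\<in>small_balls \<rho>.
        (\<integral>\<^sup>+z\<in>ball x r. e2ennreal (ereal (f z) - ess_inf M (ball x r) f) \<partial>M)
          / emeasure M (ball x r)) +
     (SUP (x, r)\<in>large_balls \<rho>.
        (\<integral>\<^sup>+z\<in>ball x r. ennreal \<bar>f z\<bar> \<partial>M) / emeasure M (ball x r))"

definition BLO :: "'a::metric_space measure \<Rightarrow> ('a \<Rightarrow> real) \<Rightarrow> ('a \<Rightarrow> real) set" where
  "BLO M \<rho> = {f \<in> L1_loc M. BLO_norm M \<rho> f < \<infinity>}"

definition L2 :: "'a measure \<Rightarrow> ('a \<Rightarrow> 'b::{banach,second_countable_topology}) set" where
  "L2 M = {f \<in> borel_measurable M. integrable M (\<lambda>x. (norm (f x))\<^sup>2)}"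

definition L2norm :: "'a measure \<Rightarrow> ('a \<Rightarrow> 'b::{banach,second_countable_topology}) \<Rightarrow> real" where
  "L2norm M f = sqrt (\<integral>x. (norm (f x))\<^sup>2 \<partial>M)"

definition L2_bounded ::
  "'a measure \<Rightarrow> (('a \<Rightarrow> complex) \<Rightarrow> 'a \<Rightarrow> 'b::{banach,second_countable_topology}) \<Rightarrow> bool" where
  "L2_bounded M T \<longleftrightarrow> (\<exists>K. \<forall>f\<in>L2 M. T f \<in> L2 M \<and> L2norm M (T f) \<le> K * L2norm M f)"

definition kernel_op :: "'a measure \<Rightarrow> ('a \<Rightarrow> 'a \<Rightarrow> complex) \<Rightarrow> ('a \<Rightarrow> complex) \<Rightarrow> 'a \<Rightarrow> complex" where
  "kernel_op M K f x = (\<integral>y. K x y * f y \<partial>M)"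

definition g_square ::
  "'a measure \<Rightarrow> (real \<Rightarrow> 'a \<Rightarrow> 'a \<Rightarrow> complex) \<Rightarrow> ('a \<Rightarrow> complex) \<Rightarrow> 'a \<Rightarrow> ennreal" where
  "g_square M Q f x = (\<integral>\<^sup>+t\<in>{0<..}. ennreal ((cmod (kernel_op M (Q t) f x))\<^sup>2 / t) \<partial>lborel)"

(* As enn2real sends \<infinity> to 0, every use of g_function is paired with the requirement that g_square
   is finite almost everywhere. *)
definition g_function ::
  "'a measure \<Rightarrow> (real \<Rightarrow> 'a \<Rightarrow> 'a \<Rightarrow> complex) \<Rightarrow> ('a \<Rightarrow> complex) \<Rightarrow> 'a \<Rightarrow> real" where
  "g_function M Q f x = sqrt (enn2real (g_square M Q f x))"

end

theory Submission
  imports Defs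
begin

text \<open>
Let \<open>f\<close> have localized BMO norm below \<open>b\<close>. Attach to every ball \<open>B = ball x r\<close> the reference constant
\<open>a x r\<close>, which is the average of \<open>f\<close> over \<open>B\<close> if \<open>r < \<rho> x\<close> and zero otherwise. Then the mean of \<open>|f - a x r|\<close>
over \<open>B\<close> is at most \<open>b\<close> for every ball, and since consecutive dyadic constants differ by a multiple of \<open>b\<close>,
\<open>a x r\<close> is at most a multiple of \<open>b\<close> times any prescribed positive power of \<open>(r + \<rho> x) / r\<close>
(\<open>oscillation_constant_growth\<close>). The cancellation condition is strong enough to absorb this growth.

Fix a ball \<open>B\<close> of radius \<open>r\<close> and cut the integral that defines the square of \<open>g f\<close> at \<open>t = 4 * r\<close> into a local
part \<open>L\<close> and a tail \<open>T\<close>.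

The mean of \<open>L\<close> over \<open>B\<close> is at most a multiple of \<open>b\<^sup>2\<close> (\<open>square_local\<close>). To see this, subtract from \<open>f\<close> the
constant \<open>d\<close> of the doubled ball. The part of \<open>f - d\<close> on the doubled ball is square integrable by the
John-Nirenberg inequality (\<open>john_nirenberg_square\<close>), so the boundedness of \<open>g\<close> on \<open>L\<^sup>2\<close> takes care of it. The
part outside the doubled ball and the constant \<open>d\<close> contribute a positive power of \<open>t / r\<close>, by the decay of the
kernel and by cancellation respectively (\<open>kernel_op_local\<close>).

For two points of \<open>B\<close> and \<open>t \<ge> 4 * r\<close> the operators differ by at most a multiple of
\<open>b * (r / t) powr (\<beta> / 2)\<close>, which follows from smoothness and cancellation together (\<open>kernel_op_smooth\<close>). By the
triangle inequality in \<open>L\<^sup>2(dt / t)\<close> the square root of \<open>T\<close> varies on \<open>B\<close> by at most a multiple of \<open>b\<close>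
(\<open>square_tail_compare\<close>). Therefore almost everywhere on \<open>B\<close>, \<open>g f\<close> exceeds its essential infimum over \<open>B\<close> by
at most the square root of \<open>L\<close> plus a multiple of \<open>b\<close>, which is the BLO estimate (\<open>g_function_lower_oscillation\<close>). If \<open>r \<ge> \<rho> x\<close>, the decay
in \<open>\<rho> / t\<close> of the kernels bounds \<open>T\<close> itself (\<open>square_tail_large\<close>), which gives the estimate of the mean of \<open>g f\<close>
and, since such balls exhaust the space, also its finiteness almost everywhere.

The John-Nirenberg inequality is proved by a stopping time argument at one level, followed by absorption: an
a priori bound for the mean square oscillation, available for truncated functions, improves itself
(\<open>oscillation_square_improve\<close>). The covering argument behind it is the Vitali lemma for metric spaces
(\<open>maximal_disjoint_balls\<close>), and outer regularity of the measure is used instead of differentiation of integrals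
(\<open>set_integral_le_of_small_balls\<close>).
\<close>

section \<open>Doubling measures and the Vitali covering lemma\<close>

text \<open>
\<open>A\<close> is a doubling constant. Approximation of Borel sets from outside by open sets takes the place of
the Lebesgue differentiation theorem below, so averages never have to converge pointwise.
\<close>

locale doubling_measure =
  fixes M :: "'a::metric_space measure" and A :: real
  assumes sets_eq_borel: "sets M = sets borel"
    and outer_regular: "E \<in> sets borel \<Longrightarrow> emeasure M E = (INF U\<in>{U. E \<subseteq> U \<and> open U}. emeasure M U)"
    and emeasure_ball_pos: "0 < r \<Longrightarrow> 0 < emeasure M (ball x r)"
    and emeasure_ball_finite: "0 < r \<Longrightarrow> emeasure M (ball x r) < \<infinity>"
    and A_ge_1: "1 \<le> A"
    and doubling: "0 < r \<Longrightarrow> measure M (ball x (2 * r)) \<le> A * measure M (ball x r)"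
begin

abbreviation V :: "'a \<Rightarrow> real \<Rightarrow> real" where
  "V x r \<equiv> measure M (ball x r)"

lemma space_eq_UNIV: "space M = UNIV"
  using sets_eq_imp_space_eq[OF sets_eq_borel] by simp

lemma open_in_sets: "open U \<Longrightarrow> U \<in> sets M"
  by (simp add: sets_eq_borel)

lemma ball_in_sets [measurable]: "ball x r \<in> sets M"
  by (simp add: open_in_sets)

lemma emeasure_ball: "emeasure M (ball x r) = ennreal (V x r)"
proof (cases "0 < r")
  case True
  then show ?thesis
    using emeasure_ball_finite[OF True, of x] by (intro emeasure_eq_ennreal_measure) auto
next
  case False
  then show ?thesis by (simp add: ball_empty)
qed

lemma V_pos: "0 < r \<Longrightarrow> 0 < V x r"
  using emeasure_ball_pos[of r x] by (simp add: emeasure_ball)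

lemma V_mono: "ball x r \<subseteq> ball y s \<Longrightarrow> V x r \<le> V y s"
  using emeasure_mono[of "ball x r" "ball y s" M] by (simp add: emeasure_ball)

lemma V_pow2: "0 < r \<Longrightarrow> V x (2 ^ k * r) \<le> A ^ k * V x r"
proof (induction k)
  case (Suc k)
  have "V x (2 ^ Suc k * r) \<le> A * V x (2 ^ k * r)"
    using doubling[of "2 ^ k * r" x] Suc.prems by (simp add: mult.assoc)
  also have "\<dots> \<le> A * (A ^ k * V x r)"
    using Suc A_ge_1 by (intro mult_left_mono) auto
  finally show ?case by (simp add: mult.assoc)
qed simp

text \<open>
Comparison of balls with different centres: \<open>ball y s\<close> sits inside \<open>ball x (2 ^ k * r)\<close>.
\<close>

lemma V_le:
  assumes "0 < r" and "s \<le> 2 ^ k * r - dist x y"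
  shows "V y s \<le> A ^ k * V x r"
proof -
  have "ball y s \<subseteq> ball x (2 ^ k * r)"
  proof
    fix z assume "z \<in> ball y s"
    then show "z \<in> ball x (2 ^ k * r)"
      using assms dist_triangle[of x z y] by simp
  qed
  then show ?thesis
    using V_mono V_pow2[OF assms(1), of x k] order_trans by blast
qed

lemma sigma_finite_measure: "sigma_finite_measure M"
proof
  show "\<exists>S. countable S \<and> S \<subseteq> sets M \<and> \<Union> S = space M \<and> (\<forall>a\<in>S. emeasure M a \<noteq> \<infinity>)"
  proof (intro exI conjI)
    let ?S = "range (\<lambda>n. ball (undefined::'a) (real n))"
    show "\<Union> ?S = space M"
      using reals_Archimedean2 by (auto simp: space_eq_UNIV)
    show "countable ?S" by simp
    show "?S \<subseteq> sets M" by auto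
    show "\<forall>a\<in>?S. emeasure M a \<noteq> \<infinity>" by (auto simp: emeasure_ball)
  qed
qed

end

text \<open>
The Vitali covering lemma in a metric space. Zorn's lemma is applied to the disjoint subfamilies that
already satisfy the conclusion for every ball they meet: a ball that meets the subfamily meets a member
of at least half its radius. If some ball missed a maximal subfamily, one of nearly largest radius among
the missing balls could be added without destroying this property.
\<close>

lemma maximal_disjoint_balls:
  fixes r :: "'a::metric_space \<Rightarrow> real"
  assumes r: "\<And>x. x \<in> K \<Longrightarrow> 0 < r x \<and> r x \<le> R"
  obtains C where "C \<subseteq> K" "disjoint_family_on (\<lambda>x. ball x (r x)) C"
    "K \<subseteq> (\<Union>x\<in>C. ball x (5 * r x))"
proof -
  define meets where "meets x y \<longleftrightarrow> ball x (r x) \<inter> ball y (r y) \<noteq> {}" for x y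
  define F where "F = {C. C \<subseteq> K \<and> disjoint_family_on (\<lambda>x. ball x (r x)) C \<and>
    (\<forall>x\<in>K. (\<exists>y\<in>C. meets x y) \<longrightarrow> (\<exists>y\<in>C. meets x y \<and> r x \<le> 2 * r y))}"
  have "\<exists>C\<in>F. \<forall>X\<in>F. C \<subseteq> X \<longrightarrow> X = C"
  proof (rule subset_Zorn)
    fix \<C> assume chain: "subset.chain F \<C>"
    then have sub: "\<C> \<subseteq> F" by (simp add: subset.chain_def)
    have "\<Union>\<C> \<in> F"
      unfolding F_def
    proof (intro CollectI conjI ballI impI)
      show "\<Union>\<C> \<subseteq> K" using sub by (auto simp: F_def)
      show "disjoint_family_on (\<lambda>x. ball x (r x)) (\<Union>\<C>)"
        unfolding disjoint_family_on_def
      proof (intro ballI impI)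
        fix x y assume "x \<in> \<Union>\<C>" "y \<in> \<Union>\<C>" and ne: "x \<noteq> y"
        then obtain C D where "C \<in> \<C>" "D \<in> \<C>" "x \<in> C" "y \<in> D" by auto
        moreover from this have "C \<subseteq> D \<or> D \<subseteq> C"
          using chain by (simp add: subset_chain_def)
        ultimately obtain E where "E \<in> \<C>" "x \<in> E" "y \<in> E" by blast
        then show "ball x (r x) \<inter> ball y (r y) = {}"
          using sub ne by (auto simp: F_def disjoint_family_on_def)
      qed
      fix x assume "x \<in> K" "\<exists>y\<in>\<Union>\<C>. meets x y"
      then show "\<exists>y\<in>\<Union>\<C>. meets x y \<and> r x \<le> 2 * r y"
        using sub unfolding F_def by blast
    qed
    then show "\<exists>U\<in>F. \<forall>X\<in>\<C>. X \<subseteq> U" by blast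
  qed
  then obtain C where C: "C \<in> F" and max: "\<And>X. X \<in> F \<Longrightarrow> C \<subseteq> X \<Longrightarrow> X = C" by blast
  have hit: "\<exists>y\<in>C. meets x y" if "x \<in> K" for x
  proof (rule ccontr)
    assume no: "\<not> ?thesis"
    define L where "L = {x\<in>K. \<forall>y\<in>C. \<not> meets x y}"
    have ne: "r ` L \<noteq> {}" using that no by (auto simp: L_def)
    have bdd: "bdd_above (r ` L)" using r by (auto simp: L_def intro!: bdd_aboveI[of _ R])
    have "0 < Sup (r ` L)"
      using r that no by (intro less_cSup_iff[THEN iffD2, OF ne bdd]) (auto simp: L_def)
    then have "Sup (r ` L) / 2 < Sup (r ` L)" by simp
    (* Half of the supremum suffices; the radii of the missed balls need not attain it. *)
    then obtain z where z: "z \<in> L" "Sup (r ` L) / 2 < r z"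
      using less_cSup_iff[OF ne bdd] by blast
    have big: "r w \<le> 2 * r z" if "w \<in> L" for w
      using cSup_upper[OF _ bdd, of "r w"] that z(2) by auto
    have "insert z C \<in> F"
      unfolding F_def
    proof (intro CollectI conjI ballI impI)
      show "insert z C \<subseteq> K" using C z by (auto simp: F_def L_def)
      show "disjoint_family_on (\<lambda>x. ball x (r x)) (insert z C)"
        using C z by (auto simp: F_def L_def disjoint_family_on_def meets_def)
      fix x assume "x \<in> K" and m: "\<exists>y\<in>insert z C. meets x y"
      show "\<exists>y\<in>insert z C. meets x y \<and> r x \<le> 2 * r y"
      proof (cases "\<exists>y\<in>C. meets x y")
        case True
        then show ?thesis using C \<open>x \<in> K\<close> by (auto simp: F_def)
      next
        case False
        then have "x \<in> L" "meets x z" using m \<open>x \<in> K\<close> by (auto simp: L_def)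
        then show ?thesis using big by blast
      qed
    qed
    then have "z \<in> C" using max[of "insert z C"] by blast
    moreover have "meets z z" using z r[of z] by (auto simp: meets_def L_def)
    ultimately show False using z by (auto simp: L_def)
  qed
  have "K \<subseteq> (\<Union>x\<in>C. ball x (5 * r x))"
  proof
    fix x assume x: "x \<in> K"
    then obtain y where y: "y \<in> C" "meets x y" "r x \<le> 2 * r y"
      using hit[OF x] C unfolding F_def by blast
    then obtain w where "dist x w < r x" "dist y w < r y" by (auto simp: meets_def)
    moreover have "0 < r x" using r[OF x] by simp
    ultimately have "dist y x < 5 * r y"
      using y(3) dist_triangle2[of y x w] by linarith
    then show "x \<in> (\<Union>x\<in>C. ball x (5 * r x))" using y by auto
  qed
  then show thesis
    using C that unfolding F_def by blast
qed

context doubling_measure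
begin

text \<open>
The measures of the balls are positive and their finite sums stay below the measure of \<open>W\<close>, so only
countably many balls fit.
\<close>

lemma countable_disjoint_balls:
  assumes dis: "disjoint_family_on (\<lambda>x. ball x (r x)) C" and pos: "\<And>x. x \<in> C \<Longrightarrow> 0 < r x"
    and sub: "\<And>x. x \<in> C \<Longrightarrow> ball x (r x) \<subseteq> W" and W: "W \<in> sets M" "emeasure M W < \<infinity>"
  shows "countable C"
proof -
  have "(\<Sum>x\<in>X. V x (r x)) \<le> measure M W" if X: "finite X" "X \<subseteq> C" for X
  proof -
    have "(\<Sum>x\<in>X. V x (r x)) = measure M (\<Union>x\<in>X. ball x (r x))"
      using X disjoint_family_on_mono[OF X(2) dis]
      by (intro measure_finite_Union[symmetric]) (auto simp: emeasure_ball)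
    also have "\<dots> \<le> measure M W"
      using X sub W by (intro measure_mono_fmeasurable) (auto simp: fmeasurable_def intro!: sets.finite_UN)
    finally show ?thesis .
  qed
  then have "(\<lambda>x. V x (r x)) summable_on C"
    by (intro nonneg_bdd_above_summable_on) (auto intro!: bdd_aboveI[of _ "measure M W"])
  then have "countable {x\<in>C. V x (r x) \<noteq> 0}"
    by (rule summable_countable_real)
  also have "{x\<in>C. V x (r x) \<noteq> 0} = C"
    using V_pos pos by (auto simp: less_imp_neq[symmetric])
  finally show ?thesis .
qed

text \<open>
Local estimates between a ball and its fivefold dilate add up, because the small balls selected by the
covering lemma are disjoint while their dilates cover \<open>K\<close>. Since \<open>K\<close> need not be measurable, the
conclusion is about an open set \<open>G\<close> that contains it.
\<close>

lemma vitali_estimate: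
  fixes \<phi> h :: "'a \<Rightarrow> ennreal"
  assumes [measurable]: "\<phi> \<in> borel_measurable M" "h \<in> borel_measurable M"
    and r: "\<And>x. x \<in> K \<Longrightarrow> 0 < r x \<and> r x \<le> R"
    and sub: "\<And>x. x \<in> K \<Longrightarrow> ball x (r x) \<subseteq> W" and W: "W \<in> sets M" "emeasure M W < \<infinity>"
    and est: "\<And>x. x \<in> K \<Longrightarrow> (\<integral>\<^sup>+y\<in>ball x (5 * r x). \<phi> y \<partial>M) \<le> D * (\<integral>\<^sup>+y\<in>ball x (r x). h y \<partial>M)"
  obtains G where "open G" "K \<subseteq> G" "(\<integral>\<^sup>+y\<in>G. \<phi> y \<partial>M) \<le> D * (\<integral>\<^sup>+y\<in>W. h y \<partial>M)"
proof -
  obtain C where CK: "C \<subseteq> K" and dis: "disjoint_family_on (\<lambda>x. ball x (r x)) C"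
    and cov: "K \<subseteq> (\<Union>x\<in>C. ball x (5 * r x))"
    by (rule maximal_disjoint_balls[of K r R, OF r])
  have C: "countable C"
    using CK r sub by (intro countable_disjoint_balls[OF dis _ _ W]) auto
  define G where "G = (\<Union>x\<in>C. ball x (5 * r x))"
  have "(\<integral>\<^sup>+y\<in>G. \<phi> y \<partial>M) \<le> (\<integral>\<^sup>+y. (\<integral>\<^sup>+x. \<phi> y * indicator (ball x (5 * r x)) y \<partial>count_space C) \<partial>M)"
  proof (intro nn_integral_mono)
    fix y show "\<phi> y * indicator G y \<le> (\<integral>\<^sup>+x. \<phi> y * indicator (ball x (5 * r x)) y \<partial>count_space C)"
    proof (cases "y \<in> G")
      case True
      then obtain x where "x \<in> C" "y \<in> ball x (5 * r x)" by (auto simp: G_def)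
      then show ?thesis
        using nn_integral_ge_point[of x C "\<lambda>x. \<phi> y * indicator (ball x (5 * r x)) y"] True by simp
    qed simp
  qed
  also have "\<dots> = (\<integral>\<^sup>+x. (\<integral>\<^sup>+y\<in>ball x (5 * r x). \<phi> y \<partial>M) \<partial>count_space C)"
    by (rule nn_integral_count_space_nn_integral[OF C]) measurable
  also have "\<dots> \<le> (\<integral>\<^sup>+x. D * (\<integral>\<^sup>+y\<in>ball x (r x). h y \<partial>M) \<partial>count_space C)"
    using est CK by (intro nn_integral_mono) auto
  also have "\<dots> = D * (\<integral>\<^sup>+x. emeasure (density M h) (ball x (r x)) \<partial>count_space C)"
    by (simp add: nn_integral_cmult emeasure_density)
  also have "(\<integral>\<^sup>+x. emeasure (density M h) (ball x (r x)) \<partial>count_space C)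
      = emeasure (density M h) (\<Union>x\<in>C. ball x (r x))"
    using C dis by (intro emeasure_UN_countable[symmetric]) auto
  also have "\<dots> \<le> emeasure (density M h) W"
    using sub CK W by (intro emeasure_mono) auto
  also have "\<dots> = (\<integral>\<^sup>+y\<in>W. h y \<partial>M)"
    using W by (simp add: emeasure_density)
  finally have "(\<integral>\<^sup>+y\<in>G. \<phi> y \<partial>M) \<le> D * (\<integral>\<^sup>+y\<in>W. h y \<partial>M)"
    by (simp add: mult_left_mono)
  moreover have "open G" unfolding G_def by auto
  ultimately show thesis using that cov unfolding G_def by blast
qed

lemma emeasure_ball_5_le: "0 < r \<Longrightarrow> emeasure M (ball x (5 * r)) \<le> ennreal (A ^ 3) * emeasure M (ball x r)"
  using V_le[of r "5 * r" 3 x x] A_ge_1 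
  by (simp add: emeasure_ball ennreal_mult[symmetric])

text \<open>
A substitute for Lebesgue differentiation: if at every point of \<open>E\<close> arbitrarily small balls have mean
of \<open>h\<close> at most \<open>c\<close>, then the mean over \<open>E\<close> is controlled as well. One covers \<open>E\<close> by such balls inside
an open set \<open>U\<close> of almost the same measure. The factor \<open>A ^ 3\<close>, the price of a fivefold dilation, is
harmless for the purpose.
\<close>

lemma set_integral_le_of_small_balls:
  fixes h :: "'a \<Rightarrow> ennreal" and c :: real
  assumes "0 < c" and h [measurable]: "h \<in> borel_measurable M" and E: "E \<in> sets M" "emeasure M E < \<infinity>"
    and small: "\<And>x \<delta>. x \<in> E \<Longrightarrow> 0 < \<delta> \<Longrightarrow>
       \<exists>s. 0 < s \<and> s \<le> \<delta> \<and> (\<integral>\<^sup>+y\<in>ball x s. h y \<partial>M) \<le> ennreal c * emeasure M (ball x s)"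
  shows "(\<integral>\<^sup>+y\<in>E. h y \<partial>M) \<le> ennreal c * ennreal (A ^ 3) * emeasure M E"
proof -
  let ?D = "ennreal c * ennreal (A ^ 3)"
  have le_open: "(\<integral>\<^sup>+y\<in>E. h y \<partial>M) \<le> ?D * emeasure M U" if U: "E \<subseteq> U" "open U" "emeasure M U < \<infinity>" for U
  proof -
    have "\<exists>s. 0 < s \<and> s \<le> 1 \<and> ball x s \<subseteq> U \<and>
        (\<integral>\<^sup>+y\<in>ball x (5 * s). h y \<partial>M) \<le> ennreal c * emeasure M (ball x (5 * s))" if x: "x \<in> E" for x
    proof -
      obtain e where e: "0 < e" "ball x e \<subseteq> U"
        using U x open_contains_ball by blast
      obtain s where s: "0 < s" "s \<le> min 1 e" "(\<integral>\<^sup>+y\<in>ball x s. h y \<partial>M) \<le> ennreal c * emeasure M (ball x s)"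
        using small[OF x, of "min 1 e"] e by auto
      then show ?thesis
        using e by (intro exI[of _ "s / 5"]) (auto intro: order_trans[OF _ e(2)])
    qed
    then obtain r where r: "\<And>x. x \<in> E \<Longrightarrow> 0 < r x \<and> r x \<le> 1 \<and> ball x (r x) \<subseteq> U \<and>
        (\<integral>\<^sup>+y\<in>ball x (5 * r x). h y \<partial>M) \<le> ennreal c * emeasure M (ball x (5 * r x))"
      by metis
    have est: "(\<integral>\<^sup>+y\<in>ball x (5 * r x). h y \<partial>M) \<le> ?D * (\<integral>\<^sup>+y\<in>ball x (r x). 1 \<partial>M)" if x: "x \<in> E" for x
    proof -
      have "(\<integral>\<^sup>+y\<in>ball x (5 * r x). h y \<partial>M) \<le> ennreal c * emeasure M (ball x (5 * r x))"
        using r[OF x] by simp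
      also have "\<dots> \<le> ennreal c * (ennreal (A ^ 3) * emeasure M (ball x (r x)))"
        using r[OF x] by (intro mult_left_mono emeasure_ball_5_le) auto
      finally show ?thesis by (simp add: mult.assoc)
    qed
    obtain G where "open G" "E \<subseteq> G" "(\<integral>\<^sup>+y\<in>G. h y \<partial>M) \<le> ?D * (\<integral>\<^sup>+y\<in>U. 1 \<partial>M)"
    proof (rule vitali_estimate[of h "\<lambda>_. 1" E r 1 U ?D])
      show "U \<in> sets M" "emeasure M U < \<infinity>" using U open_in_sets by auto
    qed (use r est in auto)
    moreover have "(\<integral>\<^sup>+y\<in>E. h y \<partial>M) \<le> (\<integral>\<^sup>+y\<in>G. h y \<partial>M)"
      using \<open>E \<subseteq> G\<close> by (intro nn_integral_mono) (auto simp: indicator_def)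
    ultimately show ?thesis
      using open_in_sets[OF U(2)] by simp
  qed
  have D: "?D \<noteq> 0" "?D \<noteq> \<infinity>"
    using \<open>0 < c\<close> A_ge_1 by (auto simp: ennreal_mult[symmetric])
  have "(\<integral>\<^sup>+y\<in>E. h y \<partial>M) / ?D \<le> (INF U\<in>{U. E \<subseteq> U \<and> open U}. emeasure M U)"
  proof (rule INF_greatest, safe)
    fix U assume U: "E \<subseteq> U" "open U"
    show "(\<integral>\<^sup>+y\<in>E. h y \<partial>M) / ?D \<le> emeasure M U"
    proof (cases "emeasure M U < \<infinity>")
      case True
      then show ?thesis
        using le_open[OF U] D by (intro divide_le_posI_ennreal) (auto simp: zero_less_iff_neq_zero)
    next
      case False
      then show ?thesis by (simp add: less_top[symmetric])
    qed
  qed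
  then have "(\<integral>\<^sup>+y\<in>E. h y \<partial>M) / ?D \<le> emeasure M E"
    using E(1) outer_regular[of E] by (simp add: sets_eq_borel)
  then have "?D * ((\<integral>\<^sup>+y\<in>E. h y \<partial>M) / ?D) \<le> ?D * emeasure M E"
    by (rule mult_left_mono) simp
  moreover have "?D * ((\<integral>\<^sup>+y\<in>E. h y \<partial>M) / ?D) = (\<integral>\<^sup>+y\<in>E. h y \<partial>M)"
    unfolding ennreal_times_divide mult.commute[of ?D] using D by (intro ennreal_mult_divide_eq) auto
  ultimately show ?thesis by simp
qed

end

section \<open>Mean oscillation and the John-Nirenberg inequality\<close>

text \<open>
The reference constants \<open>a x r\<close> are part of the data instead of being the averages of \<open>f\<close>. This makes
the notion stable under Lipschitz maps applied to \<open>f\<close> and \<open>a\<close> at once, with the same bound, and it lets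
one notion cover small balls (where \<open>a x r\<close> is the average) and large balls (where it is zero).
\<close>

definition oscillation_le ::
  "'a::metric_space measure \<Rightarrow> ('a \<Rightarrow> complex) \<Rightarrow> ('a \<Rightarrow> real \<Rightarrow> complex) \<Rightarrow> real \<Rightarrow> bool" where
  "oscillation_le M f a b \<longleftrightarrow> f \<in> borel_measurable M \<and> 0 < b \<and>
     (\<forall>x r. 0 < r \<longrightarrow>
       (\<integral>\<^sup>+y\<in>ball x r. ennreal (cmod (f y - a x r)) \<partial>M) \<le> ennreal (b * measure M (ball x r)))"

lemma oscillation_leD:
  assumes "oscillation_le M f a b"
  shows "f \<in> borel_measurable M" "0 < b"
    "0 < r \<Longrightarrow> (\<integral>\<^sup>+y\<in>ball x r. ennreal (cmod (f y - a x r)) \<partial>M) \<le> ennreal (b * measure M (ball x r))"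
  using assms by (auto simp: oscillation_le_def)

lemma set_nn_integral_mono_set:
  "S \<subseteq> T \<Longrightarrow> (\<integral>\<^sup>+y\<in>S. h y \<partial>M) \<le> (\<integral>\<^sup>+y\<in>T. h y \<partial>M)"
  by (intro nn_integral_mono) (auto simp: indicator_def)

context doubling_measure
begin

lemma set_nn_integral_const_ball: "0 \<le> c \<Longrightarrow> (\<integral>\<^sup>+y\<in>ball x r. ennreal c \<partial>M) = ennreal (c * V x r)"
  by (simp add: nn_integral_cmult_indicator emeasure_ball ennreal_mult)

lemma set_nn_integral_shift:
  assumes [measurable]: "f \<in> borel_measurable M"
    and "(\<integral>\<^sup>+y\<in>ball x r. ennreal (cmod (f y - c)) \<partial>M) \<le> ennreal (p * V x r)" and "0 \<le> p"
  shows "(\<integral>\<^sup>+y\<in>ball x r. ennreal (cmod (f y - c')) \<partial>M) \<le> ennreal ((p + cmod (c - c')) * V x r)"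
proof -
  have "(\<integral>\<^sup>+y\<in>ball x r. ennreal (cmod (f y - c')) \<partial>M)
      \<le> (\<integral>\<^sup>+y. ennreal (cmod (f y - c)) * indicator (ball x r) y
            + ennreal (cmod (c - c')) * indicator (ball x r) y \<partial>M)"
  proof (intro nn_integral_mono)
    fix y
    have "cmod (f y - c') \<le> cmod (f y - c) + cmod (c - c')"
      by (metis diff_add_cancel add_diff_eq norm_triangle_ineq)
    then show "ennreal (cmod (f y - c')) * indicator (ball x r) y
        \<le> ennreal (cmod (f y - c)) * indicator (ball x r) y + ennreal (cmod (c - c')) * indicator (ball x r) y"
      by (auto simp: indicator_def ennreal_plus[symmetric] simp del: ennreal_plus)
  qed
  also have "\<dots> = (\<integral>\<^sup>+y\<in>ball x r. ennreal (cmod (f y - c)) \<partial>M) + (\<integral>\<^sup>+y\<in>ball x r. ennreal (cmod (c - c')) \<partial>M)"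
    by (intro nn_integral_add) auto
  also have "\<dots> \<le> ennreal (p * V x r) + ennreal (cmod (c - c') * V x r)"
    using assms(2) by (intro add_mono) (auto simp: set_nn_integral_const_ball)
  also have "\<dots> = ennreal ((p + cmod (c - c')) * V x r)"
    using assms(3) by (simp add: ennreal_plus[symmetric] algebra_simps del: ennreal_plus)
  finally show ?thesis .
qed

lemma cmod_diff_le_of_means:
  assumes [measurable]: "f \<in> borel_measurable M" and r: "0 < r"
    and p: "(\<integral>\<^sup>+y\<in>ball x r. ennreal (cmod (f y - c)) \<partial>M) \<le> ennreal (p * V x r)" "0 \<le> p"
    and q: "(\<integral>\<^sup>+y\<in>ball x r. ennreal (cmod (f y - c')) \<partial>M) \<le> ennreal (q * V x r)" "0 \<le> q"
  shows "cmod (c - c') \<le> p + q"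
proof -
  have "ennreal (cmod (c - c') * V x r) = (\<integral>\<^sup>+y\<in>ball x r. ennreal (cmod (c - c')) \<partial>M)"
    by (simp add: set_nn_integral_const_ball)
  also have "\<dots> \<le> (\<integral>\<^sup>+y. ennreal (cmod (f y - c)) * indicator (ball x r) y
            + ennreal (cmod (f y - c')) * indicator (ball x r) y \<partial>M)"
  proof (intro nn_integral_mono)
    fix y
    have "cmod (c - c') \<le> cmod (f y - c) + cmod (f y - c')"
      using norm_triangle_ineq4[of "f y - c'" "f y - c"] by (simp add: algebra_simps)
    then show "ennreal (cmod (c - c')) * indicator (ball x r) y
        \<le> ennreal (cmod (f y - c)) * indicator (ball x r) y + ennreal (cmod (f y - c')) * indicator (ball x r) y"
      by (auto simp: indicator_def ennreal_plus[symmetric] simp del: ennreal_plus)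
  qed
  also have "\<dots> = (\<integral>\<^sup>+y\<in>ball x r. ennreal (cmod (f y - c)) \<partial>M) + (\<integral>\<^sup>+y\<in>ball x r. ennreal (cmod (f y - c')) \<partial>M)"
    by (intro nn_integral_add) auto
  also have "\<dots> \<le> ennreal (p * V x r) + ennreal (q * V x r)"
    using p q by (intro add_mono) auto
  also have "\<dots> = ennreal ((p + q) * V x r)"
    using p q by (simp add: ennreal_plus[symmetric] algebra_simps del: ennreal_plus)
  finally have "cmod (c - c') * V x r \<le> (p + q) * V x r"
    using p q by (subst (asm) ennreal_le_iff) auto
  then show ?thesis using V_pos[OF r, of x] by simp
qed

lemma oscillation_subball:
  assumes osc: "oscillation_le M f a b" and "0 < s"
    and sub: "ball x r \<subseteq> ball y s" and D: "V y s \<le> D * V x r"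
  shows "(\<integral>\<^sup>+z\<in>ball x r. ennreal (cmod (f z - a y s)) \<partial>M) \<le> ennreal ((D * b) * V x r)"
proof -
  have "(\<integral>\<^sup>+z\<in>ball x r. ennreal (cmod (f z - a y s)) \<partial>M) \<le> (\<integral>\<^sup>+z\<in>ball y s. ennreal (cmod (f z - a y s)) \<partial>M)"
    using sub by (rule set_nn_integral_mono_set)
  also have "\<dots> \<le> ennreal (b * V y s)" using osc \<open>0 < s\<close> by (rule oscillation_leD)
  also have "\<dots> \<le> ennreal ((D * b) * V x r)"
    using mult_left_mono[OF D, of b] oscillation_leD(2)[OF osc] by (intro ennreal_leI) (simp add: ac_simps)
  finally show ?thesis .
qed

lemma oscillation_compare:
  assumes osc: "oscillation_le M f a b" and r: "0 < r" "0 < s"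
    and sub: "ball x r \<subseteq> ball y s" and D: "V y s \<le> D * V x r"
  shows "cmod (a x r - a y s) \<le> (1 + D) * b"
proof -
  have "0 \<le> D * V x r" using D measure_nonneg[of M "ball y s"] by linarith
  then have "0 \<le> D" using V_pos[OF r(1), of x] by (simp add: zero_le_mult_iff)
  then have "cmod (a x r - a y s) \<le> b + D * b"
    using oscillation_leD[OF osc] r
    by (intro cmod_diff_le_of_means[OF _ r(1) _ _ oscillation_subball[OF osc r(2) sub D]]) auto
  then show ?thesis by (simp add: algebra_simps)
qed

text \<open>
One step of the John-Nirenberg argument: an a priori bound \<open>S\<close> for the mean square oscillation is
improved to \<open>S / 2\<close> plus a multiple of \<open>b\<^sup>2\<close>. With \<open>h = |f - a x0 R|\<close>, stop at the first dyadic radius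
at which the mean of \<open>h\<close> exceeds the level \<open>l\<close>. On the dilated stopping balls the constant has moved by
at most \<open>2 * l\<close>, so the mean of \<open>h\<^sup>2\<close> there is at most \<open>2 * S + 8 * l\<^sup>2\<close>; the
stopping balls fill only a small fraction of the ball because \<open>l\<close> is a large multiple of \<open>b\<close>. Off the
stopping balls \<open>h\<close> is bounded by a multiple of \<open>l\<close>. The factor \<open>4 * (2 + A) * A ^ 4\<close> in \<open>l\<close> is what makes
the fraction small enough to turn \<open>2 * S\<close> into \<open>S / 2\<close>.
\<close>

lemma oscillation_square_improve:
  assumes osc: "oscillation_le M f a b" and S: "0 \<le> S"
    and sq: "\<And>x r. 0 < r \<Longrightarrow> (\<integral>\<^sup>+y\<in>ball x r. ennreal ((cmod (f y - a x r))\<^sup>2) \<partial>M) \<le> ennreal (S * V x r)"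
    and R: "0 < R"
  defines "l \<equiv> 4 * (2 + A) * A ^ 4 * b"
  shows "(\<integral>\<^sup>+y\<in>ball x0 R. ennreal ((cmod (f y - a x0 R))\<^sup>2) \<partial>M)
    \<le> ennreal ((S / 2 + 2 * l\<^sup>2 + (2 * l * A ^ 3)\<^sup>2) * V x0 R)"
proof -
  note [measurable] = oscillation_leD(1)[OF osc]
  have b: "0 < b" and A: "1 \<le> A" "0 < A" using oscillation_leD(2)[OF osc] A_ge_1 by auto
  have l: "0 < l" using A b by (simp add: l_def)
  define h where "h y = cmod (f y - a x0 R)" for y
  have [measurable]: "h \<in> borel_measurable M" unfolding h_def by measurable
  define D where "D = (2 * S + 8 * l\<^sup>2) * A ^ 3 / l"
  have D: "0 \<le> D" using S l A by (simp add: D_def)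
  have double: "(\<integral>\<^sup>+y\<in>ball x0 (2 * R). ennreal (h y) \<partial>M) \<le> ennreal ((2 + A) * b * V x0 (2 * R))"
  proof -
    have "cmod (a x0 R - a x0 (2 * R)) \<le> (1 + A) * b"
      using R doubling[OF R, of x0] by (intro oscillation_compare[OF osc]) auto
    then have "b + cmod (a x0 (2 * R) - a x0 R) \<le> (2 + A) * b"
      by (simp add: norm_minus_commute algebra_simps)
    moreover have "(\<integral>\<^sup>+y\<in>ball x0 (2 * R). ennreal (h y) \<partial>M)
        \<le> ennreal ((b + cmod (a x0 (2 * R) - a x0 R)) * V x0 (2 * R))"
      unfolding h_def using R b oscillation_leD[OF osc] by (intro set_nn_integral_shift) auto
    ultimately show ?thesis
      by (elim order_trans) (intro ennreal_leI mult_right_mono, auto)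
  qed
  (* At the radius R itself the mean is at most l, so the stopping index is positive and twice the stopping
     radius is again a dyadic radius, at which the mean is still at most l. *)
  have top_scale: "(\<integral>\<^sup>+y\<in>ball x R. ennreal (h y) \<partial>M) \<le> ennreal (l * V x R)" if x: "x \<in> ball x0 R" for x
  proof -
    have "ball x R \<subseteq> ball x0 (2 * R)"
    proof
      fix z assume "z \<in> ball x R"
      then show "z \<in> ball x0 (2 * R)" using x dist_triangle[of x0 z x] by simp
    qed
    then have "(\<integral>\<^sup>+y\<in>ball x R. ennreal (h y) \<partial>M) \<le> ennreal ((2 + A) * b * V x0 (2 * R))"
      by (rule order_trans[OF set_nn_integral_mono_set double])
    also have "\<dots> \<le> ennreal (l * V x R)"
    proof (rule ennreal_leI)
      have "V x0 (2 * R) \<le> A ^ 2 * V x R"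
        using V_le[OF R, of "2 * R" 2 x x0] x R by (simp add: dist_commute)
      then have "(2 + A) * b * V x0 (2 * R) \<le> ((2 + A) * b * A ^ 2) * V x R"
        using A b by (simp add: mult.assoc)
      also have "A ^ 2 \<le> 4 * A ^ 4"
        using power_increasing[of 2 4 A] zero_le_power[of A 4] A by linarith
      then have "(2 + A) * b * A ^ 2 \<le> l"
        using mult_left_mono[of "A ^ 2" "4 * A ^ 4" "(2 + A) * b"] A b unfolding l_def
        by (simp add: ac_simps del: distrib_left_numeral distrib_right_numeral)
      then have "((2 + A) * b * A ^ 2) * V x R \<le> l * V x R" by (simp add: mult_right_mono)
      finally show "(2 + A) * b * V x0 (2 * R) \<le> l * V x R" .
    qed
    finally show ?thesis .
  qed
  define bad where "bad x j \<longleftrightarrow> \<not> (\<integral>\<^sup>+y\<in>ball x (R / 2 ^ j). ennreal (h y) \<partial>M) \<le> ennreal (l * V x (R / 2 ^ j))" for x j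
  define K where "K = {x \<in> ball x0 R. \<exists>j. bad x j}"
  define j where "j x = (LEAST j. bad x j)" for x
  define s where "s x = R / 2 ^ j x" for x
  have s: "0 < s x" "s x \<le> R" "\<not> (\<integral>\<^sup>+y\<in>ball x (s x). ennreal (h y) \<partial>M) \<le> ennreal (l * V x (s x))"
    "(\<integral>\<^sup>+y\<in>ball x (2 * s x). ennreal (h y) \<partial>M) \<le> ennreal (l * V x (2 * s x))" if x: "x \<in> K" for x
  proof -
    show "0 < s x" "s x \<le> R" using R by (auto simp: s_def divide_le_eq_1 field_simps)
    have "bad x (j x)" unfolding j_def using x by (auto simp: K_def intro: LeastI)
    then show "\<not> (\<integral>\<^sup>+y\<in>ball x (s x). ennreal (h y) \<partial>M) \<le> ennreal (l * V x (s x))"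
      by (simp add: bad_def s_def)
    have "j x \<noteq> 0"
    proof
      assume "j x = 0"
      then have "bad x 0" using \<open>bad x (j x)\<close> by simp
      moreover have "\<not> bad x 0" using top_scale[of x] x by (simp add: bad_def K_def)
      ultimately show False by contradiction
    qed
    then obtain i where i: "j x = Suc i" using not0_implies_Suc by blast
    then have "\<not> bad x i" unfolding j_def using not_less_Least[of i "bad x"] by simp
    then show "(\<integral>\<^sup>+y\<in>ball x (2 * s x). ennreal (h y) \<partial>M) \<le> ennreal (l * V x (2 * s x))"
      by (simp add: bad_def s_def i)
  qed
  have est: "(\<integral>\<^sup>+y\<in>ball x (5 * s x). ennreal ((h y)\<^sup>2) \<partial>M) \<le> ennreal D * (\<integral>\<^sup>+y\<in>ball x (s x). ennreal (h y) \<partial>M)"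
    if x: "x \<in> K" for x
  proof -
    note s = s[OF x]
    let ?a = "a x (8 * s x)"
    have "cmod (a x (2 * s x) - ?a) \<le> (1 + A ^ 2) * b"
      using s(1) V_pow2[of "2 * s x" x 2] by (intro oscillation_compare[OF osc]) auto
    moreover have "cmod (a x (2 * s x) - a x0 R) \<le> b + l"
      using s(1,4) b l oscillation_leD[OF osc]
      by (intro cmod_diff_le_of_means[where f = f and r = "2 * s x" and x = x]) (auto simp: h_def)
    moreover have "(2 + A ^ 2) * b \<le> l"
    proof -
      have "2 + A ^ 2 \<le> 4 * (2 + A) * A ^ 4"
      proof -
        have "A ^ 2 \<le> A ^ 4" "1 \<le> A ^ 4"
          using A power_increasing[of 2 4 A] by auto
        then have "1 * A ^ 2 \<le> (2 + A) * A ^ 4"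
          using A by (intro mult_mono) auto
        moreover have "3 * 1 \<le> (2 + A) * A ^ 4" using A \<open>1 \<le> A ^ 4\<close> by (intro mult_mono) auto
        ultimately show ?thesis unfolding mult.assoc[of 4] by linarith
      qed
      then show ?thesis using b by (simp add: l_def)
    qed
    moreover have "cmod (?a - a x0 R) \<le> cmod (a x (2 * s x) - ?a) + cmod (a x (2 * s x) - a x0 R)"
      using norm_triangle_ineq4[of "a x (2 * s x) - a x0 R" "a x (2 * s x) - ?a"] by (simp add: algebra_simps)
    ultimately have c: "cmod (?a - a x0 R) \<le> 2 * l"
      by (simp add: algebra_simps)
    have "(\<integral>\<^sup>+y\<in>ball x (5 * s x). ennreal ((h y)\<^sup>2) \<partial>M) \<le> (\<integral>\<^sup>+y\<in>ball x (8 * s x). ennreal ((h y)\<^sup>2) \<partial>M)"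
      using s(1) by (intro set_nn_integral_mono_set subset_ball) auto
    also have "\<dots> \<le> (\<integral>\<^sup>+y. 2 * (ennreal ((cmod (f y - ?a))\<^sup>2) * indicator (ball x (8 * s x)) y)
        + ennreal (8 * l\<^sup>2) * indicator (ball x (8 * s x)) y \<partial>M)"
    proof (intro nn_integral_mono)
      fix y
      have "h y \<le> cmod (f y - ?a) + 2 * l"
        using c norm_triangle_ineq[of "f y - ?a" "?a - a x0 R"] by (simp add: h_def)
      then have "(h y)\<^sup>2 \<le> (cmod (f y - ?a) + 2 * l)\<^sup>2"
        by (intro power_mono) (auto simp: h_def)
      also have "\<dots> \<le> 2 * (cmod (f y - ?a))\<^sup>2 + 8 * l\<^sup>2"
        using sum_squares_bound[of "cmod (f y - ?a)" "2 * l"] by (simp add: power2_sum power_mult_distrib)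
      finally have "ennreal ((h y)\<^sup>2) \<le> ennreal (2 * (cmod (f y - ?a))\<^sup>2 + 8 * l\<^sup>2)"
        by (rule ennreal_leI)
      then show "ennreal ((h y)\<^sup>2) * indicator (ball x (8 * s x)) y
          \<le> 2 * (ennreal ((cmod (f y - ?a))\<^sup>2) * indicator (ball x (8 * s x)) y)
            + ennreal (8 * l\<^sup>2) * indicator (ball x (8 * s x)) y"
        by (auto simp: indicator_def ennreal_mult)
    qed
    also have "\<dots> = 2 * (\<integral>\<^sup>+y\<in>ball x (8 * s x). ennreal ((cmod (f y - ?a))\<^sup>2) \<partial>M)
        + (\<integral>\<^sup>+y\<in>ball x (8 * s x). ennreal (8 * l\<^sup>2) \<partial>M)"
      by (subst nn_integral_add) (auto simp: nn_integral_cmult)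
    also have "\<dots> \<le> 2 * ennreal (S * V x (8 * s x)) + ennreal (8 * l\<^sup>2 * V x (8 * s x))"
      using s(1) by (intro add_mono mult_left_mono sq) (auto simp: set_nn_integral_const_ball)
    also have "\<dots> = ennreal ((2 * S + 8 * l\<^sup>2) * V x (8 * s x))"
    proof -
      have "2 * ennreal (S * V x (8 * s x)) = ennreal (2 * (S * V x (8 * s x)))"
        using S by (simp add: ennreal_mult)
      then show ?thesis
        using S by (simp add: ennreal_plus[symmetric] algebra_simps del: ennreal_plus)
    qed
    also have "\<dots> \<le> ennreal (D * (l * V x (s x)))"
    proof (rule ennreal_leI)
      have "(2 * S + 8 * l\<^sup>2) * V x (8 * s x) \<le> (2 * S + 8 * l\<^sup>2) * (A ^ 3 * V x (s x))"
        using S V_pow2[OF s(1), of x 3] by (intro mult_left_mono) auto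
      then show "(2 * S + 8 * l\<^sup>2) * V x (8 * s x) \<le> D * (l * V x (s x))"
        using l by (simp add: D_def ac_simps)
    qed
    also have "\<dots> = ennreal D * ennreal (l * V x (s x))"
      using D l by (simp add: ennreal_mult)
    also have "\<dots> \<le> ennreal D * (\<integral>\<^sup>+y\<in>ball x (s x). ennreal (h y) \<partial>M)"
      using s(3) by (intro mult_left_mono) auto
    finally show ?thesis .
  qed
  (* The dilated stopping balls are collected in the open set G. *)
  obtain G where G: "open G" "K \<subseteq> G"
    and Gint: "(\<integral>\<^sup>+y\<in>G. ennreal ((h y)\<^sup>2) \<partial>M) \<le> ennreal D * (\<integral>\<^sup>+y\<in>ball x0 (2 * R). ennreal (h y) \<partial>M)"
  proof (rule vitali_estimate[of "\<lambda>y. ennreal ((h y)\<^sup>2)" "\<lambda>y. ennreal (h y)" K s R "ball x0 (2 * R)" "ennreal D"])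
    fix x assume x: "x \<in> K"
    show "0 < s x \<and> s x \<le> R" using s[OF x] by simp
    show "ball x (s x) \<subseteq> ball x0 (2 * R)"
    proof
      fix z assume "z \<in> ball x (s x)"
      then show "z \<in> ball x0 (2 * R)"
        using x s(2)[OF x] dist_triangle[of x0 z x] by (simp add: K_def)
    qed
  qed (use est R emeasure_ball in auto)
  (* Outside G no dyadic radius stops, so small balls have mean at most l. *)
  have good: "AE y in M. y \<in> ball x0 R - G \<longrightarrow> h y \<le> 2 * l * A ^ 3"
  proof -
    define E where "E = {y \<in> space M. y \<in> ball x0 R - G \<and> 2 * l * A ^ 3 < h y}"
    have [measurable]: "G \<in> sets M" using G open_in_sets by blast
    have E[measurable]: "E \<in> sets M" unfolding E_def by measurable
    have EV: "emeasure M E \<le> ennreal (V x0 R)"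
      unfolding emeasure_ball[symmetric] by (intro emeasure_mono) (auto simp: E_def)
    have "(\<integral>\<^sup>+y\<in>E. ennreal (h y) \<partial>M) \<le> ennreal l * ennreal (A ^ 3) * emeasure M E"
    proof (rule set_integral_le_of_small_balls)
      show "emeasure M E < \<infinity>" using EV by (auto intro: le_less_trans)
      fix x and \<delta> :: real assume x: "x \<in> E" and \<delta>: "0 < \<delta>"
      obtain n where "R / \<delta> < 2 ^ n" using real_arch_pow[of 2 "R / \<delta>"] by auto
      then have n: "R / 2 ^ n \<le> \<delta>" using \<delta> by (simp add: field_simps)
      have "\<not> bad x n" using x G by (auto simp: E_def K_def)
      then show "\<exists>s>0. s \<le> \<delta> \<and> (\<integral>\<^sup>+y\<in>ball x s. ennreal (h y) \<partial>M) \<le> ennreal l * emeasure M (ball x s)"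
        using R n l by (intro exI[of _ "R / 2 ^ n"]) (auto simp: bad_def emeasure_ball ennreal_mult)
    qed (use l in auto)
    moreover have "ennreal (2 * l * A ^ 3) * emeasure M E \<le> (\<integral>\<^sup>+y\<in>E. ennreal (h y) \<partial>M)"
      unfolding nn_integral_cmult_indicator[OF E, symmetric]
      by (intro nn_integral_mono) (auto simp: E_def indicator_def intro!: ennreal_leI)
    ultimately have *: "ennreal (2 * l * A ^ 3) * emeasure M E \<le> ennreal (l * A ^ 3) * emeasure M E"
      using l A by (simp add: ennreal_mult)
    have Efin: "emeasure M E = ennreal (measure M E)"
      using EV by (intro emeasure_eq_ennreal_measure) (auto simp: top_unique)
    have "2 * l * A ^ 3 * measure M E \<le> l * A ^ 3 * measure M E"
      using * l A unfolding Efin by (simp add: ennreal_mult[symmetric] del: ennreal_mult'')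
    then have "l * A ^ 3 * measure M E \<le> 0" by linarith
    then have "measure M E = 0"
      using l A by (simp add: mult_le_0_iff measure_le_0_iff)
    then have "emeasure M E = 0" using Efin by simp
    then show ?thesis
      using E by (intro AE_I[of _ _ E]) (auto simp: E_def space_eq_UNIV)
  qed
  have [measurable]: "G \<in> sets M" using G open_in_sets by blast
  have "(\<integral>\<^sup>+y\<in>ball x0 R. ennreal ((h y)\<^sup>2) \<partial>M)
      \<le> (\<integral>\<^sup>+y. ennreal ((2 * l * A ^ 3)\<^sup>2) * indicator (ball x0 R) y + ennreal ((h y)\<^sup>2) * indicator G y \<partial>M)"
  proof (rule nn_integral_mono_AE, use good in \<open>rule AE_mp\<close>, intro AE_I2 impI)
    fix y assume y: "y \<in> ball x0 R - G \<longrightarrow> h y \<le> 2 * l * A ^ 3"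
    have "(h y)\<^sup>2 \<le> (2 * l * A ^ 3)\<^sup>2" if "y \<in> ball x0 R - G"
      using y that by (intro power_mono) (auto simp: h_def)
    then show "ennreal ((h y)\<^sup>2) * indicator (ball x0 R) y
       \<le> ennreal ((2 * l * A ^ 3)\<^sup>2) * indicator (ball x0 R) y + ennreal ((h y)\<^sup>2) * indicator G y"
      by (cases "y \<in> ball x0 R"; cases "y \<in> G") (auto intro!: ennreal_leI)
  qed
  also have "\<dots> = (\<integral>\<^sup>+y\<in>ball x0 R. ennreal ((2 * l * A ^ 3)\<^sup>2) \<partial>M) + (\<integral>\<^sup>+y\<in>G. ennreal ((h y)\<^sup>2) \<partial>M)"
    by (intro nn_integral_add) auto
  also have "\<dots> \<le> ennreal ((2 * l * A ^ 3)\<^sup>2 * V x0 R) + ennreal D * ennreal ((2 + A) * b * V x0 (2 * R))"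
    by (intro add_mono) (auto simp: set_nn_integral_const_ball intro!: order_trans[OF Gint mult_left_mono[OF double]])
  also have "\<dots> = ennreal ((2 * l * A ^ 3)\<^sup>2 * V x0 R + D * ((2 + A) * b * V x0 (2 * R)))"
    using D A b by (simp add: ennreal_mult[symmetric] del: ennreal_mult'')
  also have "\<dots> \<le> ennreal ((S / 2 + 2 * l\<^sup>2 + (2 * l * A ^ 3)\<^sup>2) * V x0 R)"
  proof (rule ennreal_leI)
    have "D * ((2 + A) * b * V x0 (2 * R)) \<le> D * ((2 + A) * b * (A * V x0 R))"
      using D A b doubling[OF R, of x0] by (intro mult_left_mono) auto
    also have "\<dots> = (S / 2 + 2 * l\<^sup>2) * V x0 R"
    proof -
      have "D * ((2 + A) * b * A) = (2 * S + 8 * l\<^sup>2) * (((2 + A) * A ^ 4 * b) / l)"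
        by (simp add: D_def power_numeral_reduce)
      also have "((2 + A) * A ^ 4 * b) / l = 1 / 4"
        using l unfolding l_def by (simp add: field_simps)
      finally have "D * ((2 + A) * b * A) = S / 2 + 2 * l\<^sup>2" by simp
      then show ?thesis by (simp add: mult.assoc[symmetric])
    qed
    finally show "(2 * l * A ^ 3)\<^sup>2 * V x0 R + D * ((2 + A) * b * V x0 (2 * R))
        \<le> (S / 2 + 2 * l\<^sup>2 + (2 * l * A ^ 3)\<^sup>2) * V x0 R"
      by (simp add: algebra_simps)
  qed
  finally show ?thesis by (simp add: h_def)
qed

text \<open>
Iterating the improvement drives the a priori bound out: after \<open>n\<close> steps it enters only as \<open>S / 2 ^ n\<close>.
\<close>

lemma oscillation_square_bounded:
  assumes osc: "oscillation_le M f a b" and S: "0 \<le> S"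
    and sq: "\<And>x r. 0 < r \<Longrightarrow> (\<integral>\<^sup>+y\<in>ball x r. ennreal ((cmod (f y - a x r))\<^sup>2) \<partial>M) \<le> ennreal (S * V x r)"
    and R: "0 < R"
  defines "l \<equiv> 4 * (2 + A) * A ^ 4 * b"
  defines "c \<equiv> 2 * l\<^sup>2 + (2 * l * A ^ 3)\<^sup>2"
  shows "(\<integral>\<^sup>+y\<in>ball x R. ennreal ((cmod (f y - a x R))\<^sup>2) \<partial>M) \<le> ennreal (2 * c * V x R)"
proof -
  have c: "0 \<le> c" by (simp add: c_def)
  have step: "(\<integral>\<^sup>+y\<in>ball x r. ennreal ((cmod (f y - a x r))\<^sup>2) \<partial>M) \<le> ennreal ((S / 2 ^ n + 2 * c) * V x r)"
    if "0 < r" for x r n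
    using that
  proof (induction n arbitrary: x r)
    case 0
    have "ennreal (S * V x r) \<le> ennreal ((S / 2 ^ 0 + 2 * c) * V x r)"
      using c by (intro ennreal_leI mult_right_mono) auto
    then show ?case using sq[OF 0, of x] by (rule order_trans[rotated])
  next
    case (Suc n)
    have "(\<integral>\<^sup>+y\<in>ball x r. ennreal ((cmod (f y - a x r))\<^sup>2) \<partial>M)
        \<le> ennreal (((S / 2 ^ n + 2 * c) / 2 + 2 * l\<^sup>2 + (2 * l * A ^ 3)\<^sup>2) * V x r)"
      unfolding l_def
      using S c Suc by (intro oscillation_square_improve[OF osc]) auto
    also have "(S / 2 ^ n + 2 * c) / 2 + 2 * l\<^sup>2 + (2 * l * A ^ 3)\<^sup>2 = S / 2 ^ Suc n + 2 * c"
      by (simp add: c_def field_simps)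
    finally show ?case .
  qed
  have "(\<lambda>n. S / 2 ^ n) \<longlonglongrightarrow> 0"
    using LIMSEQ_divide_realpow_zero[of 2 S] by simp
  then have "(\<lambda>n. ennreal ((S / 2 ^ n + 2 * c) * V x R)) \<longlonglongrightarrow> ennreal ((0 + 2 * c) * V x R)"
    by (intro tendsto_ennrealI tendsto_intros)
  then show ?thesis
    using step[OF R, of x] by (intro LIMSEQ_le_const[of _ "ennreal (2 * c * V x R)"]) auto
qed

text \<open>
The square mean form of the John-Nirenberg inequality. The a priori bound needed for the iteration is
obtained by composing \<open>f\<close> and the constants with the nearest point projection \<open>T k\<close> to the disc of radius
\<open>k\<close>; it is 1-Lipschitz and hence does not increase the oscillation, and the resulting estimate does not
depend on \<open>k\<close>, so that Fatou's lemma applies.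
\<close>

theorem john_nirenberg_square:
  obtains J where "0 < J"
    "\<And>f a b x r. oscillation_le M f a b \<Longrightarrow> 0 < r \<Longrightarrow>
       (\<integral>\<^sup>+y\<in>ball x r. ennreal ((cmod (f y - a x r))\<^sup>2) \<partial>M) \<le> ennreal (J * b\<^sup>2 * V x r)"
proof
  define m where "m = 4 * (2 + A) * A ^ 4"
  define J where "J = 2 * (2 * m\<^sup>2 + (2 * m * A ^ 3)\<^sup>2)"
  have m: "0 < m" using A_ge_1 by (simp add: m_def)
  then show "0 < J" using A_ge_1 by (simp add: J_def add_pos_nonneg)
  fix f a b x and r :: real
  assume osc: "oscillation_le M f a b" and r: "0 < r"
  note [measurable] = oscillation_leD(1)[OF osc]
  define T where "T k = closest_point (cball (0::complex) (real k))" for k :: nat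
  have T_bound: "cmod (T k z) \<le> real k" for k z
    using closest_point_in_set[of "cball (0::complex) (real k)" z] by (simp add: T_def)
  have T_lip: "cmod (T k z - T k w) \<le> cmod (z - w)" for k z w
    using closest_point_lipschitz[of "cball (0::complex) (real k)" z w] by (simp add: T_def dist_norm)
  have T_id: "T k z = z" if "cmod z \<le> real k" for k z
    using that by (auto simp: T_def intro!: closest_point_self)
  have T_meas [measurable]: "T k \<in> borel_measurable borel" for k
    unfolding T_def by (intro borel_measurable_continuous_onI continuous_on_closest_point) auto
  have bound: "(\<integral>\<^sup>+y\<in>ball x r. ennreal ((cmod (T k (f y) - T k (a x r)))\<^sup>2) \<partial>M) \<le> ennreal (J * b\<^sup>2 * V x r)" for k
  proof -
    have "oscillation_le M (\<lambda>y. T k (f y)) (\<lambda>x r. T k (a x r)) b"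
      unfolding oscillation_le_def
    proof (intro conjI allI impI)
      fix x and r :: real assume r: "0 < r"
      have "(\<integral>\<^sup>+y\<in>ball x r. ennreal (cmod (T k (f y) - T k (a x r))) \<partial>M)
          \<le> (\<integral>\<^sup>+y\<in>ball x r. ennreal (cmod (f y - a x r)) \<partial>M)"
        by (intro nn_integral_mono mult_right_mono ennreal_leI T_lip) auto
      also have "\<dots> \<le> ennreal (b * V x r)" using osc r by (rule oscillation_leD)
      finally show "(\<integral>\<^sup>+y\<in>ball x r. ennreal (cmod (T k (f y) - T k (a x r))) \<partial>M) \<le> ennreal (b * V x r)" .
    qed (use oscillation_leD[OF osc] in auto)
    moreover have "(\<integral>\<^sup>+y\<in>ball x r. ennreal ((cmod (T k (f y) - T k (a x r)))\<^sup>2) \<partial>M) \<le> ennreal ((2 * real k)\<^sup>2 * V x r)"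
      for x r
    proof -
      have "cmod (T k (f y) - T k (a x r)) \<le> 2 * real k" for y
        using norm_triangle_ineq4[of "T k (f y)" "T k (a x r)"] T_bound[of k "f y"] T_bound[of k "a x r"] by linarith
      then have "(\<integral>\<^sup>+y\<in>ball x r. ennreal ((cmod (T k (f y) - T k (a x r)))\<^sup>2) \<partial>M)
          \<le> (\<integral>\<^sup>+y\<in>ball x r. ennreal ((2 * real k)\<^sup>2) \<partial>M)"
        by (intro nn_integral_mono mult_right_mono ennreal_leI power_mono) auto
      then show ?thesis by (simp add: set_nn_integral_const_ball)
    qed
    ultimately have "(\<integral>\<^sup>+y\<in>ball x r. ennreal ((cmod (T k (f y) - T k (a x r)))\<^sup>2) \<partial>M)
       \<le> ennreal (2 * (2 * (4 * (2 + A) * A ^ 4 * b)\<^sup>2 + (2 * (4 * (2 + A) * A ^ 4 * b) * A ^ 3)\<^sup>2) * V x r)"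
      using r by (intro oscillation_square_bounded[where S = "(2 * real k)\<^sup>2"]) auto
    also have "2 * (2 * (4 * (2 + A) * A ^ 4 * b)\<^sup>2 + (2 * (4 * (2 + A) * A ^ 4 * b) * A ^ 3)\<^sup>2) = J * b\<^sup>2"
      unfolding J_def m_def[symmetric] by (simp add: power2_eq_square algebra_simps)
    finally show ?thesis .
  qed
  have lim: "liminf (\<lambda>k. ennreal ((cmod (T k (f y) - T k (a x r)))\<^sup>2) * indicator (ball x r) y)
      = ennreal ((cmod (f y - a x r))\<^sup>2) * indicator (ball x r) y" for y
  proof (intro lim_imp_Liminf tendsto_eventually)
    obtain n where n: "cmod (f y) + cmod (a x r) \<le> real n" using real_arch_simple by blast
    show "\<forall>\<^sub>F k in sequentially. ennreal ((cmod (T k (f y) - T k (a x r)))\<^sup>2) * indicator (ball x r) y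
      = ennreal ((cmod (f y - a x r))\<^sup>2) * indicator (ball x r) y"
      using eventually_ge_at_top[of n]
    proof eventually_elim
      case (elim k)
      then have "real n \<le> real k" by simp
      then have "T k (f y) = f y" "T k (a x r) = a x r"
        using n norm_ge_zero[of "f y"] norm_ge_zero[of "a x r"] by (intro T_id; linarith)+
      then show ?case by simp
    qed
  qed simp
  have "(\<integral>\<^sup>+y\<in>ball x r. ennreal ((cmod (f y - a x r))\<^sup>2) \<partial>M)
      = (\<integral>\<^sup>+y. liminf (\<lambda>k. ennreal ((cmod (T k (f y) - T k (a x r)))\<^sup>2) * indicator (ball x r) y) \<partial>M)"
    unfolding lim ..
  also have "\<dots> \<le> liminf (\<lambda>k. \<integral>\<^sup>+y. ennreal ((cmod (T k (f y) - T k (a x r)))\<^sup>2) * indicator (ball x r) y \<partial>M)"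
    by (intro nn_integral_liminf) measurable
  also have "\<dots> \<le> liminf (\<lambda>k. ennreal (J * b\<^sup>2 * V x r))"
    using bound by (intro Liminf_mono) auto
  also have "\<dots> = ennreal (J * b\<^sup>2 * V x r)"
    by (intro Liminf_const) simp
  finally show "(\<integral>\<^sup>+y\<in>ball x r. ennreal ((cmod (f y - a x r))\<^sup>2) \<partial>M) \<le> ennreal (J * b\<^sup>2 * V x r)" .
qed

end

section \<open>Growth of the reference constants and decaying kernels\<close>

lemma dyadic_shell:
  fixes d s :: real
  assumes "0 < s" "s \<le> d"
  obtains k :: nat where "2 ^ k * s \<le> d" "d < 2 ^ Suc k * s"
proof -
  define P where "P n \<longleftrightarrow> d < 2 ^ n * s" for n :: nat
  obtain n :: nat where "d / s < 2 ^ n" using real_arch_pow[of 2 "d / s"] by auto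
  then have "P n" using assms by (simp add: P_def field_simps)
  then have L: "P (LEAST n. P n)" by (rule LeastI)
  moreover have "\<not> P 0" using assms by (simp add: P_def)
  ultimately have "(LEAST n. P n) \<noteq> 0" by metis
  then obtain k where k: "(LEAST n. P n) = Suc k" using not0_implies_Suc by blast
  then have "\<not> P k" using not_less_Least[of k P] by simp
  then show thesis using that[of k] L k by (simp add: P_def not_less)
qed

text \<open>
The Poisson-type majorant of the kernels, without the factor that measures \<open>t\<close> against \<open>\<rho>\<close>.
\<close>

definition decay_kernel :: "'a::metric_space measure \<Rightarrow> real \<Rightarrow> real \<Rightarrow> 'a \<Rightarrow> 'a \<Rightarrow> real" where
  "decay_kernel M \<gamma> t x y = 1 / (vol M t x + vol2 M x y) * (t / (t + dist x y)) powr \<gamma>"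

lemma decay_kernel_nonneg [simp]: "0 \<le> decay_kernel M \<gamma> t x y"
  by (simp add: decay_kernel_def vol_def vol2_def)

context doubling_measure
begin

text \<open>
Taking \<open>f = 1\<close> and \<open>a = 0\<close> turns every estimate for \<open>f - a\<close> below into one for the kernel itself.
\<close>

lemma oscillation_one: "oscillation_le M (\<lambda>_. 1) (\<lambda>_ _. 0) 1"
  by (simp add: oscillation_le_def emeasure_ball)

lemma oscillation_dyadic:
  assumes osc: "oscillation_le M f a b" and r: "0 < r"
  shows "cmod (a x (2 ^ k * r) - a x r) \<le> real k * ((1 + A) * b)"
proof (induction k)
  case (Suc k)
  have "cmod (a x (2 ^ k * r) - a x (2 ^ Suc k * r)) \<le> (1 + A) * b"
  proof (rule oscillation_compare[OF osc])
    show "V x (2 ^ Suc k * r) \<le> A * V x (2 ^ k * r)"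
      using doubling[of "2 ^ k * r" x] r by (simp add: mult.assoc)
  qed (use r in \<open>auto intro!: subset_ball\<close>)
  then have "cmod (a x (2 ^ Suc k * r) - a x r) \<le> (1 + A) * b + real k * ((1 + A) * b)"
    using Suc norm_triangle_ineq[of "a x (2 ^ Suc k * r) - a x (2 ^ k * r)" "a x (2 ^ k * r) - a x r"]
    by (simp add: norm_minus_commute)
  then show ?case by (simp add: algebra_simps)
qed simp

text \<open>
The reference constants change by at most \<open>(1 + A) * b\<close> per doubling of the radius, so vanishing from
radius \<open>R\<close> on forces at most logarithmic size in \<open>R / r\<close>. A power with an arbitrarily small exponent is
the convenient form: the exponent is later matched to that of the cancellation condition.
\<close>

lemma oscillation_constant_growth:
  assumes \<epsilon>: "0 < \<epsilon>"
  obtains C where "0 < C"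
    "\<And>f a b x r R. oscillation_le M f a b \<Longrightarrow> 0 < r \<Longrightarrow> 0 < R \<Longrightarrow> (\<And>s. R \<le> s \<Longrightarrow> a x s = 0) \<Longrightarrow>
       cmod (a x r) \<le> C * b * ((r + R) / r) powr \<epsilon>"
proof
  define C where "C = (1 + A) * (1 / (\<epsilon> * ln 2) + 1)"
  show "0 < C" using \<epsilon> A_ge_1 by (auto simp: C_def intro!: mult_pos_pos add_pos_nonneg add_nonneg_pos)
  fix f a b and x :: 'a and r R :: real
  assume osc: "oscillation_le M f a b" and r: "0 < r" and R: "0 < R"
    and zero: "\<And>s. R \<le> s \<Longrightarrow> a x s = 0"
  have b: "0 < b" using osc by (rule oscillation_leD)
  define u where "u = (r + R) / r"
  have u: "1 \<le> u" using r R by (simp add: u_def)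
  define k where "k = nat \<lceil>log 2 u\<rceil>"
  have k: "real k \<le> log 2 u + 1"
    using zero_le_log_cancel_iff[of 2 u] u unfolding k_def by linarith
  have "log 2 u \<le> real k" unfolding k_def by linarith
  then have "u \<le> 2 powr real k" using u by (simp add: log_le_iff)
  then have "u \<le> 2 ^ k" by (simp add: powr_realpow)
  then have "u * r \<le> 2 ^ k * r" using r by (intro mult_right_mono) auto
  then have "R \<le> 2 ^ k * r" using r by (simp add: u_def)
  then have "cmod (a x r) \<le> real k * ((1 + A) * b)"
    using oscillation_dyadic[OF osc r, of x k] zero by simp
  also have "\<dots> \<le> ((1 / (\<epsilon> * ln 2) + 1) * u powr \<epsilon>) * ((1 + A) * b)"
  proof (rule mult_right_mono)
    have "ln u / ln 2 \<le> (u powr \<epsilon> / \<epsilon>) / ln 2"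
      using ln_powr_bound[OF u \<epsilon>] by (intro divide_right_mono) auto
    moreover have "1 \<le> u powr \<epsilon>" using u \<epsilon> by (simp add: ge_one_powr_ge_zero)
    ultimately show "real k \<le> (1 / (\<epsilon> * ln 2) + 1) * u powr \<epsilon>"
      using k by (simp add: log_def algebra_simps)
  qed (use A_ge_1 b in auto)
  also have "\<dots> = C * b * u powr \<epsilon>" by (simp add: C_def)
  finally show "cmod (a x r) \<le> C * b * ((r + R) / r) powr \<epsilon>" by (simp add: u_def)
qed

lemma decay_kernel_le_shell:
  assumes "0 < s" "0 < t" "0 < \<gamma>" "s \<le> dist x y"
  shows "decay_kernel M \<gamma> t x y \<le> 1 / V x s * (t / s) powr \<gamma>"
proof -
  have "V x s \<le> V x t + V x (dist x y)"
    using V_mono[OF subset_ball[OF assms(4)], of x] measure_nonneg[of M "ball x t"] by linarith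
  then have "1 / (V x t + V x (dist x y)) \<le> 1 / V x s"
    using V_pos[OF assms(1), of x] by (intro divide_left_mono) (auto intro!: mult_pos_pos)
  moreover have "(t / (t + dist x y)) powr \<gamma> \<le> (t / s) powr \<gamma>"
    using assms by (intro powr_mono2 divide_left_mono) auto
  ultimately show ?thesis
    using V_pos[OF assms(1), of x] unfolding decay_kernel_def vol_def vol2_def
    by (intro mult_mono) auto
qed

lemma decay_kernel_le_center:
  assumes "0 < t" "0 < \<gamma>"
  shows "decay_kernel M \<gamma> t x y \<le> 1 / V x t"
proof -
  have "1 / (V x t + V x (dist x y)) \<le> 1 / V x t"
    using V_pos[OF assms(1), of x] by (intro divide_left_mono) (auto intro!: mult_pos_pos add_pos_nonneg)
  moreover have "(t / (t + dist x y)) powr \<gamma> \<le> 1"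
    using assms by (intro powr_le1) (auto simp: add_pos_nonneg divide_le_eq_1)
  ultimately have "1 / (V x t + V x (dist x y)) * (t / (t + dist x y)) powr \<gamma> \<le> 1 / V x t * 1"
    by (intro mult_mono) auto
  then show ?thesis by (simp add: decay_kernel_def vol_def vol2_def)
qed

lemma decay_kernel_measurable [measurable]: "decay_kernel M \<gamma> t x \<in> borel_measurable M"
proof -
  have "mono (\<lambda>r. V x r)" by (intro monoI V_mono subset_ball)
  then have "(\<lambda>r. V x r) \<in> borel_measurable borel" by (rule borel_measurable_mono)
  moreover have [measurable]: "dist x \<in> borel_measurable M"
    unfolding measurable_cong_sets[OF sets_eq_borel refl]
    by (intro borel_measurable_continuous_onI continuous_intros)
  ultimately have [measurable]: "(\<lambda>y. V x (dist x y)) \<in> borel_measurable M" by measurable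
  show ?thesis unfolding decay_kernel_def vol_def vol2_def by measurable
qed

text \<open>
Sum over the dyadic shells around \<open>x\<close>: on the \<open>k\<close>-th shell the kernel contributes
\<open>(t / s) powr \<gamma>\<close> times a geometric factor \<open>q ^ k\<close>, and the oscillation relative to the central constant
grows only linearly in \<open>k\<close>.
\<close>

lemma decay_kernel_exterior:
  assumes \<gamma>: "0 < \<gamma>"
  obtains C where "0 < C"
    "\<And>f a b x s t. oscillation_le M f a b \<Longrightarrow> 0 < s \<Longrightarrow> 0 < t \<Longrightarrow>
       (\<integral>\<^sup>+y\<in>- ball x s. ennreal (decay_kernel M \<gamma> t x y * cmod (f y - a x s)) \<partial>M)
         \<le> ennreal (C * b * (t / s) powr \<gamma>)"
proof
  define q where "q = (1 / 2) powr \<gamma>"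
  have q: "0 < q" "q < 1" using \<gamma> powr_less_mono2[of \<gamma> "1/2" 1] by (auto simp: q_def)
  define c where "c k = q ^ k * (1 + real (Suc k) * (1 + A)) * A" for k
  have "summable (\<lambda>k. q ^ k)" using q by (intro summable_geometric) auto
  moreover have "summable (\<lambda>k. real (Suc k) * q ^ k)"
    using geometric_deriv_sums[of q] q by (auto intro: sums_summable)
  ultimately have "summable (\<lambda>k. A * q ^ k + ((1 + A) * A) * (real (Suc k) * q ^ k))"
    by (intro summable_add summable_mult)
  then have c: "summable c" by (rule back_subst[of summable]) (auto simp: c_def algebra_simps)
  have c_pos: "0 < c k" for k
    using q A_ge_1 by (auto simp: c_def intro!: mult_pos_pos add_pos_nonneg)
  show "0 < suminf c" using c c_pos by (intro suminf_pos) auto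
  fix f a b x and s t :: real
  assume osc: "oscillation_le M f a b" and s: "0 < s" and t: "0 < t"
  note [measurable] = oscillation_leD(1)[OF osc]
  have b: "0 < b" using osc by (rule oscillation_leD)
  define w where "w k = 1 / V x (2 ^ k * s) * (t / (2 ^ k * s)) powr \<gamma>" for k :: nat
  have w: "0 \<le> w k" for k by (simp add: w_def)
  let ?F = "\<lambda>k y. ennreal (w k) * (ennreal (cmod (f y - a x s)) * indicator (ball x (2 ^ Suc k * s)) y)"
  have "(\<integral>\<^sup>+y\<in>- ball x s. ennreal (decay_kernel M \<gamma> t x y * cmod (f y - a x s)) \<partial>M)
      \<le> (\<integral>\<^sup>+y. (\<Sum>k. ?F k y) \<partial>M)"
  proof (intro nn_integral_mono)
    fix y
    show "ennreal (decay_kernel M \<gamma> t x y * cmod (f y - a x s)) * indicator (- ball x s) y \<le> (\<Sum>k. ?F k y)"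
    proof (cases "y \<in> ball x s")
      case False
      then have "s \<le> dist x y" by simp
      then obtain k where k: "2 ^ k * s \<le> dist x y" "dist x y < 2 ^ Suc k * s"
        using dyadic_shell[OF s] by blast
      have "decay_kernel M \<gamma> t x y \<le> w k"
        unfolding w_def using s t \<gamma> k by (intro decay_kernel_le_shell) auto
      then have "ennreal (decay_kernel M \<gamma> t x y * cmod (f y - a x s)) \<le> ennreal (w k * cmod (f y - a x s))"
        by (intro ennreal_leI mult_right_mono) auto
      also have "\<dots> = (\<Sum>j\<in>{k}. ?F j y)" using w k by (simp add: ennreal_mult)
      also have "\<dots> \<le> (\<Sum>j. ?F j y)" by (intro sum_le_suminf) auto
      finally show ?thesis using False by simp
    qed simp
  qed
  also have "\<dots> = (\<Sum>k. \<integral>\<^sup>+y. ?F k y \<partial>M)" by (intro nn_integral_suminf) measurable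
  also have "\<dots> \<le> (\<Sum>k. ennreal (b * (t / s) powr \<gamma> * c k))"
  proof (rule suminf_le)
    fix k
    let ?r = "2 ^ Suc k * s"
    have "(\<integral>\<^sup>+y. ?F k y \<partial>M) = ennreal (w k) * (\<integral>\<^sup>+y\<in>ball x ?r. ennreal (cmod (f y - a x s)) \<partial>M)"
      by (intro nn_integral_cmult) measurable
    also have "\<dots> \<le> ennreal (w k) * ennreal ((b + cmod (a x ?r - a x s)) * V x ?r)"
      using s b oscillation_leD[OF osc] by (intro mult_left_mono set_nn_integral_shift) auto
    also have "\<dots> = ennreal (w k * ((b + cmod (a x ?r - a x s)) * V x ?r))"
      using w b by (intro ennreal_mult[symmetric]) auto
    also have "\<dots> \<le> ennreal (b * (t / s) powr \<gamma> * c k)"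
    proof (rule ennreal_leI)
      have V: "0 < V x (2 ^ k * s)" using s by (intro V_pos) auto
      have "V x ?r \<le> A * V x (2 ^ k * s)"
        using doubling[of "2 ^ k * s" x] s by (simp add: mult.assoc)
      moreover have "b + cmod (a x ?r - a x s) \<le> b * (1 + real (Suc k) * (1 + A))"
        using oscillation_dyadic[OF osc s, of x "Suc k"] by (simp add: algebra_simps)
      ultimately have "w k * ((b + cmod (a x ?r - a x s)) * V x ?r)
          \<le> w k * ((b * (1 + real (Suc k) * (1 + A))) * (A * V x (2 ^ k * s)))"
        using w b A_ge_1 by (intro mult_left_mono mult_mono) auto
      also have "\<dots> = b * (t / s) powr \<gamma> * c k"
      proof -
        have "q ^ k = ((1 / 2) ^ k) powr \<gamma>"
          by (simp add: q_def powr_powr powr_realpow[symmetric] mult.commute)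
        then have "(t / s) powr \<gamma> * q ^ k = (t / s * (1 / 2) ^ k) powr \<gamma>"
          using powr_mult[of "t / s" "(1 / 2) ^ k" \<gamma>] s t by simp
        also have "t / s * (1 / 2) ^ k = t / (2 ^ k * s)" by (simp add: power_one_over field_simps)
        finally have "w k = 1 / V x (2 ^ k * s) * ((t / s) powr \<gamma> * q ^ k)" by (simp add: w_def)
        then show ?thesis using V by (simp add: c_def)
      qed
      finally show "w k * ((b + cmod (a x ?r - a x s)) * V x ?r) \<le> b * (t / s) powr \<gamma> * c k" .
    qed
    finally show "(\<integral>\<^sup>+y. ?F k y \<partial>M) \<le> ennreal (b * (t / s) powr \<gamma> * c k)" .
  qed auto
  also have "\<dots> = ennreal (\<Sum>k. b * (t / s) powr \<gamma> * c k)"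
    using c c_pos b by (intro suminf_ennreal2 summable_mult) (auto intro!: mult_nonneg_nonneg less_imp_le[OF c_pos])
  also have "(\<Sum>k. b * (t / s) powr \<gamma> * c k) = suminf c * b * (t / s) powr \<gamma>"
    using c by (subst suminf_mult) auto
  finally show "(\<integral>\<^sup>+y\<in>- ball x s. ennreal (decay_kernel M \<gamma> t x y * cmod (f y - a x s)) \<partial>M)
         \<le> ennreal (suminf c * b * (t / s) powr \<gamma>)" .
qed

text \<open>
The exterior estimate with \<open>s = t\<close>, completed by the ball of radius \<open>t\<close>, where the kernel is at most
\<open>1 / V x t\<close>.
\<close>

lemma decay_kernel_total:
  assumes \<gamma>: "0 < \<gamma>"
  obtains C where "0 < C"
    "\<And>f a b x t. oscillation_le M f a b \<Longrightarrow> 0 < t \<Longrightarrow>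
       (\<integral>\<^sup>+y. ennreal (decay_kernel M \<gamma> t x y * cmod (f y - a x t)) \<partial>M) \<le> ennreal (C * b)"
proof -
  obtain C where C: "0 < C"
    "\<And>f a b x s t. oscillation_le M f a b \<Longrightarrow> 0 < s \<Longrightarrow> 0 < t \<Longrightarrow>
       (\<integral>\<^sup>+y\<in>- ball x s. ennreal (decay_kernel M \<gamma> t x y * cmod (f y - a x s)) \<partial>M)
         \<le> ennreal (C * b * (t / s) powr \<gamma>)"
    using decay_kernel_exterior[OF \<gamma>] by blast
  show thesis
  proof (rule that[of "1 + C"])
    show "0 < 1 + C" using C by simp
    fix f a b x and t :: real
    assume osc: "oscillation_le M f a b" and t: "0 < t"
    note [measurable] = oscillation_leD(1)[OF osc]
    have b: "0 < b" using osc by (rule oscillation_leD)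
    let ?g = "\<lambda>y. ennreal (decay_kernel M \<gamma> t x y * cmod (f y - a x t))"
    have Vt: "0 < V x t" using t by (rule V_pos)
    have "(\<integral>\<^sup>+y. ?g y \<partial>M) = (\<integral>\<^sup>+y. ?g y * indicator (ball x t) y + ?g y * indicator (- ball x t) y \<partial>M)"
      by (intro nn_integral_cong) (auto simp: indicator_def)
    also have "\<dots> \<le> (\<integral>\<^sup>+y. ennreal (1 / V x t) * (ennreal (cmod (f y - a x t)) * indicator (ball x t) y)
        + ?g y * indicator (- ball x t) y \<partial>M)"
    proof (intro nn_integral_mono add_mono order_refl)
      fix y
      have "?g y \<le> ennreal (1 / V x t * cmod (f y - a x t))"
        using decay_kernel_le_center[OF t \<gamma>, of x y] by (intro ennreal_leI mult_right_mono) auto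
      then show "?g y * indicator (ball x t) y
          \<le> ennreal (1 / V x t) * (ennreal (cmod (f y - a x t)) * indicator (ball x t) y)"
        using Vt by (auto simp: indicator_def ennreal_mult[symmetric] simp del: ennreal_mult'' ennreal_mult')
    qed
    also have "\<dots> = ennreal (1 / V x t) * (\<integral>\<^sup>+y\<in>ball x t. ennreal (cmod (f y - a x t)) \<partial>M)
        + (\<integral>\<^sup>+y\<in>- ball x t. ?g y \<partial>M)"
      by (subst nn_integral_add) (auto simp: nn_integral_cmult)
    also have "\<dots> \<le> ennreal (1 / V x t) * ennreal (b * V x t) + ennreal (C * b * (t / t) powr \<gamma>)"
      using C(2)[OF osc t t, of x] oscillation_leD(3)[OF osc t, of x]
      by (intro add_mono mult_left_mono) auto
    also have "\<dots> = ennreal ((1 + C) * b)"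
      using Vt t b C by (simp add: ennreal_mult[symmetric] ennreal_plus[symmetric] algebra_simps
         del: ennreal_mult'' ennreal_mult' ennreal_plus)
    finally show "(\<integral>\<^sup>+y. ?g y \<partial>M) \<le> ennreal ((1 + C) * b)" .
  qed
qed

end

section \<open>Pointwise estimates for the operators\<close>

text \<open>
The Bochner integral of a non-integrable function is zero, so no integrability has to be checked here.
\<close>

lemma norm_integral_le_of_nn_integral:
  fixes g :: "'a \<Rightarrow> 'b::{banach, second_countable_topology}"
  assumes "(\<integral>\<^sup>+y. ennreal (norm (g y)) \<partial>M) \<le> ennreal B" and "0 \<le> B"
  shows "norm (\<integral>y. g y \<partial>M) \<le> B"
proof (cases "integrable M g")
  case True
  then have "ennreal (norm (\<integral>y. g y \<partial>M)) \<le> ennreal B"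
    using integral_norm_bound_ennreal assms(1) order_trans by blast
  then show ?thesis using assms(2) by simp
qed (use assms(2) in \<open>simp add: not_integrable_integral_eq\<close>)

lemma cmod_integral_mult_le:
  assumes D: "0 \<le> D" and K: "\<And>y. cmod (K y) \<le> D * k y" and B: "0 \<le> B"
    and [measurable]: "k \<in> borel_measurable M" "h \<in> borel_measurable M"
    and int: "(\<integral>\<^sup>+y. ennreal (k y * cmod (h y)) \<partial>M) \<le> ennreal B"
  shows "cmod (\<integral>y. K y * h y \<partial>M) \<le> D * B"
proof (rule norm_integral_le_of_nn_integral)
  have "(\<integral>\<^sup>+y. ennreal (cmod (K y * h y)) \<partial>M) \<le> (\<integral>\<^sup>+y. ennreal D * ennreal (k y * cmod (h y)) \<partial>M)"
  proof (intro nn_integral_mono)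
    fix y
    have "cmod (K y * h y) \<le> D * (k y * cmod (h y))"
      using mult_right_mono[OF K, of "cmod (h y)"] by (simp add: norm_mult mult.assoc)
    then show "ennreal (cmod (K y * h y)) \<le> ennreal D * ennreal (k y * cmod (h y))"
      using D by (simp add: ennreal_mult'[symmetric] ennreal_leI del: ennreal_mult')
  qed
  also have "\<dots> = ennreal D * (\<integral>\<^sup>+y. ennreal (k y * cmod (h y)) \<partial>M)"
    by (intro nn_integral_cmult) measurable
  also have "\<dots> \<le> ennreal D * ennreal B" using int by (intro mult_left_mono) auto
  finally show "(\<integral>\<^sup>+y. ennreal (cmod (K y * h y)) \<partial>M) \<le> ennreal (D * B)"
    using D B by (simp add: ennreal_mult)
qed (use D B in simp)

lemma le_geometric_mean:
  fixes z :: real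
  assumes "0 \<le> z" "z \<le> X" "z \<le> Y"
  shows "z \<le> X powr (1 / 2) * Y powr (1 / 2)"
proof -
  have "z = z powr (1 / 2) * z powr (1 / 2)"
    using assms by (cases "z = 0") (auto simp: powr_add[symmetric])
  also have "\<dots> \<le> X powr (1 / 2) * Y powr (1 / 2)"
    using assms by (intro mult_mono powr_mono2) auto
  finally show ?thesis .
qed

text \<open>
Admissibility of \<open>\<rho>\<close> is recorded as comparability with constant \<open>c\<close> at distances up to \<open>\<rho> x\<close>, and the
smoothness condition in the weaker form with \<open>dist x x' / t\<close>, where the dependence on \<open>y\<close> is confined to
the decay kernel.
\<close>

locale kernel_square_function = doubling_measure M A
  for M :: "'a::metric_space measure" and A :: real +
  fixes \<rho> :: "'a \<Rightarrow> real" and c :: real and Q :: "real \<Rightarrow> 'a \<Rightarrow> 'a \<Rightarrow> complex"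
    and C1 \<delta>1 \<beta> \<delta>2 \<gamma> :: real
  assumes rho_pos: "0 < \<rho> x" and c_ge_1: "1 \<le> c"
    and rho_comparable: "dist x y \<le> \<rho> x \<Longrightarrow> \<rho> x \<le> c * \<rho> y"
    and Q_measurable: "(\<lambda>(t, x, y). Q t x y)
          \<in> borel_measurable (restrict_space borel {0<..} \<Otimes>\<^sub>M (M \<Otimes>\<^sub>M M))"
    and params: "0 < C1" "0 < \<delta>1" "0 < \<beta>" "0 < \<delta>2" "0 < \<gamma>"
    and Q_size: "0 < t \<Longrightarrow>
          cmod (Q t x y) \<le> C1 * (\<rho> x / (t + \<rho> x)) powr \<delta>1 * decay_kernel M \<gamma> t x y"
    and Q_smooth: "0 < t \<Longrightarrow> dist x x' \<le> t / 2 \<Longrightarrow>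
          cmod (Q t x y - Q t x' y) \<le> C1 * (dist x x' / t) powr \<beta> * decay_kernel M \<gamma> t x y"
    and Q_cancel: "0 < t \<Longrightarrow> cmod (\<integral>y. Q t x y \<partial>M) \<le> C1 * (t / (t + \<rho> x)) powr \<delta>2"
    and g_finite: "f \<in> L2 M \<Longrightarrow> AE x in M. g_square M Q f x < \<infinity>"
    and g_bounded: "L2_bounded M (g_function M Q)"
begin

text \<open>
The form in which the bound \<open>b\<close> for the localized BMO norm of \<open>f\<close> is used. The two suprema of that norm are
merged into one condition: on a ball whose radius is at least \<open>\<rho>\<close> at its centre the reference constant is zero.
\<close>

definition localized_oscillation :: "('a \<Rightarrow> complex) \<Rightarrow> ('a \<Rightarrow> real \<Rightarrow> complex) \<Rightarrow> real \<Rightarrow> bool" where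
  "localized_oscillation f a b \<longleftrightarrow> oscillation_le M f a b \<and> (\<forall>x r. \<rho> x \<le> r \<longrightarrow> a x r = 0)"

lemma Q_section_measurable [measurable]: "0 < t \<Longrightarrow> Q t x \<in> borel_measurable M"
proof -
  assume t: "0 < t"
  have "(\<lambda>y. (t, x, y)) \<in> measurable M (restrict_space borel {0<..} \<Otimes>\<^sub>M (M \<Otimes>\<^sub>M M))"
    using t space_eq_UNIV by (intro measurable_Pair measurable_const measurable_ident) (auto simp: space_restrict_space)
  from measurable_compose[OF this Q_measurable] show ?thesis by simp
qed

lemma Q_le_decay_kernel: "0 < t \<Longrightarrow> cmod (Q t x y) \<le> C1 * decay_kernel M \<gamma> t x y"
proof -
  assume t: "0 < t"
  have "(\<rho> x / (t + \<rho> x)) powr \<delta>1 \<le> 1"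
    using t rho_pos[of x] params by (intro powr_le1) (auto simp: add_pos_pos divide_le_eq_1)
  then have "C1 * (\<rho> x / (t + \<rho> x)) powr \<delta>1 * decay_kernel M \<gamma> t x y \<le> C1 * 1 * decay_kernel M \<gamma> t x y"
    using params decay_kernel_nonneg by (intro mult_right_mono mult_left_mono) auto
  then show ?thesis using Q_size[OF t, of x y] by simp
qed

lemma Q_mult_integrable:
  assumes osc: "oscillation_le M f a b" and t: "0 < t"
  shows "integrable M (\<lambda>y. Q t x y * (f y - d))"
proof -
  obtain C where C: "0 < C"
    "\<And>f a b x t. oscillation_le M f a b \<Longrightarrow> 0 < t \<Longrightarrow>
       (\<integral>\<^sup>+y. ennreal (decay_kernel M \<gamma> t x y * cmod (f y - a x t)) \<partial>M) \<le> ennreal (C * b)"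
    using decay_kernel_total[OF params(5)] by blast
  have *: "integrable M (\<lambda>y. Q t x y * (f y - a x t))" if osc: "oscillation_le M f a b" for f a b
  proof (rule integrableI_bounded)
    note [measurable] = oscillation_leD(1)[OF osc]
    show "(\<lambda>y. Q t x y * (f y - a x t)) \<in> borel_measurable M" using t by measurable
    have "(\<integral>\<^sup>+y. ennreal (cmod (Q t x y * (f y - a x t))) \<partial>M)
      \<le> (\<integral>\<^sup>+y. ennreal C1 * ennreal (decay_kernel M \<gamma> t x y * cmod (f y - a x t)) \<partial>M)"
    proof (intro nn_integral_mono)
      fix y
      have "cmod (Q t x y * (f y - a x t)) \<le> C1 * (decay_kernel M \<gamma> t x y * cmod (f y - a x t))"
        using mult_right_mono[OF Q_le_decay_kernel[OF t], of "cmod (f y - a x t)"]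
        by (simp add: norm_mult mult.assoc)
      then show "ennreal (cmod (Q t x y * (f y - a x t)))
          \<le> ennreal C1 * ennreal (decay_kernel M \<gamma> t x y * cmod (f y - a x t))"
        using params by (simp add: ennreal_mult'[symmetric] ennreal_leI del: ennreal_mult')
    qed
    also have "\<dots> = ennreal C1 * (\<integral>\<^sup>+y. ennreal (decay_kernel M \<gamma> t x y * cmod (f y - a x t)) \<partial>M)"
      by (intro nn_integral_cmult) measurable
    also have "\<dots> \<le> ennreal C1 * ennreal (C * b)" using C(2)[OF osc t] by (intro mult_left_mono) auto
    also have "\<dots> < \<infinity>" by (simp add: ennreal_mult_less_top)
    finally show "(\<integral>\<^sup>+y. ennreal (cmod (Q t x y * (f y - a x t))) \<partial>M) < \<infinity>" .
  qed
  have "integrable M (\<lambda>y. Q t x y * (f y - a x t) + (a x t - d) * (Q t x y * (1 - 0)))"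
    using *[OF osc] *[OF oscillation_one] by (intro Bochner_Integration.integrable_add integrable_mult_right) auto
  then show ?thesis by (rule back_subst[of "integrable M"]) (auto simp: algebra_simps)
qed

lemma Q_integrable: "0 < t \<Longrightarrow> integrable M (Q t x)"
  using Q_mult_integrable[OF oscillation_one, of t x 0] by simp

lemma kernel_op_split:
  assumes osc: "oscillation_le M f a b" and t: "0 < t"
  shows "kernel_op M (Q t) f x = (\<integral>y. Q t x y * (f y - d) \<partial>M) + d * (\<integral>y. Q t x y \<partial>M)"
proof -
  have "(\<integral>y. Q t x y * (f y - d) \<partial>M) + d * (\<integral>y. Q t x y \<partial>M)
      = (\<integral>y. Q t x y * (f y - d) + d * Q t x y \<partial>M)"
    using Q_mult_integrable[OF osc t] Q_integrable[OF t] by simp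
  then show ?thesis by (simp add: kernel_op_def algebra_simps)
qed

text \<open>
For \<open>t\<close> beyond \<open>\<rho> x / c\<close> the constant \<open>a x t\<close> is bounded by a multiple of \<open>b\<close>, so that the factor
\<open>(\<rho> x / (t + \<rho> x)) powr \<delta>1\<close> of the size condition gives decay of the whole operator.
\<close>

lemma kernel_op_decay:
  obtains C where "0 < C"
    "\<And>f a b x r t. localized_oscillation f a b \<Longrightarrow> 0 < r \<Longrightarrow> \<rho> x \<le> c * r \<Longrightarrow> r \<le> t \<Longrightarrow>
       cmod (kernel_op M (Q t) f x) \<le> C * b * (r / t) powr \<delta>1"
proof -
  obtain C where C: "0 < C"
    "\<And>f a b x t. oscillation_le M f a b \<Longrightarrow> 0 < t \<Longrightarrow>
       (\<integral>\<^sup>+y. ennreal (decay_kernel M \<gamma> t x y * cmod (f y - a x t)) \<partial>M) \<le> ennreal (C * b)"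
    using decay_kernel_total[OF params(5)] by blast
  obtain C' where C': "0 < C'"
    "\<And>f a b x r R. oscillation_le M f a b \<Longrightarrow> 0 < r \<Longrightarrow> 0 < R \<Longrightarrow> (\<And>s. R \<le> s \<Longrightarrow> a x s = 0) \<Longrightarrow>
       cmod (a x r) \<le> C' * b * ((r + R) / r) powr 1"
    using oscillation_constant_growth[of 1] by auto
  define E where "E = C1 * c powr \<delta>1 * (C + C' * (1 + c) * C)"
  show thesis
  proof (rule that[of E])
    have "0 < c powr \<delta>1" using c_ge_1 by simp
    then show E: "0 < E"
      unfolding E_def using params C C' c_ge_1 by (intro mult_pos_pos add_pos_pos) auto
    fix f a b and x :: 'a and r t :: real
    assume loc: "localized_oscillation f a b" and r: "0 < r" and \<rho>: "\<rho> x \<le> c * r" and rt: "r \<le> t"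
    have osc: "oscillation_le M f a b" and zero: "\<And>s. \<rho> x \<le> s \<Longrightarrow> a x s = 0"
      using loc by (auto simp: localized_oscillation_def)
    note [measurable] = oscillation_leD(1)[OF osc]
    have b: "0 < b" and t: "0 < t" using osc r rt by (auto intro: oscillation_leD)
    have \<rho>0: "0 < \<rho> x" by (rule rho_pos)
    define D where "D = C1 * (\<rho> x / (t + \<rho> x)) powr \<delta>1"
    have D: "0 \<le> D" using params by (simp add: D_def)
    have 1: "cmod (\<integral>y. Q t x y * (f y - a x t) \<partial>M) \<le> D * (C * b)"
      using D Q_size[OF t, of x] C(1) C(2)[OF osc t] b
      by (intro cmod_integral_mult_le[where k = "decay_kernel M \<gamma> t x"]) (auto simp: D_def)
    have "cmod (\<integral>y. Q t x y * (1 - 0) \<partial>M) \<le> D * (C * 1)"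
      using D Q_size[OF t, of x] C(1) C(2)[OF oscillation_one t]
      by (intro cmod_integral_mult_le[where k = "decay_kernel M \<gamma> t x"]) (auto simp: D_def)
    then have 2: "cmod (\<integral>y. Q t x y \<partial>M) \<le> D * C" by simp
    have "(t + \<rho> x) / t \<le> 1 + c"
    proof -
      have "\<rho> x \<le> c * t" using \<rho> mult_left_mono[OF rt, of c] c_ge_1 by linarith
      then show ?thesis using t by (simp add: field_simps)
    qed
    then have "C' * b * ((t + \<rho> x) / t) \<le> C' * b * (1 + c)"
      using C' b by (intro mult_left_mono) auto
    moreover have "cmod (a x t) \<le> C' * b * ((t + \<rho> x) / t) powr 1"
      using C'(2)[OF osc t \<rho>0 zero] .
    ultimately have 3: "cmod (a x t) \<le> C' * b * (1 + c)"
      using t \<rho>0 by simp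
    have "cmod (kernel_op M (Q t) f x) \<le> D * (C * b) + (C' * b * (1 + c)) * (D * C)"
      unfolding kernel_op_split[OF osc t, of x "a x t"]
      using 1 mult_mono[OF 3 2] C' b c_ge_1
      by (intro order_trans[OF norm_triangle_ineq] add_mono) (auto simp: norm_mult)
    also have "\<dots> = (C + C' * (1 + c) * C) * b * D" by (simp add: algebra_simps)
    also have "\<dots> \<le> (C + C' * (1 + c) * C) * b * (C1 * (c powr \<delta>1 * (r / t) powr \<delta>1))"
    proof (intro mult_left_mono)
      have "\<rho> x / (t + \<rho> x) \<le> c * r / t"
        using \<rho> \<rho>0 t by (intro frac_le) auto
      then have "(\<rho> x / (t + \<rho> x)) powr \<delta>1 \<le> (c * (r / t)) powr \<delta>1"
        using \<rho>0 t params by (intro powr_mono2) auto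
      also have "\<dots> = c powr \<delta>1 * (r / t) powr \<delta>1"
        using c_ge_1 r t by (intro powr_mult; simp)
      finally show "D \<le> C1 * (c powr \<delta>1 * (r / t) powr \<delta>1)"
        unfolding D_def using params by (intro mult_left_mono) auto
    qed (use C C' b c_ge_1 in auto)
    finally show "cmod (kernel_op M (Q t) f x) \<le> E * b * (r / t) powr \<delta>1"
      by (simp add: E_def ac_simps)
  qed
qed

text \<open>
Write \<open>f = (f - a x t) + a x t\<close>. The first summand is handled by the smoothness of the kernel. The second
is \<open>a x t\<close> times the difference \<open>q\<close> of the integrals of the two kernels, where smoothness alone would
leave the unbounded factor \<open>a x t\<close>. The cancellation condition bounds \<open>q\<close> by a power of
\<open>t / (t + \<rho> x)\<close>, and the geometric mean of both bounds for \<open>q\<close> keeps half the smoothness while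
compensating the growth of \<open>a x t\<close>. This is where the exponent \<open>\<beta> / 2\<close> comes from.
\<close>

lemma kernel_op_smooth:
  obtains C where "0 < C"
    "\<And>f a b x x' t. localized_oscillation f a b \<Longrightarrow> 0 < t \<Longrightarrow> dist x x' \<le> t / 2 \<Longrightarrow>
       cmod (kernel_op M (Q t) f x - kernel_op M (Q t) f x') \<le> C * b * (dist x x' / t) powr (\<beta> / 2)"
proof -
  obtain C where C: "0 < C"
    "\<And>f a b x t. oscillation_le M f a b \<Longrightarrow> 0 < t \<Longrightarrow>
       (\<integral>\<^sup>+y. ennreal (decay_kernel M \<gamma> t x y * cmod (f y - a x t)) \<partial>M) \<le> ennreal (C * b)"
    using decay_kernel_total[OF params(5)] by blast
  obtain C' where C': "0 < C'"
    "\<And>f a b x r R. oscillation_le M f a b \<Longrightarrow> 0 < r \<Longrightarrow> 0 < R \<Longrightarrow> (\<And>s. R \<le> s \<Longrightarrow> a x s = 0) \<Longrightarrow>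
       cmod (a x r) \<le> C' * b * ((r + R) / r) powr (\<delta>2 / 2)"
    using oscillation_constant_growth[of "\<delta>2 / 2"] params by auto
  define m where "m = (C1 * C) powr (1 / 2) * (C1 * (1 + c powr \<delta>2)) powr (1 / 2)"
  have "0 < 1 + c powr \<delta>2" by (simp add: add_pos_nonneg)
  then have m: "0 < m" using params C by (simp add: m_def)
  show thesis
  proof (rule that[of "C1 * C + C' * m"])
    show "0 < C1 * C + C' * m" using params C C' m by (intro add_pos_pos mult_pos_pos) auto
    fix f a b and x x' :: 'a and t :: real
    assume loc: "localized_oscillation f a b" and t: "0 < t" and xx': "dist x x' \<le> t / 2"
    have osc: "oscillation_le M f a b" and zero: "\<And>s. \<rho> x \<le> s \<Longrightarrow> a x s = 0"
      using loc by (auto simp: localized_oscillation_def)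
    note [measurable] = oscillation_leD(1)[OF osc]
    have b: "0 < b" using osc by (rule oscillation_leD)
    have \<rho>0: "0 < \<rho> x" "0 < \<rho> x'" by (rule rho_pos)+
    define u where "u = dist x x' / t"
    have u: "0 \<le> u" "u \<le> 1" using t xx' by (auto simp: u_def)
    have "cmod (\<integral>y. (Q t x y - Q t x' y) * (f y - a x t) \<partial>M) \<le> (C1 * u powr \<beta>) * (C * b)"
      using Q_smooth[OF t xx'] C(1) C(2)[OF osc t] b params
      by (intro cmod_integral_mult_le[where k = "decay_kernel M \<gamma> t x"]) (auto simp: u_def)
    also have "\<dots> \<le> (C1 * u powr (\<beta> / 2)) * (C * b)"
      using u params C b by (intro mult_right_mono mult_left_mono powr_mono') auto
    finally have 1: "cmod (\<integral>y. (Q t x y - Q t x' y) * (f y - a x t) \<partial>M) \<le> C1 * C * b * u powr (\<beta> / 2)"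
      by (simp add: ac_simps)
    let ?q = "(\<integral>y. Q t x y \<partial>M) - (\<integral>y. Q t x' y \<partial>M)"
    have 2: "cmod (a x t * ?q) \<le> C' * b * (m * u powr (\<beta> / 2))"
    proof (cases "\<rho> x \<le> t")
      case True
      then show ?thesis using zero C' b m by simp
    next
      case False
      define w where "w = t / (t + \<rho> x)"
      have w: "0 < w" "w \<le> 1" using t \<rho>0 by (auto simp: w_def)
      have "cmod (\<integral>y. (Q t x y - Q t x' y) * (1 - 0) \<partial>M) \<le> (C1 * u powr \<beta>) * (C * 1)"
        using Q_smooth[OF t xx'] C(1) C(2)[OF oscillation_one t] params
        by (intro cmod_integral_mult_le[where k = "decay_kernel M \<gamma> t x"]) (auto simp: u_def)
      then have q1: "cmod ?q \<le> (C1 * C) * u powr \<beta>"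
        using Q_integrable[OF t, of x] Q_integrable[OF t, of x'] by (simp add: ac_simps)
      have "cmod ?q \<le> C1 * (t / (t + \<rho> x)) powr \<delta>2 + C1 * (t / (t + \<rho> x')) powr \<delta>2"
        using Q_cancel[OF t] by (intro order_trans[OF norm_triangle_ineq4] add_mono)
      also have "\<dots> \<le> C1 * w powr \<delta>2 + C1 * (c powr \<delta>2 * w powr \<delta>2)"
      proof (intro add_mono mult_left_mono)
        (* The cancellation bound at x' has to be expressed through rho at x. *)
        have "\<rho> x \<le> c * \<rho> x'" using False xx' t by (intro rho_comparable) auto
        moreover have "t \<le> c * t" using c_ge_1 t by simp
        ultimately have "t + \<rho> x \<le> c * (t + \<rho> x')" by (simp add: algebra_simps)
        then have "c * t / (c * (t + \<rho> x')) \<le> c * t / (t + \<rho> x)"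
          using t \<rho>0 c_ge_1 by (intro divide_left_mono mult_pos_pos) auto
        then have "t / (t + \<rho> x') \<le> c * w"
          using c_ge_1 by (simp add: w_def)
        then have "(t / (t + \<rho> x')) powr \<delta>2 \<le> (c * w) powr \<delta>2"
          using t \<rho>0 params by (intro powr_mono2) auto
        then show "(t / (t + \<rho> x')) powr \<delta>2 \<le> c powr \<delta>2 * w powr \<delta>2"
          using c_ge_1 w by (simp add: powr_mult)
      qed (use params in \<open>auto simp: w_def\<close>)
      finally have q2: "cmod ?q \<le> (C1 * (1 + c powr \<delta>2)) * w powr \<delta>2" by (simp add: algebra_simps)
      have "cmod ?q \<le> ((C1 * C) * u powr \<beta>) powr (1 / 2) * ((C1 * (1 + c powr \<delta>2)) * w powr \<delta>2) powr (1 / 2)"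
        using q1 q2 by (intro le_geometric_mean) auto
      also have "\<dots> = m * (u powr (\<beta> / 2) * w powr (\<delta>2 / 2))"
        using params C by (simp add: m_def powr_mult powr_powr)
      finally have q: "cmod ?q \<le> m * (u powr (\<beta> / 2) * w powr (\<delta>2 / 2))" .
      have "cmod (a x t) \<le> C' * b * ((t + \<rho> x) / t) powr (\<delta>2 / 2)"
        using C'(2)[OF osc t \<rho>0(1) zero] .
      also have "(t + \<rho> x) / t = 1 / w" by (simp add: w_def)
      finally have "cmod (a x t * ?q) \<le> (C' * b * (1 / w) powr (\<delta>2 / 2)) * (m * (u powr (\<beta> / 2) * w powr (\<delta>2 / 2)))"
        unfolding norm_mult using q C' b by (intro mult_mono) auto
      also have "\<dots> = C' * b * (m * u powr (\<beta> / 2)) * ((1 / w) powr (\<delta>2 / 2) * w powr (\<delta>2 / 2))"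
        by (simp add: ac_simps)
      also have "(1 / w) powr (\<delta>2 / 2) * w powr (\<delta>2 / 2) = 1"
        using w by (simp add: powr_mult[symmetric])
      finally show ?thesis by simp
    qed
    have "kernel_op M (Q t) f x - kernel_op M (Q t) f x'
        = (\<integral>y. (Q t x y - Q t x' y) * (f y - a x t) \<partial>M) + a x t * ?q"
    proof -
      have "(\<integral>y. (Q t x y - Q t x' y) * (f y - a x t) \<partial>M)
          = (\<integral>y. Q t x y * (f y - a x t) - Q t x' y * (f y - a x t) \<partial>M)"
        by (simp add: left_diff_distrib)
      also have "\<dots> = (\<integral>y. Q t x y * (f y - a x t) \<partial>M) - (\<integral>y. Q t x' y * (f y - a x t) \<partial>M)"
        by (intro Bochner_Integration.integral_diff Q_mult_integrable[OF osc t])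
      finally show ?thesis
        unfolding kernel_op_split[OF osc t, of x "a x t"] kernel_op_split[OF osc t, of x' "a x t"]
        by (simp add: algebra_simps)
    qed
    then have "cmod (kernel_op M (Q t) f x - kernel_op M (Q t) f x')
        \<le> C1 * C * b * u powr (\<beta> / 2) + C' * b * (m * u powr (\<beta> / 2))"
      using 1 2 by (simp add: norm_triangle_le)
    then show "cmod (kernel_op M (Q t) f x - kernel_op M (Q t) f x')
        \<le> (C1 * C + C' * m) * b * (dist x x' / t) powr (\<beta> / 2)"
      by (simp add: u_def algebra_simps)
  qed
qed

end

section \<open>The square function at small scales\<close>

lemma nn_integral_powr_near_zero:
  assumes "0 < p" "0 < T"
  shows "(\<integral>\<^sup>+t\<in>{0<..<T}. ennreal ((t / T) powr p / t) \<partial>lborel) \<le> ennreal (1 / p)"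
proof -
  have "(\<integral>\<^sup>+t\<in>{0<..<T}. ennreal ((t / T) powr p / t) \<partial>lborel)
      \<le> (\<integral>\<^sup>+t\<in>{0..T}. ennreal (T powr - p * t powr (p - 1)) \<partial>lborel)"
  proof (intro nn_integral_mono)
    fix t
    have "(t / T) powr p / t = T powr - p * t powr (p - 1)" if "0 < t"
      using that assms by (simp add: powr_divide powr_diff powr_minus field_simps)
    then show "ennreal ((t / T) powr p / t) * indicator {0<..<T} t
        \<le> ennreal (T powr - p * t powr (p - 1)) * indicator {0..T} t"
      by (auto simp: indicator_def)
  qed
  also have "\<dots> = ennreal (T powr - p * (T powr (p - 1 + 1) / (p - 1 + 1)))"
    using assms by (intro nn_integral_has_integral_lebesgue' has_integral_mult_right has_integral_powr_from_0) auto
  also have "T powr - p * (T powr (p - 1 + 1) / (p - 1 + 1)) = 1 / p"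
    using assms by (simp add: powr_minus field_simps)
  finally show ?thesis .
qed

lemma nn_integral_powr_at_infinity:
  assumes "0 < p" "0 < T"
  shows "(\<integral>\<^sup>+t\<in>{T..}. ennreal ((T / t) powr p / t) \<partial>lborel) \<le> ennreal (1 / p)"
proof -
  have "(\<integral>\<^sup>+t\<in>{T..}. ennreal ((T / t) powr p / t) \<partial>lborel)
      = (\<integral>\<^sup>+t\<in>{T..}. ennreal (T powr p * t powr (- p - 1)) \<partial>lborel)"
  proof (intro nn_integral_cong)
    fix t
    have "(T / t) powr p / t = T powr p * t powr (- p - 1)" if "T \<le> t"
      using that assms by (simp add: powr_divide powr_diff powr_minus field_simps)
    then show "ennreal ((T / t) powr p / t) * indicator {T..} t
        = ennreal (T powr p * t powr (- p - 1)) * indicator {T..} t"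
      by (auto simp: indicator_def)
  qed
  also have "\<dots> = ennreal (T powr p * (- (T powr (- p - 1 + 1)) / (- p - 1 + 1)))"
    using assms by (intro nn_integral_has_integral_lebesgue' has_integral_mult_right has_integral_powr_to_inf) auto
  also have "T powr p * (- (T powr (- p - 1 + 1)) / (- p - 1 + 1)) = 1 / p"
    using assms by (simp add: powr_minus field_simps)
  finally show ?thesis by simp
qed

context kernel_square_function
begin

text \<open>
The square of the square function with \<open>t\<close> restricted to \<open>S\<close>; it takes the value \<open>\<infinity>\<close>, so that additivity
in \<open>S\<close> needs no finiteness.
\<close>

definition square_on :: "real set \<Rightarrow> ('a \<Rightarrow> complex) \<Rightarrow> 'a \<Rightarrow> ennreal" where
  "square_on S f x = (\<integral>\<^sup>+t\<in>S. ennreal ((cmod (kernel_op M (Q t) f x))\<^sup>2 / t) \<partial>lborel)"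

lemma g_square_eq: "g_square M Q f = square_on {0<..} f"
  by (simp add: fun_eq_iff g_square_def square_on_def)

lemma kernel_op_jointly_measurable:
  assumes [measurable]: "f \<in> borel_measurable M"
  shows "(\<lambda>(x, t). kernel_op M (Q t) f x) \<in> borel_measurable (M \<Otimes>\<^sub>M restrict_space borel {0<..})"
proof -
  interpret M: sigma_finite_measure M by (rule sigma_finite_measure)
  let ?N = "M \<Otimes>\<^sub>M restrict_space borel {0<..}"
  have "(\<lambda>(p, y). (snd p, fst p, y)) \<in> measurable (?N \<Otimes>\<^sub>M M) (restrict_space borel {0<..} \<Otimes>\<^sub>M (M \<Otimes>\<^sub>M M))"
    by measurable
  from measurable_compose[OF this Q_measurable]
  have [measurable]: "(\<lambda>(p, y). Q (snd p) (fst p) y) \<in> borel_measurable (?N \<Otimes>\<^sub>M M)"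
    by (simp add: case_prod_beta)
  have "(\<lambda>p. \<integral>y. Q (snd p) (fst p) y * f y \<partial>M) \<in> borel_measurable ?N"
    by (intro M.borel_measurable_lebesgue_integral) measurable
  then show ?thesis by (simp add: kernel_op_def case_prod_beta)
qed

lemma square_integrand_measurable:
  assumes f: "f \<in> borel_measurable M" and S: "S \<in> sets borel" "S \<subseteq> {0<..}"
  shows "(\<lambda>t. ennreal ((cmod (kernel_op M (Q t) f x))\<^sup>2 / t) * indicator S t) \<in> borel_measurable lborel"
proof -
  have "(\<lambda>t. (x, t)) \<in> measurable (restrict_space borel {0<..}) (M \<Otimes>\<^sub>M restrict_space borel {0<..})"
    using space_eq_UNIV by (intro measurable_Pair1') simp
  from measurable_compose[OF this kernel_op_jointly_measurable[OF f]]
  have [measurable]: "(\<lambda>t. kernel_op M (Q t) f x) \<in> borel_measurable (restrict_space borel {0<..})" by simp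
  have [measurable]: "(\<lambda>t. t) \<in> borel_measurable (restrict_space borel {0<..})"
    by (intro measurable_restrict_space1) simp
  have "(\<lambda>t. ennreal ((cmod (kernel_op M (Q t) f x))\<^sup>2 / t)) \<in> borel_measurable (restrict_space borel {0<..})"
    by measurable
  then have [measurable]: "(\<lambda>t. ennreal ((cmod (kernel_op M (Q t) f x))\<^sup>2 / t) * indicator {0<..} t) \<in> borel_measurable lborel"
    by (subst (asm) borel_measurable_restrict_space_iff_ennreal) auto
  have [measurable]: "S \<in> sets borel" by fact
  have "(\<lambda>t. (ennreal ((cmod (kernel_op M (Q t) f x))\<^sup>2 / t) * indicator {0<..} t) * indicator S t) \<in> borel_measurable lborel"
    by measurable
  moreover have "(\<lambda>t. (ennreal ((cmod (kernel_op M (Q t) f x))\<^sup>2 / t) * indicator {0<..} t) * indicator S t)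
      = (\<lambda>t. ennreal ((cmod (kernel_op M (Q t) f x))\<^sup>2 / t) * indicator S t)"
    using S(2) by (auto simp: indicator_def fun_eq_iff)
  ultimately show ?thesis by simp
qed

lemma square_on_measurable:
  assumes f: "f \<in> borel_measurable M" and S: "S \<in> sets borel" "S \<subseteq> {0<..}"
  shows "square_on S f \<in> borel_measurable M"
proof -
  let ?R = "restrict_space lborel {0<..} :: real measure"
  interpret R: sigma_finite_measure ?R
    by (intro sigma_finite_measure_restrict_space lborel.sigma_finite_measure_axioms) auto
  have sets: "sets (M \<Otimes>\<^sub>M ?R) = sets (M \<Otimes>\<^sub>M restrict_space borel {0<..})"
    by (intro sets_pair_measure_cong sets_restrict_space_cong) auto
  have [measurable]: "(\<lambda>(x, t). kernel_op M (Q t) f x) \<in> borel_measurable (M \<Otimes>\<^sub>M ?R)"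
    using kernel_op_jointly_measurable[OF f] by (simp add: measurable_cong_sets[OF sets refl])
  have [measurable]: "(\<lambda>t. t) \<in> borel_measurable ?R"
    by (intro measurable_restrict_space1) simp
  have [measurable]: "S \<inter> {0<..} \<in> sets ?R" "indicator S \<in> borel_measurable ?R"
    using S by (auto simp: sets_restrict_space intro!: measurable_restrict_space1 borel_measurable_indicator)
  have "square_on S f x = (\<integral>\<^sup>+t. ennreal ((cmod (kernel_op M (Q t) f x))\<^sup>2 / t) * indicator S t \<partial>?R)" for x
    unfolding square_on_def using S(2)
    by (subst nn_integral_restrict_space) (auto intro!: nn_integral_cong simp: indicator_def)
  moreover have "(\<lambda>x. \<integral>\<^sup>+t. ennreal ((cmod (kernel_op M (Q t) f x))\<^sup>2 / t) * indicator S t \<partial>?R) \<in> borel_measurable M"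
    by (intro R.borel_measurable_nn_integral) measurable
  ultimately show ?thesis by presburger
qed

lemma g_square_L2:
  obtains K where "0 < K" "\<And>h. h \<in> L2 M \<Longrightarrow>
    (\<integral>\<^sup>+x. g_square M Q h x \<partial>M) \<le> ennreal K * (\<integral>\<^sup>+x. ennreal ((cmod (h x))\<^sup>2) \<partial>M)"
proof -
  obtain K where K: "\<And>h. h \<in> L2 M \<Longrightarrow> g_function M Q h \<in> L2 M \<and> L2norm M (g_function M Q h) \<le> K * L2norm M h"
    using g_bounded by (auto simp: L2_bounded_def)
  show thesis
  proof (rule that[of "K\<^sup>2 + 1"])
    show "0 < K\<^sup>2 + 1" by (simp add: add_nonneg_pos)
    fix h :: "'a \<Rightarrow> complex" assume h: "h \<in> L2 M"
    let ?g = "g_function M Q h"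
    have g: "integrable M (\<lambda>x. (norm (?g x))\<^sup>2)" and hi: "integrable M (\<lambda>x. (cmod (h x))\<^sup>2)"
      using K[OF h] h by (auto simp: L2_def)
    have "(\<integral>\<^sup>+x. g_square M Q h x \<partial>M) = (\<integral>\<^sup>+x. ennreal ((norm (?g x))\<^sup>2) \<partial>M)"
    proof (rule nn_integral_cong_AE, use g_finite[OF h] in eventually_elim)
      case (elim x)
      then show ?case by (simp add: g_function_def)
    qed
    also have "\<dots> = ennreal (\<integral>x. (norm (?g x))\<^sup>2 \<partial>M)"
      using g by (intro nn_integral_eq_integral) auto
    also have "\<dots> \<le> ennreal ((K\<^sup>2 + 1) * (\<integral>x. (cmod (h x))\<^sup>2 \<partial>M))"
    proof (rule ennreal_leI)
      have "0 \<le> (\<integral>x. (norm (?g x))\<^sup>2 \<partial>M)" "0 \<le> (\<integral>x. (cmod (h x))\<^sup>2 \<partial>M)" by simp_all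
      moreover from this have "(L2norm M ?g)\<^sup>2 \<le> (K * L2norm M h)\<^sup>2"
        using K[OF h] by (intro power_mono) (auto simp: L2norm_def)
      ultimately have "(\<integral>x. (norm (?g x))\<^sup>2 \<partial>M) \<le> K\<^sup>2 * (\<integral>x. (cmod (h x))\<^sup>2 \<partial>M)"
        by (simp add: L2norm_def power_mult_distrib)
      then show "(\<integral>x. (norm (?g x))\<^sup>2 \<partial>M) \<le> (K\<^sup>2 + 1) * (\<integral>x. (cmod (h x))\<^sup>2 \<partial>M)"
        using \<open>0 \<le> (\<integral>x. (cmod (h x))\<^sup>2 \<partial>M)\<close> unfolding distrib_right mult_1 by linarith
    qed
    also have "\<dots> = ennreal (K\<^sup>2 + 1) * ennreal (\<integral>x. (cmod (h x))\<^sup>2 \<partial>M)"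
      by (intro ennreal_mult) auto
    also have "ennreal (\<integral>x. (cmod (h x))\<^sup>2 \<partial>M) = (\<integral>\<^sup>+x. ennreal ((cmod (h x))\<^sup>2) \<partial>M)"
      using hi by (intro nn_integral_eq_integral[symmetric]) auto
    finally show "(\<integral>\<^sup>+x. g_square M Q h x \<partial>M) \<le> ennreal (K\<^sup>2 + 1) * (\<integral>\<^sup>+x. ennreal ((cmod (h x))\<^sup>2) \<partial>M)" .
  qed
qed

text \<open>
Split \<open>f\<close> into \<open>(f - d) 1\<^sub>B\<close>, \<open>(f - d)\<close> off \<open>B\<close>, and \<open>d\<close>, where \<open>B = ball x0 (2 * r)\<close> and
\<open>d = a x0 (2 * r)\<close>. The exterior piece is small like \<open>(t / r) powr \<gamma>\<close> by the decay of the kernel. For the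
constant piece the cancellation condition gives \<open>(t / \<rho>) powr \<delta>2\<close>, which beats the growth
\<open>(\<rho> / r) powr \<delta>2\<close> of \<open>d\<close> and leaves \<open>(t / r) powr \<delta>2\<close>; on a large ball \<open>d\<close> is zero.
\<close>

lemma kernel_op_local:
  defines "\<eta> \<equiv> min \<gamma> \<delta>2"
  obtains E where "0 < E"
    "\<And>f a b x0 x r t. localized_oscillation f a b \<Longrightarrow> 0 < r \<Longrightarrow> x \<in> ball x0 r \<Longrightarrow> 0 < t \<Longrightarrow> t < 4 * r \<Longrightarrow>
       cmod (kernel_op M (Q t) f x)
         \<le> cmod (kernel_op M (Q t) (\<lambda>y. indicator (ball x0 (2 * r)) y *\<^sub>R (f y - a x0 (2 * r))) x)
           + E * b * (t / (4 * r)) powr \<eta>"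
proof -
  obtain C where C: "0 < C"
    "\<And>f a b x s t. oscillation_le M f a b \<Longrightarrow> 0 < s \<Longrightarrow> 0 < t \<Longrightarrow>
       (\<integral>\<^sup>+y\<in>- ball x s. ennreal (decay_kernel M \<gamma> t x y * cmod (f y - a x s)) \<partial>M)
         \<le> ennreal (C * b * (t / s) powr \<gamma>)"
    using decay_kernel_exterior[OF params(5)] by blast
  obtain C' where C': "0 < C'"
    "\<And>f a b x r R. oscillation_le M f a b \<Longrightarrow> 0 < r \<Longrightarrow> 0 < R \<Longrightarrow> (\<And>s. R \<le> s \<Longrightarrow> a x s = 0) \<Longrightarrow>
       cmod (a x r) \<le> C' * b * ((r + R) / r) powr \<delta>2"
    using oscillation_constant_growth[OF params(4)] by blast
  define E1 where "E1 = C1 * (C * (2 + A ^ 2) * 4 powr \<gamma>)"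
  define E2 where "E2 = C' * C1 * (4 * c) powr \<delta>2"
  have "0 < E1" using params C A_ge_1 by (auto simp: E1_def intro!: mult_pos_pos add_pos_nonneg)
  moreover have "0 < E2" using params C' c_ge_1 by (simp add: E2_def)
  ultimately have E: "0 < E1" "0 < E2" "0 < E1 + E2" by auto
  show thesis
  proof (rule that[of "E1 + E2"])
    show "0 < E1 + E2" by fact
    fix f a b and x0 x :: 'a and r t :: real
    assume loc: "localized_oscillation f a b" and r: "0 < r" and x: "x \<in> ball x0 r"
      and t: "0 < t" and t4: "t < 4 * r"
    have osc: "oscillation_le M f a b" and zero: "\<And>x s. \<rho> x \<le> s \<Longrightarrow> a x s = 0"
      using loc by (auto simp: localized_oscillation_def)
    note [measurable] = oscillation_leD(1)[OF osc]
    have b: "0 < b" using osc by (rule oscillation_leD)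
    define u where "u = t / (4 * r)"
    have u: "0 < u" "u \<le> 1" using t t4 r by (auto simp: u_def)
    have tr: "t / r = 4 * u" using r by (simp add: u_def)
    let ?d = "a x0 (2 * r)" and ?B = "ball x0 (2 * r)"
    let ?f1 = "\<lambda>y. indicator ?B y *\<^sub>R (f y - ?d)"
    let ?f2 = "\<lambda>y. indicator (- ?B) y *\<^sub>R (f y - ?d)"
    have sub: "ball x r \<subseteq> ?B"
    proof
      fix z assume "z \<in> ball x r"
      then show "z \<in> ?B" using x dist_triangle[of x0 z x] by simp
    qed
    define m where "m = cmod (a x r - ?d)"
    have m: "m \<le> (1 + A ^ 2) * b"
      unfolding m_def
    proof (rule oscillation_compare[OF osc r _ sub])
      show "V x0 (2 * r) \<le> A ^ 2 * V x r"
        using V_le[OF r, of "2 * r" 2 x x0] x r by (simp add: dist_commute)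
    qed (use r in auto)
    let ?k = "decay_kernel M \<gamma> t x"
    have "(\<integral>\<^sup>+y. ennreal (?k y * cmod (?f2 y)) \<partial>M)
        \<le> (\<integral>\<^sup>+y. ennreal (?k y * cmod (f y - a x r)) * indicator (- ball x r) y
            + ennreal m * (ennreal (?k y * cmod (1 - 0)) * indicator (- ball x r) y) \<partial>M)"
    proof (intro nn_integral_mono)
      fix y
      show "ennreal (?k y * cmod (?f2 y)) \<le> ennreal (?k y * cmod (f y - a x r)) * indicator (- ball x r) y
            + ennreal m * (ennreal (?k y * cmod (1 - 0)) * indicator (- ball x r) y)"
      proof (cases "y \<in> ?B")
        case False
        then have y: "y \<notin> ball x r" using sub by blast
        have "cmod (f y - ?d) \<le> cmod (f y - a x r) + m"
          unfolding m_def using norm_triangle_ineq[of "f y - a x r" "a x r - ?d"] by simp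
        then have "?k y * cmod (f y - ?d) \<le> ?k y * cmod (f y - a x r) + m * (?k y * cmod (1 - 0))"
          using mult_left_mono[of _ _ "?k y"] decay_kernel_nonneg by (fastforce simp: algebra_simps)
        then have "ennreal (?k y * cmod (f y - ?d)) \<le> ennreal (?k y * cmod (f y - a x r) + m * (?k y * cmod (1 - 0)))"
          by (rule ennreal_leI)
        also have "\<dots> = ennreal (?k y * cmod (f y - a x r)) + ennreal m * ennreal (?k y * cmod (1 - 0))"
          by (subst ennreal_plus) (auto simp: ennreal_mult m_def)
        finally show ?thesis using False y by simp
      qed simp
    qed
    also have "\<dots> = (\<integral>\<^sup>+y\<in>- ball x r. ennreal (?k y * cmod (f y - a x r)) \<partial>M)
        + ennreal m * (\<integral>\<^sup>+y\<in>- ball x r. ennreal (?k y * cmod (1 - 0)) \<partial>M)"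
      by (subst nn_integral_add) (auto simp: nn_integral_cmult)
    also have "\<dots> \<le> ennreal (C * b * (t / r) powr \<gamma>) + ennreal m * ennreal (C * 1 * (t / r) powr \<gamma>)"
      using C(2)[OF osc r t, of x] C(2)[OF oscillation_one r t, of x] by (intro add_mono mult_left_mono) auto
    also have "\<dots> = ennreal (C * (b + m) * (t / r) powr \<gamma>)"
      using C b by (simp add: m_def ennreal_mult[symmetric] ennreal_plus[symmetric] algebra_simps
         del: ennreal_mult'' ennreal_mult' ennreal_plus)
    also have "\<dots> \<le> ennreal (C * ((2 + A ^ 2) * b) * (t / r) powr \<gamma>)"
      using m C by (intro ennreal_leI mult_right_mono mult_left_mono) (auto simp: algebra_simps)
    finally have "cmod (\<integral>y. Q t x y * ?f2 y \<partial>M) \<le> C1 * (C * ((2 + A ^ 2) * b) * (t / r) powr \<gamma>)"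
      using params C b A_ge_1
      by (intro cmod_integral_mult_le[where k = ?k] Q_le_decay_kernel[OF t]) auto
    also have "\<dots> = E1 * b * u powr \<gamma>"
      using u by (simp add: tr E1_def powr_mult)
    also have "\<dots> \<le> E1 * b * u powr \<eta>"
      using E b u by (intro mult_left_mono powr_mono') (auto simp: \<eta>_def)
    finally have far: "cmod (\<integral>y. Q t x y * ?f2 y \<partial>M) \<le> E1 * b * u powr \<eta>" .
    have const: "cmod (?d * (\<integral>y. Q t x y \<partial>M)) \<le> E2 * b * u powr \<eta>"
    proof (cases "\<rho> x0 \<le> 2 * r")
      case True
      then show ?thesis using zero[of x0 "2 * r"] E b by simp
    next
      case False
      have \<rho>0: "0 < \<rho> x0" "0 < \<rho> x" by (rule rho_pos)+
      have \<rho>: "\<rho> x0 \<le> c * \<rho> x" using x False r by (intro rho_comparable) auto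
      have "cmod ?d \<le> C' * b * ((2 * r + \<rho> x0) / (2 * r)) powr \<delta>2"
        using C'(2)[OF osc _ \<rho>0(1) zero, of "2 * r"] r by simp
      also have "\<dots> \<le> C' * b * (\<rho> x0 / r) powr \<delta>2"
        using C' b r \<rho>0 False params
        by (intro mult_left_mono powr_mono2) (auto simp: field_simps)
      finally have d: "cmod ?d \<le> C' * b * (\<rho> x0 / r) powr \<delta>2" .
      have "t / (t + \<rho> x) \<le> c * t / \<rho> x0"
      proof -
        have "t / (t + \<rho> x) \<le> t / \<rho> x" using t \<rho>0 by (intro divide_left_mono mult_pos_pos) auto
        also have "t / \<rho> x = c * t / (c * \<rho> x)" using c_ge_1 by simp
        also have "\<dots> \<le> c * t / \<rho> x0" using \<rho> \<rho>0 t c_ge_1 by (intro divide_left_mono mult_pos_pos) auto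
        finally show ?thesis .
      qed
      then have "C1 * (t / (t + \<rho> x)) powr \<delta>2 \<le> C1 * (c * t / \<rho> x0) powr \<delta>2"
        using params t \<rho>0 by (intro mult_left_mono powr_mono2) auto
      then have q: "cmod (\<integral>y. Q t x y \<partial>M) \<le> C1 * (c * t / \<rho> x0) powr \<delta>2"
        using Q_cancel[OF t, of x] by simp
      have "cmod (?d * (\<integral>y. Q t x y \<partial>M)) \<le> (C' * b * (\<rho> x0 / r) powr \<delta>2) * (C1 * (c * t / \<rho> x0) powr \<delta>2)"
        unfolding norm_mult using d q C' b by (intro mult_mono) auto
      also have "\<dots> = C' * C1 * b * ((\<rho> x0 / r) powr \<delta>2 * (c * t / \<rho> x0) powr \<delta>2)" by simp
      also have "(\<rho> x0 / r) powr \<delta>2 * (c * t / \<rho> x0) powr \<delta>2 = ((4 * c) * u) powr \<delta>2"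
      proof -
        have "(\<rho> x0 / r) * (c * t / \<rho> x0) = (4 * c) * u" using \<rho>0 r by (simp add: u_def)
        then show ?thesis using \<rho>0 r t c_ge_1 by (subst powr_mult[symmetric]) auto
      qed
      also have "\<dots> = (4 * c) powr \<delta>2 * u powr \<delta>2" using c_ge_1 u by (intro powr_mult; simp)
      also have "C' * C1 * b * \<dots> = E2 * b * u powr \<delta>2" by (simp add: E2_def)
      also have "\<dots> \<le> E2 * b * u powr \<eta>"
        using E b u by (intro mult_left_mono powr_mono') (auto simp: \<eta>_def)
      finally show ?thesis .
    qed
    have Qint: "integrable M (\<lambda>y. Q t x y * (f y - ?d))" by (rule Q_mult_integrable[OF osc t])
    have "(\<integral>y. Q t x y * (f y - ?d) \<partial>M) = (\<integral>y. indicator ?B y *\<^sub>R (Q t x y * (f y - ?d))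
          + indicator (- ?B) y *\<^sub>R (Q t x y * (f y - ?d)) \<partial>M)"
      by (intro Bochner_Integration.integral_cong) (auto simp: indicator_def)
    also have "\<dots> = (\<integral>y. indicator ?B y *\<^sub>R (Q t x y * (f y - ?d)) \<partial>M)
          + (\<integral>y. indicator (- ?B) y *\<^sub>R (Q t x y * (f y - ?d)) \<partial>M)"
      using space_eq_UNIV sets.compl_sets[OF ball_in_sets, of x0 "2 * r"]
      by (intro Bochner_Integration.integral_add integrable_mult_indicator Qint) (auto simp: Compl_eq_Diff_UNIV)
    finally have "kernel_op M (Q t) f x = kernel_op M (Q t) ?f1 x + (\<integral>y. Q t x y * ?f2 y \<partial>M) + ?d * (\<integral>y. Q t x y \<partial>M)"
      unfolding kernel_op_split[OF osc t, of x ?d] by (simp add: kernel_op_def)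
    then have "cmod (kernel_op M (Q t) f x) \<le> cmod (kernel_op M (Q t) ?f1 x) + cmod (\<integral>y. Q t x y * ?f2 y \<partial>M)
        + cmod (?d * (\<integral>y. Q t x y \<partial>M))"
      by (simp add: norm_triangle_le norm_triangle_mono norm_triangle_ineq order_trans[OF norm_triangle_ineq])
    also have "\<dots> \<le> cmod (kernel_op M (Q t) ?f1 x) + (E1 * b * u powr \<eta> + E2 * b * u powr \<eta>)"
      using far const by simp
    finally show "cmod (kernel_op M (Q t) f x) \<le> cmod (kernel_op M (Q t) ?f1 x) + (E1 + E2) * b * (t / (4 * r)) powr \<eta>"
      by (simp add: u_def algebra_simps)
  qed
qed

text \<open>
The small scales on average. The first piece of the splitting is square integrable by the John-Nirenberg
inequality, so the \<open>L\<^sup>2\<close> bound for the square function applies to it; the remaining error is a positive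
power of \<open>t / (4 * r)\<close>, which is square integrable for \<open>dt / t\<close> near zero.
\<close>

lemma square_local:
  obtains C where "0 < C"
    "\<And>f a b x0 r. localized_oscillation f a b \<Longrightarrow> 0 < r \<Longrightarrow>
       (\<integral>\<^sup>+x\<in>ball x0 r. square_on {0<..<4 * r} f x \<partial>M) \<le> ennreal (C * b\<^sup>2 * V x0 r)"
proof -
  define \<eta> where "\<eta> = min \<gamma> \<delta>2"
  have \<eta>: "0 < \<eta>" using params by (simp add: \<eta>_def)
  obtain E where E: "0 < E"
    "\<And>f a b x0 x r t. localized_oscillation f a b \<Longrightarrow> 0 < r \<Longrightarrow> x \<in> ball x0 r \<Longrightarrow> 0 < t \<Longrightarrow> t < 4 * r \<Longrightarrow>
       cmod (kernel_op M (Q t) f x)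
         \<le> cmod (kernel_op M (Q t) (\<lambda>y. indicator (ball x0 (2 * r)) y *\<^sub>R (f y - a x0 (2 * r))) x)
           + E * b * (t / (4 * r)) powr \<eta>"
    using kernel_op_local unfolding \<eta>_def by blast
  obtain J where J: "0 < J"
    "\<And>f a b x r. oscillation_le M f a b \<Longrightarrow> 0 < r \<Longrightarrow>
       (\<integral>\<^sup>+y\<in>ball x r. ennreal ((cmod (f y - a x r))\<^sup>2) \<partial>M) \<le> ennreal (J * b\<^sup>2 * V x r)"
    using john_nirenberg_square by blast
  obtain K where K: "0 < K" "\<And>h. h \<in> L2 M \<Longrightarrow>
    (\<integral>\<^sup>+x. g_square M Q h x \<partial>M) \<le> ennreal K * (\<integral>\<^sup>+x. ennreal ((cmod (h x))\<^sup>2) \<partial>M)"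
    using g_square_L2 by blast
  define C where "C = 2 * K * J * A + E\<^sup>2 / \<eta>"
  show thesis
  proof (rule that[of C])
    show "0 < C" using K J E \<eta> A_ge_1 by (auto simp: C_def intro!: add_pos_pos)
    fix f a b and x0 :: 'a and r :: real
    assume loc: "localized_oscillation f a b" and r: "0 < r"
    have osc: "oscillation_le M f a b" using loc by (auto simp: localized_oscillation_def)
    note f [measurable] = oscillation_leD(1)[OF osc]
    have b: "0 < b" using osc by (rule oscillation_leD)
    define h where "h y = indicator (ball x0 (2 * r)) y *\<^sub>R (f y - a x0 (2 * r))" for y
    have [measurable]: "h \<in> borel_measurable M" unfolding h_def by measurable
    have "(\<integral>\<^sup>+x. ennreal ((cmod (h x))\<^sup>2) \<partial>M) = (\<integral>\<^sup>+y\<in>ball x0 (2 * r). ennreal ((cmod (f y - a x0 (2 * r)))\<^sup>2) \<partial>M)"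
      by (intro nn_integral_cong) (auto simp: h_def indicator_def)
    also have "\<dots> \<le> ennreal (J * b\<^sup>2 * V x0 (2 * r))" using r by (intro J(2)[OF osc]) auto
    also have "\<dots> \<le> ennreal (J * b\<^sup>2 * (A * V x0 r))"
      using J doubling[OF r, of x0] by (intro ennreal_leI mult_left_mono) auto
    finally have hsq: "(\<integral>\<^sup>+x. ennreal ((cmod (h x))\<^sup>2) \<partial>M) \<le> ennreal (J * b\<^sup>2 * (A * V x0 r))" .
    have "h \<in> L2 M"
      unfolding L2_def
    proof (intro CollectI conjI integrableI_bounded)
      show "(\<integral>\<^sup>+x. ennreal (norm ((cmod (h x))\<^sup>2)) \<partial>M) < \<infinity>"
        using hsq by (auto intro: le_less_trans)
    qed measurable
    from K(2)[OF this] have "(\<integral>\<^sup>+x. g_square M Q h x \<partial>M) \<le> ennreal K * ennreal (J * b\<^sup>2 * (A * V x0 r))"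
      using hsq by (elim order_trans) (intro mult_left_mono, auto)
    also have "\<dots> = ennreal (K * J * A * b\<^sup>2 * V x0 r)"
      using K J A_ge_1 by (simp add: ennreal_mult[symmetric] ac_simps del: ennreal_mult'' ennreal_mult')
    finally have gh: "(\<integral>\<^sup>+x. g_square M Q h x \<partial>M) \<le> ennreal (K * J * A * b\<^sup>2 * V x0 r)" .
    have pt: "square_on {0<..<4 * r} f x \<le> 2 * g_square M Q h x + ennreal (E\<^sup>2 * b\<^sup>2 / \<eta>)" if x: "x \<in> ball x0 r" for x
    proof -
      let ?h = "\<lambda>t. ennreal ((cmod (kernel_op M (Q t) h x))\<^sup>2 / t) * indicator {0<..<4 * r} t"
      let ?p = "\<lambda>t. ennreal ((t / (4 * r)) powr (2 * \<eta>) / t) * indicator {0<..<4 * r} t"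
      have hm [measurable]: "?h \<in> borel_measurable lborel"
        by (intro square_integrand_measurable) auto
      have "square_on {0<..<4 * r} f x \<le> (\<integral>\<^sup>+t. 2 * ?h t + ennreal (2 * E\<^sup>2 * b\<^sup>2) * ?p t \<partial>lborel)"
        unfolding square_on_def
      proof (intro nn_integral_mono)
        fix t
        show "ennreal ((cmod (kernel_op M (Q t) f x))\<^sup>2 / t) * indicator {0<..<4 * r} t
            \<le> 2 * ?h t + ennreal (2 * E\<^sup>2 * b\<^sup>2) * ?p t"
        proof (cases "t \<in> {0<..<4 * r}")
          case True
          then have t: "0 < t" "t < 4 * r" by auto
          let ?w = "E * b * (t / (4 * r)) powr \<eta>"
          have "cmod (kernel_op M (Q t) f x) \<le> cmod (kernel_op M (Q t) h x) + ?w"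
            using E(2)[OF loc r x t] by (simp add: h_def[abs_def])
          then have "(cmod (kernel_op M (Q t) f x))\<^sup>2 \<le> (cmod (kernel_op M (Q t) h x) + ?w)\<^sup>2"
            by (intro power_mono) auto
          also have "\<dots> \<le> 2 * (cmod (kernel_op M (Q t) h x))\<^sup>2 + 2 * ?w\<^sup>2"
            using sum_squares_bound[of "cmod (kernel_op M (Q t) h x)" ?w] by (simp add: power2_sum)
          also have "?w\<^sup>2 = E\<^sup>2 * b\<^sup>2 * (t / (4 * r)) powr (2 * \<eta>)"
            using t by (simp add: power_mult_distrib power2_eq_square powr_add[symmetric])
          finally have "(cmod (kernel_op M (Q t) f x))\<^sup>2 / t
              \<le> (2 * (cmod (kernel_op M (Q t) h x))\<^sup>2 + 2 * (E\<^sup>2 * b\<^sup>2 * (t / (4 * r)) powr (2 * \<eta>))) / t"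
            using t by (intro divide_right_mono) auto
          also have "\<dots> = 2 * ((cmod (kernel_op M (Q t) h x))\<^sup>2 / t)
              + (2 * E\<^sup>2 * b\<^sup>2) * ((t / (4 * r)) powr (2 * \<eta>) / t)"
            by (simp add: add_divide_distrib)
          finally have "ennreal ((cmod (kernel_op M (Q t) f x))\<^sup>2 / t)
            \<le> ennreal (2 * ((cmod (kernel_op M (Q t) h x))\<^sup>2 / t)
              + (2 * E\<^sup>2 * b\<^sup>2) * ((t / (4 * r)) powr (2 * \<eta>) / t))"
            by (rule ennreal_leI)
          also have "\<dots> = 2 * ennreal ((cmod (kernel_op M (Q t) h x))\<^sup>2 / t)
              + ennreal (2 * E\<^sup>2 * b\<^sup>2) * ennreal ((t / (4 * r)) powr (2 * \<eta>) / t)"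
            using t by (subst ennreal_plus) (auto simp: ennreal_mult simp del: times_divide_eq_right)
          finally show ?thesis using True by simp
        qed simp
      qed
      also have "\<dots> = 2 * (\<integral>\<^sup>+t. ?h t \<partial>lborel) + ennreal (2 * E\<^sup>2 * b\<^sup>2) * (\<integral>\<^sup>+t. ?p t \<partial>lborel)"
        by (subst nn_integral_add) (auto simp: nn_integral_cmult)
      also have "\<dots> \<le> 2 * g_square M Q h x + ennreal (2 * E\<^sup>2 * b\<^sup>2) * ennreal (1 / (2 * \<eta>))"
      proof (intro add_mono mult_left_mono)
        show "(\<integral>\<^sup>+t. ?h t \<partial>lborel) \<le> g_square M Q h x"
          unfolding g_square_def by (rule set_nn_integral_mono_set) auto
        show "(\<integral>\<^sup>+t. ?p t \<partial>lborel) \<le> ennreal (1 / (2 * \<eta>))"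
          using \<eta> r by (intro nn_integral_powr_near_zero) auto
      qed auto
      also have "ennreal (2 * E\<^sup>2 * b\<^sup>2) * ennreal (1 / (2 * \<eta>)) = ennreal (E\<^sup>2 * b\<^sup>2 / \<eta>)"
        using \<eta> by (simp add: ennreal_mult'[symmetric] del: ennreal_mult')
      finally show ?thesis .
    qed
    have [measurable]: "g_square M Q h \<in> borel_measurable M"
      unfolding g_square_eq by (intro square_on_measurable) auto
    have "(\<integral>\<^sup>+x\<in>ball x0 r. square_on {0<..<4 * r} f x \<partial>M)
        \<le> (\<integral>\<^sup>+x. 2 * g_square M Q h x + ennreal (E\<^sup>2 * b\<^sup>2 / \<eta>) * indicator (ball x0 r) x \<partial>M)"
      using pt by (intro nn_integral_mono) (auto simp: indicator_def)
    also have "\<dots> = 2 * (\<integral>\<^sup>+x. g_square M Q h x \<partial>M) + (\<integral>\<^sup>+x\<in>ball x0 r. ennreal (E\<^sup>2 * b\<^sup>2 / \<eta>) \<partial>M)"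
      by (subst nn_integral_add) (auto simp: nn_integral_cmult)
    also have "\<dots> \<le> 2 * ennreal (K * J * A * b\<^sup>2 * V x0 r) + ennreal (E\<^sup>2 * b\<^sup>2 / \<eta> * V x0 r)"
      using gh \<eta> by (intro add_mono mult_left_mono) (auto simp: set_nn_integral_const_ball)
    also have "\<dots> = ennreal (2 * (K * J * A * b\<^sup>2 * V x0 r)) + ennreal (E\<^sup>2 * b\<^sup>2 / \<eta> * V x0 r)"
      using K J A_ge_1 by (simp add: ennreal_mult)
    also have "\<dots> = ennreal (C * b\<^sup>2 * V x0 r)"
      using K J A_ge_1 \<eta> by (subst ennreal_plus[symmetric]) (auto simp: C_def algebra_simps)
    finally show "(\<integral>\<^sup>+x\<in>ball x0 r. square_on {0<..<4 * r} f x \<partial>M) \<le> ennreal (C * b\<^sup>2 * V x0 r)" .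
  qed
qed

end

section \<open>The square function at large scales\<close>

text \<open>
The triangle inequality in a weighted \<open>L\<^sup>2\<close> space, in a form that does not presuppose that \<open>u\<close> is square
integrable. It is the integrated form of
\<open>(v + h)\<^sup>2 \<le> (1 + D / P) * v\<^sup>2 + (1 + P / D) * h\<^sup>2\<close>, whose right-hand side integrates to \<open>(P + D)\<^sup>2\<close>.
\<close>

lemma nn_integral_square_perturb:
  fixes u v :: "'b \<Rightarrow> complex" and h w :: "'b \<Rightarrow> real" and P D :: real
  assumes le: "\<And>t. t \<in> S \<Longrightarrow> cmod (u t) \<le> cmod (v t) + h t"
    and nonneg: "\<And>t. t \<in> S \<Longrightarrow> 0 \<le> w t \<and> 0 \<le> h t" and PD: "0 < P" "0 < D"
    and [measurable]: "(\<lambda>t. ennreal ((cmod (v t))\<^sup>2 * w t) * indicator S t) \<in> borel_measurable N"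
      "(\<lambda>t. ennreal ((h t)\<^sup>2 * w t) * indicator S t) \<in> borel_measurable N"
    and v: "(\<integral>\<^sup>+t\<in>S. ennreal ((cmod (v t))\<^sup>2 * w t) \<partial>N) \<le> ennreal (P\<^sup>2)"
    and h: "(\<integral>\<^sup>+t\<in>S. ennreal ((h t)\<^sup>2 * w t) \<partial>N) \<le> ennreal (D\<^sup>2)"
  shows "(\<integral>\<^sup>+t\<in>S. ennreal ((cmod (u t))\<^sup>2 * w t) \<partial>N) \<le> ennreal ((P + D)\<^sup>2)"
proof -
  have "(\<integral>\<^sup>+t\<in>S. ennreal ((cmod (u t))\<^sup>2 * w t) \<partial>N)
      \<le> (\<integral>\<^sup>+t. ennreal (1 + D / P) * (ennreal ((cmod (v t))\<^sup>2 * w t) * indicator S t)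
          + ennreal (1 + P / D) * (ennreal ((h t)\<^sup>2 * w t) * indicator S t) \<partial>N)"
  proof (intro nn_integral_mono)
    fix t
    show "ennreal ((cmod (u t))\<^sup>2 * w t) * indicator S t
        \<le> ennreal (1 + D / P) * (ennreal ((cmod (v t))\<^sup>2 * w t) * indicator S t)
          + ennreal (1 + P / D) * (ennreal ((h t)\<^sup>2 * w t) * indicator S t)"
    proof (cases "t \<in> S")
      case True
      let ?v = "cmod (v t)" and ?h = "h t"
      have "0 \<le> (D * ?v - P * ?h)\<^sup>2 / (P * D)" using PD by simp
      also have "\<dots> = (D / P) * ?v\<^sup>2 + (P / D) * ?h\<^sup>2 - 2 * ?v * ?h"
        using PD by (simp add: power2_eq_square field_simps)
      finally have "(?v + ?h)\<^sup>2 \<le> (1 + D / P) * ?v\<^sup>2 + (1 + P / D) * ?h\<^sup>2"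
        by (simp add: power2_eq_square algebra_simps)
      moreover have "(cmod (u t))\<^sup>2 \<le> (?v + ?h)\<^sup>2"
        using le[OF True] by (intro power_mono) auto
      ultimately have "(cmod (u t))\<^sup>2 \<le> (1 + D / P) * ?v\<^sup>2 + (1 + P / D) * ?h\<^sup>2"
        by linarith
      then have "(cmod (u t))\<^sup>2 * w t \<le> ((1 + D / P) * ?v\<^sup>2 + (1 + P / D) * ?h\<^sup>2) * w t"
        using nonneg[OF True] by (intro mult_right_mono) auto
      then have "ennreal ((cmod (u t))\<^sup>2 * w t) \<le> ennreal ((1 + D / P) * (?v\<^sup>2 * w t) + (1 + P / D) * (?h\<^sup>2 * w t))"
        by (intro ennreal_leI) (simp add: algebra_simps)
      also have "\<dots> = ennreal (1 + D / P) * ennreal (?v\<^sup>2 * w t) + ennreal (1 + P / D) * ennreal (?h\<^sup>2 * w t)"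
        using PD nonneg[OF True] by (subst ennreal_plus) (auto simp: ennreal_mult)
      finally show ?thesis using True by simp
    qed simp
  qed
  also have "\<dots> = ennreal (1 + D / P) * (\<integral>\<^sup>+t\<in>S. ennreal ((cmod (v t))\<^sup>2 * w t) \<partial>N)
      + ennreal (1 + P / D) * (\<integral>\<^sup>+t\<in>S. ennreal ((h t)\<^sup>2 * w t) \<partial>N)"
    by (subst nn_integral_add) (auto simp: nn_integral_cmult)
  also have "\<dots> \<le> ennreal (1 + D / P) * ennreal (P\<^sup>2) + ennreal (1 + P / D) * ennreal (D\<^sup>2)"
    using v h by (intro add_mono mult_left_mono) auto
  also have "\<dots> = ennreal ((1 + D / P) * P\<^sup>2 + (1 + P / D) * D\<^sup>2)"
    using PD by (subst ennreal_plus) (auto simp: ennreal_mult)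
  also have "(1 + D / P) * P\<^sup>2 + (1 + P / D) * D\<^sup>2 = (P + D)\<^sup>2"
    using PD by (simp add: power2_eq_square field_simps)
  finally show ?thesis .
qed

context kernel_square_function
begin

text \<open>
The large scales hardly vary on the ball: by smoothness the difference of the operators at two of its
points is of size \<open>(r / t) powr (\<beta> / 2)\<close>, which is square integrable for \<open>dt / t\<close> on \<open>t \<ge> 4 * r\<close>. The cut at
\<open>4 * r\<close> ensures that points of the ball are at distance at most \<open>t / 2\<close>.
\<close>

lemma square_tail_compare:
  obtains D where "0 < D"
    "\<And>f a b x0 r x x'. localized_oscillation f a b \<Longrightarrow> 0 < r \<Longrightarrow> x \<in> ball x0 r \<Longrightarrow> x' \<in> ball x0 r \<Longrightarrow>
       square_on {4 * r..} f x' < \<infinity> \<Longrightarrow>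
       sqrt (enn2real (square_on {4 * r..} f x)) \<le> sqrt (enn2real (square_on {4 * r..} f x')) + D * b"
proof -
  obtain C where C: "0 < C"
    "\<And>f a b x x' t. localized_oscillation f a b \<Longrightarrow> 0 < t \<Longrightarrow> dist x x' \<le> t / 2 \<Longrightarrow>
       cmod (kernel_op M (Q t) f x - kernel_op M (Q t) f x') \<le> C * b * (dist x x' / t) powr (\<beta> / 2)"
    using kernel_op_smooth by blast
  define D where "D = C * (1 / \<beta>) powr (1 / 2)"
  have D: "0 < D" using C params by (simp add: D_def)
  show thesis
  proof (rule that[of "2 * D"])
    show "0 < 2 * D" using D by simp
    fix f a b and x0 x x' :: 'a and r :: real
    assume loc: "localized_oscillation f a b" and r: "0 < r"
      and x: "x \<in> ball x0 r" "x' \<in> ball x0 r" and fin: "square_on {4 * r..} f x' < \<infinity>"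
    have osc: "oscillation_le M f a b" using loc by (auto simp: localized_oscillation_def)
    note f [measurable] = oscillation_leD(1)[OF osc]
    have b: "0 < b" using osc by (rule oscillation_leD)
    (* Adding D * b makes P positive; the price is a second D * b in the conclusion. *)
    define P where "P = sqrt (enn2real (square_on {4 * r..} f x')) + D * b"
    have P: "0 < P" using D b by (auto simp: P_def intro!: add_nonneg_pos)
    have xx': "dist x x' \<le> 2 * r" using x dist_triangle3[of x x' x0] by simp
    let ?S = "{4 * r..}" and ?h = "\<lambda>t. C * b * (4 * r / t) powr (\<beta> / 2)"
    have S: "?S \<subseteq> {0<..}" using r by auto
    have hsq: "(?h t)\<^sup>2 * (1 / t) = (C * b)\<^sup>2 * ((4 * r / t) powr \<beta> / t)" if "t \<in> ?S" for t
      using that r by (simp add: power_mult_distrib power2_eq_square[of "_ powr _"] powr_add[symmetric])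
    have h: "(\<integral>\<^sup>+t\<in>?S. ennreal ((?h t)\<^sup>2 * (1 / t)) \<partial>lborel) \<le> ennreal ((D * b)\<^sup>2)"
    proof -
      have "(\<integral>\<^sup>+t\<in>?S. ennreal ((?h t)\<^sup>2 * (1 / t)) \<partial>lborel)
          = (\<integral>\<^sup>+t. ennreal ((C * b)\<^sup>2) * (ennreal ((4 * r / t) powr \<beta> / t) * indicator ?S t) \<partial>lborel)"
      proof (intro nn_integral_cong)
        fix t
        show "ennreal ((?h t)\<^sup>2 * (1 / t)) * indicator ?S t
            = ennreal ((C * b)\<^sup>2) * (ennreal ((4 * r / t) powr \<beta> / t) * indicator ?S t)"
        proof (cases "t \<in> ?S")
          case True
          show ?thesis
            unfolding hsq[OF True] using True r by (subst ennreal_mult) auto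
        qed simp
      qed
      also have "\<dots> = ennreal ((C * b)\<^sup>2) * (\<integral>\<^sup>+t\<in>?S. ennreal ((4 * r / t) powr \<beta> / t) \<partial>lborel)"
        by (intro nn_integral_cmult) measurable
      also have "\<dots> \<le> ennreal ((C * b)\<^sup>2) * ennreal (1 / \<beta>)"
        using params r by (intro mult_left_mono nn_integral_powr_at_infinity) auto
      also have "\<dots> = ennreal ((D * b)\<^sup>2)"
        using params by (simp add: D_def ennreal_mult'[symmetric] power_mult_distrib
            power2_eq_square[of "_ powr _"] powr_add[symmetric] ac_simps del: ennreal_mult')
      finally show ?thesis .
    qed
    have "(\<integral>\<^sup>+t\<in>?S. ennreal ((cmod (kernel_op M (Q t) f x))\<^sup>2 * (1 / t)) \<partial>lborel) \<le> ennreal ((P + D * b)\<^sup>2)"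
    proof (rule nn_integral_square_perturb[where h = ?h and v = "\<lambda>t. kernel_op M (Q t) f x'"])
      fix t assume t: "t \<in> ?S"
      then have t0: "0 < t" using r by auto
      have "cmod (kernel_op M (Q t) f x - kernel_op M (Q t) f x') \<le> C * b * (dist x x' / t) powr (\<beta> / 2)"
        using t xx' t0 by (intro C(2)[OF loc]) auto
      also have "\<dots> \<le> ?h t"
        using t0 xx' r C b params by (intro mult_left_mono powr_mono2 divide_right_mono) auto
      finally show "cmod (kernel_op M (Q t) f x) \<le> cmod (kernel_op M (Q t) f x') + ?h t"
        using norm_triangle_sub[of "kernel_op M (Q t) f x" "kernel_op M (Q t) f x'"] by linarith
      show "0 \<le> 1 / t \<and> 0 \<le> ?h t" using t0 C b by simp
    next
      show "(\<lambda>t. ennreal ((cmod (kernel_op M (Q t) f x'))\<^sup>2 * (1 / t)) * indicator ?S t) \<in> borel_measurable lborel"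
        using square_integrand_measurable[OF f _ S, of x'] by simp
      have "(\<integral>\<^sup>+t\<in>?S. ennreal ((cmod (kernel_op M (Q t) f x'))\<^sup>2 * (1 / t)) \<partial>lborel) = square_on ?S f x'"
        by (simp add: square_on_def)
      also have "\<dots> = ennreal ((sqrt (enn2real (square_on ?S f x')))\<^sup>2)"
        using fin by simp
      also have "\<dots> \<le> ennreal (P\<^sup>2)"
        using D b by (intro ennreal_leI power_mono) (auto simp: P_def)
      finally show "(\<integral>\<^sup>+t\<in>?S. ennreal ((cmod (kernel_op M (Q t) f x'))\<^sup>2 * (1 / t)) \<partial>lborel) \<le> ennreal (P\<^sup>2)" .
    qed (use h P D b in auto)
    then have "square_on ?S f x \<le> ennreal ((P + D * b)\<^sup>2)" by (simp add: square_on_def)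
    then have "enn2real (square_on ?S f x) \<le> (P + D * b)\<^sup>2"
      by (intro enn2real_leI) auto
    then have "sqrt (enn2real (square_on ?S f x)) \<le> P + D * b"
      using P D b by (intro real_le_lsqrt) auto
    then show "sqrt (enn2real (square_on ?S f x)) \<le> sqrt (enn2real (square_on ?S f x')) + 2 * D * b"
      by (simp add: P_def)
  qed
qed

text \<open>
On a large ball the tail itself is bounded, since there \<open>\<rho>\<close> is at most \<open>c * r\<close> at every point.
\<close>

lemma square_tail_large:
  obtains D where "0 < D"
    "\<And>f a b x0 r x. localized_oscillation f a b \<Longrightarrow> 0 < r \<Longrightarrow> \<rho> x0 \<le> r \<Longrightarrow> x \<in> ball x0 r \<Longrightarrow>
       square_on {4 * r..} f x \<le> ennreal ((D * b)\<^sup>2)"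
proof -
  obtain C where C: "0 < C"
    "\<And>f a b x r t. localized_oscillation f a b \<Longrightarrow> 0 < r \<Longrightarrow> \<rho> x \<le> c * r \<Longrightarrow> r \<le> t \<Longrightarrow>
       cmod (kernel_op M (Q t) f x) \<le> C * b * (r / t) powr \<delta>1"
    using kernel_op_decay by blast
  define D where "D = C * (1 / (2 * \<delta>1)) powr (1 / 2)"
  have D: "0 < D" using C params by (simp add: D_def)
  show thesis
  proof (rule that[of D])
    show "0 < D" by fact
    fix f a b and x0 x :: 'a and r :: real
    assume loc: "localized_oscillation f a b" and r: "0 < r" and \<rho>: "\<rho> x0 \<le> r" and x: "x \<in> ball x0 r"
    have b: "0 < b" using loc by (auto simp: localized_oscillation_def oscillation_le_def)
    (* If rho x exceeds r, then x0 is within distance rho x of x and comparability applies. *)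
    have "\<rho> x \<le> c * r"
    proof (cases "\<rho> x \<le> r")
      case True
      also have "r \<le> c * r" using c_ge_1 r by simp
      finally show ?thesis .
    next
      case False
      then have "\<rho> x \<le> c * \<rho> x0" using x by (intro rho_comparable) (auto simp: dist_commute)
      also have "\<dots> \<le> c * r" using \<rho> c_ge_1 by simp
      finally show ?thesis .
    qed
    also have "\<dots> \<le> c * (4 * r)" using c_ge_1 r by simp
    finally have \<rho>x: "\<rho> x \<le> c * (4 * r)" .
    have "square_on {4 * r..} f x
        \<le> (\<integral>\<^sup>+t. ennreal ((C * b)\<^sup>2) * (ennreal ((4 * r / t) powr (2 * \<delta>1) / t) * indicator {4 * r..} t) \<partial>lborel)"
      unfolding square_on_def
    proof (intro nn_integral_mono)
      fix t
      show "ennreal ((cmod (kernel_op M (Q t) f x))\<^sup>2 / t) * indicator {4 * r..} t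
          \<le> ennreal ((C * b)\<^sup>2) * (ennreal ((4 * r / t) powr (2 * \<delta>1) / t) * indicator {4 * r..} t)"
      proof (cases "t \<in> {4 * r..}")
        case True
        then have t: "4 * r \<le> t" "0 < t" using r by auto
        have "cmod (kernel_op M (Q t) f x) \<le> C * b * (4 * r / t) powr \<delta>1"
          using r \<rho>x t by (intro C(2)[OF loc]) auto
        then have "(cmod (kernel_op M (Q t) f x))\<^sup>2 \<le> (C * b * (4 * r / t) powr \<delta>1)\<^sup>2"
          by (intro power_mono) auto
        also have "\<dots> = (C * b)\<^sup>2 * (4 * r / t) powr (2 * \<delta>1)"
          using r t by (simp add: power_mult_distrib power2_eq_square[of "_ powr _"] powr_add[symmetric])
        finally have "(cmod (kernel_op M (Q t) f x))\<^sup>2 / t \<le> ((C * b)\<^sup>2 * (4 * r / t) powr (2 * \<delta>1)) / t"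
          using t by (intro divide_right_mono) auto
        then have "(cmod (kernel_op M (Q t) f x))\<^sup>2 / t \<le> (C * b)\<^sup>2 * ((4 * r / t) powr (2 * \<delta>1) / t)" by simp
        then show ?thesis
          using True by (auto simp: ennreal_mult'[symmetric] simp del: ennreal_mult' intro!: ennreal_leI)
      qed simp
    qed
    also have "\<dots> = ennreal ((C * b)\<^sup>2) * (\<integral>\<^sup>+t\<in>{4 * r..}. ennreal ((4 * r / t) powr (2 * \<delta>1) / t) \<partial>lborel)"
      by (intro nn_integral_cmult) measurable
    also have "\<dots> \<le> ennreal ((C * b)\<^sup>2) * ennreal (1 / (2 * \<delta>1))"
      using params r by (intro mult_left_mono nn_integral_powr_at_infinity) auto
    also have "\<dots> = ennreal ((D * b)\<^sup>2)"
      using params by (simp add: D_def ennreal_mult'[symmetric] power_mult_distrib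
          power2_eq_square[of "_ powr _"] powr_add[symmetric] ac_simps del: ennreal_mult')
    finally show "square_on {4 * r..} f x \<le> ennreal ((D * b)\<^sup>2)" .
  qed
qed

lemma g_square_split:
  assumes "f \<in> borel_measurable M" "0 < r"
  shows "g_square M Q f x = square_on {0<..<4 * r} f x + square_on {4 * r..} f x"
proof -
  have "(\<lambda>t. ennreal ((cmod (kernel_op M (Q t) f x))\<^sup>2 / t) * indicator S t) \<in> borel_measurable lborel"
    if "S \<in> {{0<..<4 * r}, {4 * r..}}" for S
    using that assms by (intro square_integrand_measurable) auto
  then have "(\<integral>\<^sup>+t. ennreal ((cmod (kernel_op M (Q t) f x))\<^sup>2 / t) * indicator {0<..<4 * r} t
      + ennreal ((cmod (kernel_op M (Q t) f x))\<^sup>2 / t) * indicator {4 * r..} t \<partial>lborel)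
      = square_on {0<..<4 * r} f x + square_on {4 * r..} f x"
    unfolding square_on_def by (intro nn_integral_add) auto
  moreover have "(\<integral>\<^sup>+t. ennreal ((cmod (kernel_op M (Q t) f x))\<^sup>2 / t) * indicator {0<..<4 * r} t
      + ennreal ((cmod (kernel_op M (Q t) f x))\<^sup>2 / t) * indicator {4 * r..} t \<partial>lborel) = g_square M Q f x"
    unfolding g_square_def using assms(2) by (intro nn_integral_cong) (auto simp: indicator_def)
  ultimately show ?thesis by simp
qed

text \<open>
Large balls around any fixed centre exhaust the space, and on each of them the local part is integrable
and the tail is bounded.
\<close>

lemma g_square_finite:
  assumes loc: "localized_oscillation f a b"
  shows "AE x in M. g_square M Q f x < \<infinity>"
proof -
  have osc: "oscillation_le M f a b" using loc by (auto simp: localized_oscillation_def)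
  note f [measurable] = oscillation_leD(1)[OF osc]
  obtain C where C: "0 < C"
    "\<And>f a b x0 r. localized_oscillation f a b \<Longrightarrow> 0 < r \<Longrightarrow>
       (\<integral>\<^sup>+x\<in>ball x0 r. square_on {0<..<4 * r} f x \<partial>M) \<le> ennreal (C * b\<^sup>2 * V x0 r)"
    using square_local by blast
  obtain D where D: "0 < D"
    "\<And>f a b x0 r x. localized_oscillation f a b \<Longrightarrow> 0 < r \<Longrightarrow> \<rho> x0 \<le> r \<Longrightarrow> x \<in> ball x0 r \<Longrightarrow>
       square_on {4 * r..} f x \<le> ennreal ((D * b)\<^sup>2)"
    using square_tail_large by blast
  fix x0 :: 'a
  have "AE x in M. x \<in> ball x0 r \<longrightarrow> g_square M Q f x < \<infinity>" if r: "\<rho> x0 \<le> r" for r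
  proof -
    have r0: "0 < r" using rho_pos[of x0] r by linarith
    have [measurable]: "square_on {0<..<4 * r} f \<in> borel_measurable M"
      by (intro square_on_measurable) auto
    have "AE x in M. square_on {0<..<4 * r} f x * indicator (ball x0 r) x \<noteq> \<infinity>"
    proof (rule nn_integral_PInf_AE)
      show "(\<integral>\<^sup>+x\<in>ball x0 r. square_on {0<..<4 * r} f x \<partial>M) \<noteq> \<infinity>"
        using C(2)[OF loc r0, of x0] by (auto simp: top_unique)
    qed measurable
    then show ?thesis
    proof eventually_elim
      case (elim x)
      show ?case
      proof
        assume x: "x \<in> ball x0 r"
        have "square_on {4 * r..} f x < \<infinity>"
          using D(2)[OF loc r0 r x] by (auto intro: le_less_trans)
        then show "g_square M Q f x < \<infinity>"
          using elim x g_square_split[OF f r0, of x] by (simp add: less_top[symmetric])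
      qed
    qed
  qed
  then have "AE x in M. \<forall>n::nat. x \<in> ball x0 (\<rho> x0 + real n) \<longrightarrow> g_square M Q f x < \<infinity>"
    by (subst AE_all_countable) auto
  then show ?thesis
  proof eventually_elim
    case (elim x)
    obtain n where "dist x0 x < real n" using reals_Archimedean2 by blast
    then have "x \<in> ball x0 (\<rho> x0 + real n)" using rho_pos[of x0] by simp
    then show ?case using elim by blast
  qed
qed

text \<open>
Mean of a square root from a mean of size \<open>b\<^sup>2\<close>: the inequality \<open>sqrt l \<le> l / (2 * b) + b / 2\<close> does the work
of Cauchy-Schwarz.
\<close>

lemma set_nn_integral_sqrt_local:
  assumes b: "0 < b" and B: "0 \<le> B" and [measurable]: "L \<in> borel_measurable M"
    and L: "(\<integral>\<^sup>+x\<in>ball x0 r. L x \<partial>M) \<le> ennreal (C * b\<^sup>2 * V x0 r)" and C: "0 \<le> C"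
  shows "(\<integral>\<^sup>+x\<in>ball x0 r. ennreal (sqrt (enn2real (L x)) + B) \<partial>M) \<le> ennreal (((C + 1) / 2 * b + B) * V x0 r)"
proof -
  have "(\<integral>\<^sup>+x\<in>ball x0 r. ennreal (sqrt (enn2real (L x)) + B) \<partial>M)
      \<le> (\<integral>\<^sup>+x. ennreal (1 / (2 * b)) * (L x * indicator (ball x0 r) x) + ennreal (b / 2 + B) * indicator (ball x0 r) x \<partial>M)"
  proof (intro nn_integral_mono)
    fix x
    define l where "l = enn2real (L x)"
    have l: "0 \<le> l" by (simp add: l_def)
    have "0 \<le> (sqrt l - b)\<^sup>2 / (2 * b)" using b by simp
    also have "(sqrt l - b)\<^sup>2 / (2 * b) = (1 / (2 * b)) * l + b / 2 - sqrt l"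
      using b l by (simp add: power2_diff field_simps) (simp add: power2_eq_square)
    finally have "ennreal (sqrt l + B) \<le> ennreal ((1 / (2 * b)) * l + (b / 2 + B))"
      by (intro ennreal_leI) simp
    also have "\<dots> = ennreal (1 / (2 * b)) * ennreal l + ennreal (b / 2 + B)"
      using b B l by (subst ennreal_plus) (auto simp: ennreal_mult'[symmetric] simp del: ennreal_mult')
    also have "ennreal l \<le> L x" by (cases "L x") (auto simp: l_def)
    finally have "ennreal (sqrt l + B) \<le> ennreal (1 / (2 * b)) * L x + ennreal (b / 2 + B)"
      by (simp add: mult_left_mono add_mono)
    then show "ennreal (sqrt (enn2real (L x)) + B) * indicator (ball x0 r) x
        \<le> ennreal (1 / (2 * b)) * (L x * indicator (ball x0 r) x) + ennreal (b / 2 + B) * indicator (ball x0 r) x"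
      by (auto simp: indicator_def l_def)
  qed
  also have "\<dots> = ennreal (1 / (2 * b)) * (\<integral>\<^sup>+x\<in>ball x0 r. L x \<partial>M) + (\<integral>\<^sup>+x\<in>ball x0 r. ennreal (b / 2 + B) \<partial>M)"
    by (subst nn_integral_add) (auto simp: nn_integral_cmult)
  also have "\<dots> \<le> ennreal (1 / (2 * b)) * ennreal (C * b\<^sup>2 * V x0 r) + ennreal ((b / 2 + B) * V x0 r)"
    using L b B by (intro add_mono mult_left_mono set_nn_integral_const_ball[THEN eq_refl]) auto
  also have "\<dots> = ennreal ((1 / (2 * b)) * (C * b\<^sup>2 * V x0 r) + (b / 2 + B) * V x0 r)"
    using b B C by (subst ennreal_plus) (auto simp: ennreal_mult'[symmetric] simp del: ennreal_mult')
  also have "(1 / (2 * b)) * (C * b\<^sup>2 * V x0 r) + (b / 2 + B) * V x0 r = ((C + 1) / 2 * b + B) * V x0 r"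
    using b by (simp add: power2_eq_square field_simps)
  finally show ?thesis .
qed

lemma g_function_large_ball:
  obtains C where "0 < C"
    "\<And>f a b x0 r. localized_oscillation f a b \<Longrightarrow> 0 < r \<Longrightarrow> \<rho> x0 \<le> r \<Longrightarrow>
       (\<integral>\<^sup>+z\<in>ball x0 r. ennreal \<bar>g_function M Q f z\<bar> \<partial>M) \<le> ennreal (C * b * V x0 r)"
proof -
  obtain C where C: "0 < C"
    "\<And>f a b x0 r. localized_oscillation f a b \<Longrightarrow> 0 < r \<Longrightarrow>
       (\<integral>\<^sup>+x\<in>ball x0 r. square_on {0<..<4 * r} f x \<partial>M) \<le> ennreal (C * b\<^sup>2 * V x0 r)"
    using square_local by blast
  obtain D where D: "0 < D"
    "\<And>f a b x0 r x. localized_oscillation f a b \<Longrightarrow> 0 < r \<Longrightarrow> \<rho> x0 \<le> r \<Longrightarrow> x \<in> ball x0 r \<Longrightarrow>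
       square_on {4 * r..} f x \<le> ennreal ((D * b)\<^sup>2)"
    using square_tail_large by blast
  show thesis
  proof (rule that[of "(C + 1) / 2 + D"])
    show "0 < (C + 1) / 2 + D" using C(1) D(1) by (simp add: add_pos_pos)
    fix f a b and x0 :: 'a and r :: real
    assume loc: "localized_oscillation f a b" and r: "0 < r" and \<rho>: "\<rho> x0 \<le> r"
    have osc: "oscillation_le M f a b" using loc by (auto simp: localized_oscillation_def)
    note f [measurable] = oscillation_leD(1)[OF osc]
    have b: "0 < b" using osc by (rule oscillation_leD)
    let ?L = "square_on {0<..<4 * r} f" and ?T = "square_on {4 * r..} f"
    have "(\<integral>\<^sup>+z\<in>ball x0 r. ennreal \<bar>g_function M Q f z\<bar> \<partial>M)
        \<le> (\<integral>\<^sup>+z\<in>ball x0 r. ennreal (sqrt (enn2real (?L z)) + D * b) \<partial>M)"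
    proof (rule nn_integral_mono_AE, use g_square_finite[OF loc] in eventually_elim)
      case (elim z)
      show ?case
      proof (cases "z \<in> ball x0 r")
        case True
        have fin: "?L z < \<infinity>" "?T z < \<infinity>"
          using elim unfolding g_square_split[OF f r] by auto
        have "enn2real (?T z) \<le> (D * b)\<^sup>2"
          using D(2)[OF loc r \<rho> True] by (intro enn2real_leI) auto
        then have "sqrt (enn2real (?T z)) \<le> D * b"
          using D b by (intro real_le_lsqrt) auto
        moreover have "g_function M Q f z \<le> sqrt (enn2real (?L z)) + sqrt (enn2real (?T z))"
          unfolding g_function_def g_square_split[OF f r] using fin
          by (simp add: enn2real_plus sqrt_add_le_add_sqrt)
        moreover have "0 \<le> g_function M Q f z" by (simp add: g_function_def)
        ultimately show ?thesis using True by (auto intro!: ennreal_leI)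
      qed simp
    qed
    also have "\<dots> \<le> ennreal (((C + 1) / 2 * b + D * b) * V x0 r)"
      using b D C C(2)[OF loc r] by (intro set_nn_integral_sqrt_local square_on_measurable) auto
    also have "(C + 1) / 2 * b + D * b = ((C + 1) / 2 + D) * b" by (simp add: algebra_simps)
    finally show "(\<integral>\<^sup>+z\<in>ball x0 r. ennreal \<bar>g_function M Q f z\<bar> \<partial>M) \<le> ennreal (((C + 1) / 2 + D) * b * V x0 r)" .
  qed
qed

text \<open>
For almost all \<open>z\<close> and \<open>z'\<close> in the ball, \<open>g z\<close> is at most the square root of the local part at \<open>z\<close> plus the
square root of the tail at \<open>z\<close>, and the latter exceeds the one at \<open>z'\<close>, hence \<open>g z'\<close>, by at most
\<open>D * b\<close>. Taking the essential infimum over \<open>z'\<close> leaves only the local part at \<open>z\<close>, whose mean is known.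
\<close>

lemma g_function_lower_oscillation:
  obtains C where "0 < C"
    "\<And>f a b x0 r. localized_oscillation f a b \<Longrightarrow> 0 < r \<Longrightarrow>
       (\<integral>\<^sup>+z\<in>ball x0 r. e2ennreal (ereal (g_function M Q f z) - ess_inf M (ball x0 r) (g_function M Q f)) \<partial>M)
         \<le> ennreal (C * b * V x0 r)"
proof -
  obtain C where C: "0 < C"
    "\<And>f a b x0 r. localized_oscillation f a b \<Longrightarrow> 0 < r \<Longrightarrow>
       (\<integral>\<^sup>+x\<in>ball x0 r. square_on {0<..<4 * r} f x \<partial>M) \<le> ennreal (C * b\<^sup>2 * V x0 r)"
    using square_local by blast
  obtain D where D: "0 < D"
    "\<And>f a b x0 r x x'. localized_oscillation f a b \<Longrightarrow> 0 < r \<Longrightarrow> x \<in> ball x0 r \<Longrightarrow> x' \<in> ball x0 r \<Longrightarrow>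
       square_on {4 * r..} f x' < \<infinity> \<Longrightarrow>
       sqrt (enn2real (square_on {4 * r..} f x)) \<le> sqrt (enn2real (square_on {4 * r..} f x')) + D * b"
    using square_tail_compare by blast
  show thesis
  proof (rule that[of "(C + 1) / 2 + D"])
    show "0 < (C + 1) / 2 + D" using C(1) D(1) by (simp add: add_pos_pos)
    fix f a b and x0 :: 'a and r :: real
    assume loc: "localized_oscillation f a b" and r: "0 < r"
    have osc: "oscillation_le M f a b" using loc by (auto simp: localized_oscillation_def)
    note f [measurable] = oscillation_leD(1)[OF osc]
    have b: "0 < b" using osc by (rule oscillation_leD)
    let ?L = "square_on {0<..<4 * r} f" and ?T = "square_on {4 * r..} f" and ?g = "g_function M Q f"
    have gsq: "?g z = sqrt (enn2real (?L z) + enn2real (?T z)) \<and> ?T z < \<infinity>" if "g_square M Q f z < \<infinity>" for z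
      using that unfolding g_function_def g_square_split[OF f r] by (simp add: enn2real_plus)
    have "(\<integral>\<^sup>+z\<in>ball x0 r. e2ennreal (ereal (?g z) - ess_inf M (ball x0 r) ?g) \<partial>M)
        \<le> (\<integral>\<^sup>+z\<in>ball x0 r. ennreal (sqrt (enn2real (?L z)) + D * b) \<partial>M)"
    proof (rule nn_integral_mono_AE, use g_square_finite[OF loc] in eventually_elim)
      case (elim z)
      show ?case
      proof (cases "z \<in> ball x0 r")
        case True
        let ?s = "sqrt (enn2real (?L z)) + D * b"
        have "AE z' in M. z' \<in> ball x0 r \<longrightarrow> ereal (?g z - ?s) \<le> ereal (?g z')"
          using g_square_finite[OF loc]
        proof eventually_elim
          case (elim z')
          show ?case
          proof
            assume z': "z' \<in> ball x0 r"
            have "?g z \<le> sqrt (enn2real (?L z)) + sqrt (enn2real (?T z))"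
              using gsq[OF \<open>g_square M Q f z < \<infinity>\<close>] by (simp add: sqrt_add_le_add_sqrt)
            also have "sqrt (enn2real (?T z)) \<le> sqrt (enn2real (?T z')) + D * b"
              using gsq[OF elim] by (intro D(2)[OF loc r True z']) auto
            also have "sqrt (enn2real (?T z')) \<le> ?g z'"
              using gsq[OF elim] by simp
            finally show "ereal (?g z - ?s) \<le> ereal (?g z')" by simp
          qed
        qed
        then have "ereal (?g z - ?s) \<le> ess_inf M (ball x0 r) ?g"
          unfolding ess_inf_def by (intro Sup_upper) auto
        then have "ereal (?g z) - ess_inf M (ball x0 r) ?g \<le> ereal ?s"
          by (cases "ess_inf M (ball x0 r) ?g") auto
        then have "e2ennreal (ereal (?g z) - ess_inf M (ball x0 r) ?g) \<le> e2ennreal (ereal ?s)"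
          by (rule e2ennreal_mono)
        then show ?thesis using True by (simp add: ennreal.rep_eq e2ennreal_ereal)
      qed simp
    qed
    also have "\<dots> \<le> ennreal (((C + 1) / 2 * b + D * b) * V x0 r)"
      using b D C C(2)[OF loc r] by (intro set_nn_integral_sqrt_local square_on_measurable) auto
    also have "(C + 1) / 2 * b + D * b = ((C + 1) / 2 + D) * b" by (simp add: algebra_simps)
    finally show "(\<integral>\<^sup>+z\<in>ball x0 r. e2ennreal (ereal (?g z) - ess_inf M (ball x0 r) ?g) \<partial>M)
        \<le> ennreal (((C + 1) / 2 + D) * b * V x0 r)" .
  qed
qed

lemma g_function_measurable:
  "f \<in> borel_measurable M \<Longrightarrow> g_function M Q f \<in> borel_measurable M"
  unfolding g_function_def[abs_def] g_square_eq
  using square_on_measurable[of f "{0<..}"] by auto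

end

section \<open>From BMO to BLO\<close>

lemma le_mult_of_ennreal_divide_le:
  fixes X :: ennreal
  assumes "0 < v" "0 \<le> b" "X / ennreal v \<le> ennreal b"
  shows "X \<le> ennreal (b * v)"
proof -
  have "X = X / ennreal v * ennreal v"
    using assms(1) ennreal_mult_divide_eq[of "ennreal v" X] by (simp add: ennreal_divide_times)
  also have "\<dots> \<le> ennreal b * ennreal v"
    using assms(3) by (rule mult_right_mono) simp
  finally show ?thesis using assms by (simp add: ennreal_mult)
qed

lemma ennreal_divide_le_of_le_mult:
  fixes X :: ennreal
  assumes "0 < v" "0 \<le> b" "X \<le> ennreal (b * v)"
  shows "X / ennreal v \<le> ennreal b"
  using assms by (intro divide_le_posI_ennreal) (auto simp: ennreal_mult mult.commute)

context doubling_measure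
begin

lemma L1_loc_measurable:
  assumes f: "f \<in> L1_loc M"
  shows "f \<in> borel_measurable M"
proof (rule borel_measurable_LIMSEQ_metric)
  let ?B = "\<lambda>n. ball (undefined :: 'a) (real (Suc n))"
  show "(\<lambda>x. indicator (?B n) x *\<^sub>R f x) \<in> borel_measurable M" for n
    using f unfolding L1_loc_def set_integrable_def by (intro borel_measurable_integrable) auto
  fix x
  show "(\<lambda>n. indicator (?B n) x *\<^sub>R f x) \<longlonglongrightarrow> f x"
  proof (rule tendsto_eventually)
    obtain n where n: "dist undefined x < real n" using reals_Archimedean2 by blast
    show "\<forall>\<^sub>F n in sequentially. indicator (?B n) x *\<^sub>R f x = f x"
      using eventually_ge_at_top[of n]
    proof eventually_elim
      case (elim m)
      then have "dist undefined x < real (Suc m)" using n by simp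
      then show ?case by simp
    qed
  qed
qed

end

context kernel_square_function
begin

lemma BMO_localized_oscillation:
  assumes f: "f \<in> BMO M \<rho>" and b: "0 < b" "BMO_norm M \<rho> f \<le> ennreal b"
  shows "localized_oscillation f (\<lambda>x r. if \<rho> x \<le> r then 0 else avg M (ball x r) f) b"
proof -
  have "(\<integral>\<^sup>+y\<in>ball x r. ennreal (cmod (f y - (if \<rho> x \<le> r then 0 else avg M (ball x r) f))) \<partial>M)
      \<le> ennreal (b * V x r)" if r: "0 < r" for x r
  proof (rule le_mult_of_ennreal_divide_le)
    show "0 < V x r" using r by (rule V_pos)
    show "0 \<le> b" using b by simp
    show "(\<integral>\<^sup>+y\<in>ball x r. ennreal (cmod (f y - (if \<rho> x \<le> r then 0 else avg M (ball x r) f))) \<partial>M)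
        / ennreal (V x r) \<le> ennreal b" (is "?I / _ \<le> _")
    proof (cases "\<rho> x \<le> r")
      case True
      have "?I / ennreal (V x r) \<le> (SUP (x, r)\<in>large_balls \<rho>.
          (\<integral>\<^sup>+z\<in>ball x r. ennreal (cmod (f z)) \<partial>M) / emeasure M (ball x r))"
        using r True by (intro SUP_upper2[of "(x, r)"]) (auto simp: large_balls_def emeasure_ball)
      also have "\<dots> \<le> BMO_norm M \<rho> f" by (simp add: BMO_norm_def)
      finally show ?thesis using b(2) by (rule order_trans)
    next
      case False
      have "?I / ennreal (V x r) \<le> (SUP (x, r)\<in>small_balls \<rho>.
          (\<integral>\<^sup>+z\<in>ball x r. ennreal (cmod (f z - avg M (ball x r) f)) \<partial>M) / emeasure M (ball x r))"
        using r False by (intro SUP_upper2[of "(x, r)"]) (auto simp: small_balls_def emeasure_ball)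
      also have "\<dots> \<le> BMO_norm M \<rho> f" by (simp add: BMO_norm_def)
      finally show ?thesis using b(2) by (rule order_trans)
    qed
  qed
  then show ?thesis
    using f b L1_loc_measurable[of f]
    by (auto simp: localized_oscillation_def oscillation_le_def BMO_def)
qed

lemma g_function_BLO_norm:
  obtains C where "0 < C"
    "\<And>f a b. localized_oscillation f a b \<Longrightarrow> BLO_norm M \<rho> (g_function M Q f) \<le> ennreal (C * b)"
proof -
  obtain C where C: "0 < C"
    "\<And>f a b x0 r. localized_oscillation f a b \<Longrightarrow> 0 < r \<Longrightarrow>
       (\<integral>\<^sup>+z\<in>ball x0 r. e2ennreal (ereal (g_function M Q f z) - ess_inf M (ball x0 r) (g_function M Q f)) \<partial>M)
         \<le> ennreal (C * b * V x0 r)"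
    using g_function_lower_oscillation by blast
  obtain D where D: "0 < D"
    "\<And>f a b x0 r. localized_oscillation f a b \<Longrightarrow> 0 < r \<Longrightarrow> \<rho> x0 \<le> r \<Longrightarrow>
       (\<integral>\<^sup>+z\<in>ball x0 r. ennreal \<bar>g_function M Q f z\<bar> \<partial>M) \<le> ennreal (D * b * V x0 r)"
    using g_function_large_ball by blast
  show thesis
  proof (rule that[of "C + D"])
    show "0 < C + D" using C D by simp
    fix f a b assume loc: "localized_oscillation f a b"
    have b: "0 < b" using loc by (auto simp: localized_oscillation_def oscillation_le_def)
    have "BLO_norm M \<rho> (g_function M Q f) \<le> ennreal (C * b) + ennreal (D * b)"
      unfolding BLO_norm_def
    proof (intro add_mono SUP_least; clarsimp simp: emeasure_ball)
      fix x r assume "(x, r) \<in> small_balls \<rho>"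
      then have r: "0 < r" by (simp add: small_balls_def)
      show "(\<integral>\<^sup>+z\<in>ball x r. e2ennreal (ereal (g_function M Q f z) - ess_inf M (ball x r) (g_function M Q f)) \<partial>M)
          / ennreal (V x r) \<le> ennreal (C * b)"
        using C b r by (intro ennreal_divide_le_of_le_mult C(2)[OF loc] V_pos) auto
    next
      fix x r assume "(x, r) \<in> large_balls \<rho>"
      then have r: "0 < r" "\<rho> x \<le> r" by (simp_all add: large_balls_def)
      show "(\<integral>\<^sup>+z\<in>ball x r. ennreal \<bar>g_function M Q f z\<bar> \<partial>M) / ennreal (V x r) \<le> ennreal (D * b)"
        using D b r by (intro ennreal_divide_le_of_le_mult D(2)[OF loc] V_pos) auto
    qed
    also have "\<dots> = ennreal ((C + D) * b)"
      using C D b by (subst ennreal_plus[symmetric]) (auto simp: algebra_simps)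
    finally show "BLO_norm M \<rho> (g_function M Q f) \<le> ennreal ((C + D) * b)" .
  qed
qed

lemma g_function_L1_loc:
  assumes loc: "localized_oscillation f a b"
  shows "g_function M Q f \<in> L1_loc M"
  unfolding L1_loc_def
proof (intro CollectI allI impI)
  fix x and r :: real assume "0 < r"
  have f: "f \<in> borel_measurable M"
    using loc by (auto simp: localized_oscillation_def oscillation_le_def)
  note [measurable] = g_function_measurable[OF f]
  obtain D where D: "0 < D"
    "\<And>f a b x0 r. localized_oscillation f a b \<Longrightarrow> 0 < r \<Longrightarrow> \<rho> x0 \<le> r \<Longrightarrow>
       (\<integral>\<^sup>+z\<in>ball x0 r. ennreal \<bar>g_function M Q f z\<bar> \<partial>M) \<le> ennreal (D * b * V x0 r)"
    using g_function_large_ball by blast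
  let ?R = "max r (\<rho> x)"
  have "(\<integral>\<^sup>+z. ennreal (norm (indicator (ball x r) z *\<^sub>R g_function M Q f z)) \<partial>M)
      = (\<integral>\<^sup>+z\<in>ball x r. ennreal \<bar>g_function M Q f z\<bar> \<partial>M)"
    by (intro nn_integral_cong) (auto simp: indicator_def)
  also have "\<dots> \<le> (\<integral>\<^sup>+z\<in>ball x ?R. ennreal \<bar>g_function M Q f z\<bar> \<partial>M)"
    by (intro set_nn_integral_mono_set subset_ball) auto
  also have "\<dots> \<le> ennreal (D * b * V x ?R)"
    using \<open>0 < r\<close> by (intro D(2)[OF loc]) auto
  also have "\<dots> < \<infinity>" by simp
  finally show "set_integrable M (ball x r) (g_function M Q f)"
    unfolding set_integrable_def by (intro integrableI_bounded) measurable
qed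

text \<open>
The estimates were proved for positive bounds \<open>b\<close> only. They are applied to every \<open>b\<close> above the norm of
\<open>f\<close>, which covers functions of norm zero.
\<close>

theorem g_function_BMO_BLO:
  "\<exists>C>0. \<forall>f\<in>BMO M \<rho>. (AE x in M. g_square M Q f x < \<infinity>) \<and> g_function M Q f \<in> BLO M \<rho> \<and>
     BLO_norm M \<rho> (g_function M Q f) \<le> ennreal C * BMO_norm M \<rho> f"
proof -
  obtain C where C: "0 < C"
    "\<And>f a b. localized_oscillation f a b \<Longrightarrow> BLO_norm M \<rho> (g_function M Q f) \<le> ennreal (C * b)"
    using g_function_BLO_norm by blast
  show ?thesis
  proof (intro exI[of _ C] conjI ballI)
    show "0 < C" by fact
    fix f assume f: "f \<in> BMO M \<rho>"
    define N where "N = enn2real (BMO_norm M \<rho> f)"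
    have N: "0 \<le> N" "BMO_norm M \<rho> f = ennreal N"
      using f by (auto simp: N_def BMO_def)
    define a where "a = (\<lambda>x r. if \<rho> x \<le> r then 0 else avg M (ball x r) f)"
    have loc: "localized_oscillation f a b" if "N < b" for b
      unfolding a_def using that N by (intro BMO_localized_oscillation[OF f]) (auto intro: ennreal_leI)
    show "AE x in M. g_square M Q f x < \<infinity>"
      by (rule g_square_finite[OF loc[of "N + 1"]]) simp
    have le: "BLO_norm M \<rho> (g_function M Q f) \<le> ennreal (C * N)"
    proof (rule ennreal_le_epsilon)
      fix e :: real assume e: "0 < e"
      have "BLO_norm M \<rho> (g_function M Q f) \<le> ennreal (C * (N + e / C))"
        using e C(1) by (intro C(2)[OF loc]) simp
      also have "C * (N + e / C) = C * N + e" using C(1) by (simp add: distrib_left)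
      also have "ennreal \<dots> = ennreal (C * N) + ennreal e" using e C(1) N(1) by (intro ennreal_plus) auto
      finally show "BLO_norm M \<rho> (g_function M Q f) \<le> ennreal (C * N) + ennreal e" .
    qed
    then show "BLO_norm M \<rho> (g_function M Q f) \<le> ennreal C * BMO_norm M \<rho> f"
      unfolding N(2) using C(1) N(1) by (simp add: ennreal_mult)
    have "BLO_norm M \<rho> (g_function M Q f) < \<infinity>" using le by (auto intro: le_less_trans)
    moreover have "g_function M Q f \<in> L1_loc M"
      by (rule g_function_L1_loc[OF loc[of "N + 1"]]) simp
    ultimately show "g_function M Q f \<in> BLO M \<rho>" by (simp add: BLO_def)
  qed
qed

end

text \<open>
The admissibility inequality is used with \<open>x\<close> and \<open>y\<close> exchanged, where its last factor is at most
\<open>2 powr k0\<close>.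
\<close>

lemma admissible_comparable:
  assumes "admissible \<rho>"
  obtains c where "1 \<le> c" "\<And>x y. dist x y \<le> \<rho> x \<Longrightarrow> \<rho> x \<le> c * \<rho> y"
proof -
  obtain C0 k0 where C0: "0 < C0" "0 < k0"
    and adm: "\<And>x y. 1 / \<rho> x \<le> C0 * (1 / \<rho> y) * (1 + dist x y / \<rho> y) powr k0"
    and pos: "\<And>x. 0 < \<rho> x"
    using assms unfolding admissible_def by blast
  show thesis
  proof (rule that[of "max 1 (C0 * 2 powr k0)"])
    fix x y assume d: "dist x y \<le> \<rho> x"
    have "1 + dist y x / \<rho> x \<le> 2" using d pos[of x] by (simp add: dist_commute)
    then have "(1 + dist y x / \<rho> x) powr k0 \<le> 2 powr k0"
      using C0 pos[of x] by (intro powr_mono2) (auto intro!: add_nonneg_nonneg divide_nonneg_pos)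
    then have "C0 * (1 / \<rho> x) * (1 + dist y x / \<rho> x) powr k0 \<le> C0 * (1 / \<rho> x) * 2 powr k0"
      using C0 pos[of x] by (intro mult_left_mono) auto
    then have "1 / \<rho> y \<le> C0 * (1 / \<rho> x) * 2 powr k0"
      using adm[of y x] by linarith
    then have "\<rho> x \<le> C0 * 2 powr k0 * \<rho> y"
      using pos[of x] pos[of y] by (simp add: field_simps)
    also have "\<dots> \<le> max 1 (C0 * 2 powr k0) * \<rho> y"
      using pos[of y] by (intro mult_right_mono) auto
    finally show "\<rho> x \<le> max 1 (C0 * 2 powr k0) * \<rho> y" .
  qed simp
qed

theorem corollary6p1:
  fixes M :: "'a::metric_space measure"
    and \<rho> :: "'a \<Rightarrow> real"
    and Q :: "real \<Rightarrow> 'a \<Rightarrow> 'a \<Rightarrow> complex"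
    and C1 \<delta>1 \<beta> \<delta>2 \<gamma> :: real
  assumes "RD_space M"
    and "admissible \<rho>"
    and "(\<lambda>(t, x, y). Q t x y)
           \<in> borel_measurable (restrict_space borel {0<..} \<Otimes>\<^sub>M (M \<Otimes>\<^sub>M M))"
    and "\<And>t. 0 < t \<Longrightarrow> L2_bounded M (kernel_op M (Q t))"
    and "0 < C1" and "0 < \<delta>1" and "0 < \<beta>" and "\<beta> \<le> 1" and "0 < \<delta>2" and "\<delta>2 < 1" and "0 < \<gamma>"
    and Q_i: "\<And>t x y. 0 < t \<Longrightarrow>
           cmod (Q t x y) \<le> C1 * (1 / (vol M t x + vol2 M x y))
             * (t / (t + dist x y)) powr \<gamma> * (\<rho> x / (t + \<rho> x)) powr \<delta>1"
    and Q_ii: "\<And>t x x' y. 0 < t \<Longrightarrow> dist x x' \<le> t / 2 \<Longrightarrow>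
           cmod (Q t x y - Q t x' y) \<le> C1 * (dist x x' / (t + dist x y)) powr \<beta>
             * (1 / (vol M t x + vol2 M x y)) * (t / (t + dist x y)) powr \<gamma>"
    and Q_iii: "\<And>t x. 0 < t \<Longrightarrow>
           cmod (\<integral>y. Q t x y \<partial>M) \<le> C1 * (t / (t + \<rho> x)) powr \<delta>2"
    and g_finite: "\<And>f. f \<in> L2 M \<Longrightarrow> AE x in M. g_square M Q f x < \<infinity>"
    and g_bounded: "L2_bounded M (g_function M Q)"
  shows "\<exists>C>0. \<forall>f\<in>BMO M \<rho>.
           (AE x in M. g_square M Q f x < \<infinity>) \<and>
           g_function M Q f \<in> BLO M \<rho> \<and>
           BLO_norm M \<rho> (g_function M Q f) \<le> ennreal C * BMO_norm M \<rho> f"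
proof -
  have reg: "regular_borel_measure M"
    and ball: "\<And>x r. 0 < r \<Longrightarrow> 0 < emeasure M (ball x r) \<and> emeasure M (ball x r) < \<infinity>"
    using assms(1) unfolding RD_space_def by blast+
  obtain A where A: "1 \<le> A" "\<And>x r. 0 < r \<Longrightarrow> measure M (ball x (2 * r)) \<le> A * measure M (ball x r)"
    using assms(1) unfolding RD_space_def by blast
  obtain c where c: "1 \<le> c" "\<And>x y. dist x y \<le> \<rho> x \<Longrightarrow> \<rho> x \<le> c * \<rho> y"
    using admissible_comparable[OF assms(2)] by blast
  have smooth: "cmod (Q t x y - Q t x' y) \<le> C1 * (dist x x' / t) powr \<beta> * decay_kernel M \<gamma> t x y"
    if t: "0 < t" and x: "dist x x' \<le> t / 2" for t x x' y
  proof -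
    have "dist x x' / (t + dist x y) \<le> dist x x' / t"
      using t by (intro divide_left_mono) (auto intro!: mult_pos_pos add_pos_nonneg)
    then have "(dist x x' / (t + dist x y)) powr \<beta> \<le> (dist x x' / t) powr \<beta>"
      using t \<open>0 < \<beta>\<close> by (intro powr_mono2) auto
    then have "C1 * (dist x x' / (t + dist x y)) powr \<beta> * decay_kernel M \<gamma> t x y
        \<le> C1 * (dist x x' / t) powr \<beta> * decay_kernel M \<gamma> t x y"
      using \<open>0 < C1\<close> by (intro mult_right_mono mult_left_mono) auto
    then show ?thesis
      using Q_ii[OF t x, of y] by (simp add: decay_kernel_def mult.assoc)
  qed
  interpret kernel_square_function M A \<rho> c Q C1 \<delta>1 \<beta> \<delta>2 \<gamma>
  proof
    show "sets M = sets borel" using reg by (simp add: regular_borel_measure_def)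
    show "emeasure M E = (INF U\<in>{U. E \<subseteq> U \<and> open U}. emeasure M U)" if "E \<in> sets borel" for E
      using reg that by (simp add: regular_borel_measure_def)
    show "cmod (Q t x y) \<le> C1 * (\<rho> x / (t + \<rho> x)) powr \<delta>1 * decay_kernel M \<gamma> t x y" if "0 < t" for t x y
      using Q_i[OF that, of x y] by (simp add: decay_kernel_def ac_simps)
    show "0 < \<rho> x" for x using assms(2) by (simp add: admissible_def)
  qed (use ball A c assms smooth in \<open>auto simp del: space_restrict_space\<close>)
  show ?thesis by (rule g_function_BMO_BLO)
qed

end
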